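(* Let $g \in C^2(\mathbb{R})$ satisfy $g''(t) > 0$ for all $t \in \mathbb{R}$ and $g(0) = g'(0) = 0$, and let $f(X) = g(\det X)$ for $X \in \mathbb{R}^{2\times 2}$. Let $\Omega \subset \mathbb{R}^2$ be open and connected and let $u : \Omega \to \mathbb{R}^2$ be a Lipschitz map that is a stationary point of the energy $\int_\Omega f(Du)\,dx$, i.e. $u$ solves in the weak sense in $\Omega$ both $$\operatorname{div}(Df(Du)) = 0 \quad\text{and}\quad \operatorname{div}\big(Du^T Df(Du) - f(Du)\,\mathrm{id}\big) = 0.$$ Then $x \mapsto \det(Du)(x)$ is constant (i.e. equal to a constant a.e. in $\Omega$).
   Context: $Du$ is the a.e. defined Jacobian matrix, $(Du)_{ij} = \partial_j u_i$. For $X\in\mathbb{R}^{2\times 2}$, $Df(X)$ is the matrix of partial derivatives of $f$ with respect to the entries of $X$; explicitly $Df(X) = g'(\det X)\operatorname{cof}^T(X)$, where $\operatorname{cof}(X)$ is the matrix satisfying $X\operatorname{cof}(X) = \operatorname{cof}(X)X = \det(X)\,\mathrm{id}$ with entries $\operatorname{cof}(X)_{ij} = (-1)^{i+j}\det(M_{ji}(X))$ ($M_{ji}(X)$ is $X$ with the $j$-th row and $i$-th column deleted), and $\operatorname{cof}^T(X)$ is its transpose. Divergences of matrix fields are taken row-wise; $\operatorname{div}(A) = 0$ weakly means $\int_\Omega \langle A, D\eta\rangle\,dx = 0$ for all $\eta \in C_c^\infty(\Omega,\mathbb{R}^2)$, with $\langle\cdot,\cdot\rangle$ the Hilbert-Schmidt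 scalar product. *)

theory Defs
  imports "HOL-Analysis.Analysis"
begin

(* C_k k f: all iterated directional derivatives of order at most k exist and are continuous on
   the whole space; on a Euclidean space this is the usual class C^k. *)
primrec C_k :: "nat \<Rightarrow> ('a::real_normed_vector \<Rightarrow> 'b::real_normed_vector) \<Rightarrow> bool" where
  "C_k 0 f \<longleftrightarrow> continuous_on UNIV f"
| "C_k (Suc k) f \<longleftrightarrow>
     (\<forall>x. f differentiable (at x)) \<and> (\<forall>v. C_k k (\<lambda>x. frechet_derivative f (at x) v))"

(* Elements of C_c^infinity(Omega, R^2) are represented by their extensions by zero to R^2. *)
definition test_fields :: "(real^2) set \<Rightarrow> (real^2 \<Rightarrow> real^2) set" where
  "test_fields \<Omega> =
     {\<eta>. (\<forall>k. C_k k \<eta>) \<and> compact (closure {x. \<eta> x \<noteq> 0}) \<and> closure {x. \<eta> x \<noteq> 0} \<subseteq> \<Omega>}"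

(* jacobian u (at x) $ i $ j is the partial derivative of u_i in direction j; by Rademacher's
   theorem it is meaningful almost everywhere when u is Lipschitz near x. *)
abbreviation D :: "(real^2 \<Rightarrow> real^2) \<Rightarrow> real^2 \<Rightarrow> real^2^2" where
  "D u x \<equiv> jacobian u (at x)"

definition matrix_gradient :: "(real^2^2 \<Rightarrow> real) \<Rightarrow> real^2^2 \<Rightarrow> real^2^2" where
  "matrix_gradient f X = (\<chi> i j. deriv (\<lambda>t. f (X + t *\<^sub>R axis i (axis j 1))) 0)"

(* Row-wise divergence. The inner product of real^2^2 is the Hilbert-Schmidt one. The integrand is
   integrable whenever A is measurable and locally bounded on Omega. *)
definition weakly_div_free :: "(real^2) set \<Rightarrow> (real^2 \<Rightarrow> real^2^2) \<Rightarrow> bool" where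
  "weakly_div_free \<Omega> A \<longleftrightarrow>
     (\<forall>\<eta>\<in>test_fields \<Omega>. (LINT x:\<Omega>|lebesgue. A x \<bullet> D \<eta> x) = 0)"

definition stationary_point :: "(real^2^2 \<Rightarrow> real) \<Rightarrow> (real^2) set \<Rightarrow> (real^2 \<Rightarrow> real^2) \<Rightarrow> bool" where
  "stationary_point f \<Omega> u \<longleftrightarrow>
     weakly_div_free \<Omega> (\<lambda>x. matrix_gradient f (D u x)) \<and>
     weakly_div_free \<Omega>
       (\<lambda>x. transpose (D u x) ** matrix_gradient f (D u x) - f (D u x) *\<^sub>R mat 1)"

end

theory Submission
  imports Defs "HOL-Complex_Analysis.Great_Picard"
begin

text \<open>
  Write \<open>d = det Du\<close>. Since \<open>Du\<^sup>T Df(Du) = g'(d) d id\<close>, the second equation says that \<open>h(d)\<close> is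
  locally constant, where \<open>h(s) = g'(s) s - g(s)\<close>. As \<open>h'(s) = s g''(s)\<close>, the function \<open>h\<close> is
  injective on each closed half line, so locally \<open>d\<close> takes at most two values \<open>a \<le> 0 < b\<close>. The rows
  of \<open>cof\<^sup>T(Du)\<close> are divergence free, hence the first equation says that \<open>1\<^sub>E Du\<close> is curl free, where
  \<open>E = {d = b}\<close>. So \<open>1\<^sub>E Du = Dv\<close> with \<open>|Dv|\<^sup>2 \<le> C det Dv = C b 1\<^sub>E\<close>, and it has to be shown that a
  map of bounded distortion cannot have \<open>Dv = 0\<close> on a set that is neither null nor of full measure.

  On squares \<open>Q\<^sub>r\<close> the isoperimetric inequality gives \<open>b |E \<inter> Q\<^sub>r| \<le> (C |E \<inter> Q\<^sub>s| / (s - r))\<^sup>2\<close>,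
  and De Giorgi's iteration turns small density of \<open>E\<close> in a square into nullity in a smaller one. This
  starts at a density point of the complement, so \<open>v\<close> is constant, say \<open>0\<close>, on some square. Green's
  formula for \<open>X(v)\<close> with \<open>X(y) = y / (|y|\<^sup>2 + \<delta>\<^sup>2)\<close> gives
  \<open>\<integral>\<^sub>r \<psi>(v) 1\<^sub>E \<le> C \<integral>\<^sub>s |X(v)| 1\<^sub>E\<close> with \<open>\<psi> = 2\<delta>\<^sup>2 / (|v|\<^sup>2 + \<delta>\<^sup>2)\<^sup>2\<close>. As \<open>\<delta>\<close> tends to \<open>0\<close>, a
  first use shows that \<open>E \<inter> {v = 0}\<close> is null, and a second one that \<open>\<delta> \<integral> \<psi>(v) 1\<^sub>E\<close> tends to \<open>0\<close>.
  This integral controls the gradient of \<open>T = \<delta>\<^sup>4 / (|v|\<^sup>2 + \<delta>\<^sup>2)\<^sup>2\<close>, which equals \<open>1\<close> on the small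
  square, so by Poincare's inequality \<open>T\<close> tends to \<open>1\<close>, that is, \<open>v = 0\<close> on the large square.
\<close>

section \<open>Rademacher's theorem in the plane\<close>

text \<open>The last reduction is a case of the theorem that a nonconstant quasiregular map has
  nonzero Jacobian almost everywhere; that the Jacobian of \<open>v\<close> takes only the values
  \<open>0\<close> and \<open>b\<close> permits a direct proof. Bounded distortion comes for free:
  \<open>u\<close> is Lipschitz and \<open>d = b\<close> on \<open>E\<close>. The first equation
  enters through \<open>1\<^sub>E = (g'(d) - g'(a)) / (g'(b) - g'(a))\<close>, where the denominator
  is positive because \<open>g'\<close> increases strictly.

  The field \<open>X\<close> smooths \<open>y / |y|\<^sup>2\<close>, the gradient of
  \<open>log |y|\<close>, so its divergence concentrates at the origin at scale \<delta>. On
  \<open>{v = 0}\<close> the weight \<open>\<psi>(v)\<close> is \<open>2 / \<delta>\<^sup>2\<close>,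
  whereas \<open>|X(v)| \<le> 1 / \<delta>\<close> everywhere: the first use bounds the measure of
  \<open>E \<inter> {v = 0}\<close> by a multiple of \<delta>.

  As \<open>v\<close> is only Lipschitz, the integral identities are proved for mollifications,
  whose gradients and Jacobians are close to the true ones in \<open>L\<^sup>1\<close>. For fixed
  \<delta> the smoothing parameter goes to its limit first; \<delta> follows.\<close>

text \<open>The Stieltjes measures of \<open>F\<close> and \<open>G\<close> add up to \<open>c\<close> times the Lebesgue measure.\<close>
lemma lipschitz_interval_measure_absolutely_continuous:
  fixes F G :: "real \<Rightarrow> real"
  assumes F: "mono F" "continuous_on UNIV F" and G: "mono G" "continuous_on UNIV G"
    and c: "0 < c" and sum: "\<And>x. F x + G x = c * x"
  shows "absolutely_continuous lborel (interval_measure F)"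
proof -
  let ?N = "interval_measure F" and ?N' = "interval_measure G"
  have emF: "emeasure ?N {a<..b} = ennreal (F b - F a)" if "a \<le> b" for a b
    using F that by (intro emeasure_interval_measure_Ioc)
      (auto simp: mono_def continuous_on_eq_continuous_at continuous_at_imp_continuous_at_within)
  have emG: "emeasure ?N' {a<..b} = ennreal (G b - G a)" if "a \<le> b" for a b
    using G that by (intro emeasure_interval_measure_Ioc)
      (auto simp: mono_def continuous_on_eq_continuous_at continuous_at_imp_continuous_at_within)
  let ?m = "\<lambda>A. (emeasure ?N A + emeasure ?N' A) / ennreal c"
  define M where "M = measure_of UNIV (sets borel) ?m"
  have "countably_additive (sets borel) ?m"
  proof (rule countably_additiveI)
    fix A :: "nat \<Rightarrow> real set"
    assume A: "range A \<subseteq> sets borel" "disjoint_family A" "(\<Union>i. A i) \<in> sets borel"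
    have "(\<Sum>i. ?m (A i)) = (\<Sum>i. emeasure ?N (A i) + emeasure ?N' (A i)) / ennreal c"
      by (rule ennreal_suminf_divide)
    also have "(\<Sum>i. emeasure ?N (A i) + emeasure ?N' (A i)) = emeasure ?N (\<Union>i. A i) + emeasure ?N' (\<Union>i. A i)"
      using A by (subst suminf_add[symmetric]) (auto simp: suminf_emeasure)
    finally show "(\<Sum>i. ?m (A i)) = ?m (\<Union>i. A i)" .
  qed
  then have M: "emeasure M A = ?m A" if "A \<in> sets borel" for A
    unfolding M_def using that
    by (intro emeasure_measure_of_sigma sets.sigma_algebra_axioms[of borel, simplified])
      (auto simp: positive_def)
  have setsM: "sets M = sets borel"
    unfolding M_def using sets.sigma_sets_eq[of "borel :: real measure"] by simp
  have "lborel = M"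
  proof (rule lborel_eqI)
    fix l u :: real assume lu: "\<And>b. b \<in> Basis \<Longrightarrow> l \<bullet> b \<le> u \<bullet> b"
    then have le: "l \<le> u" by simp
    \<comment> \<open>\<open>lborel_eqI\<close> speaks of open intervals, the Stieltjes measures of
      half-open ones; by continuity of \<open>F\<close> and \<open>G\<close> the end point is null
      for both.\<close>
    have sg: "emeasure ?N {u} = 0" "emeasure ?N' {u} = 0"
      using emeasure_interval_measure_Icc[of u u F] emeasure_interval_measure_Icc[of u u G] F G
      by (auto simp: mono_def)
    have "emeasure M {l<..u} = ennreal (F u - F l + (G u - G l)) / ennreal c"
      using F G le by (subst M) (auto simp: emF emG ennreal_plus mono_def)
    also have "F u - F l + (G u - G l) = c * (u - l)"
      using sum[of u] sum[of l] by (simp add: algebra_simps)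
    also have "ennreal (c * (u - l)) / ennreal c = ennreal (u - l)"
      using c le by (simp add: divide_ennreal)
    finally have 1: "emeasure M {l<..u} = ennreal (u - l)" .
    have 2: "emeasure M {u} = 0"
      using sg by (subst M) auto
    have "emeasure M (box l u) = emeasure M ({l<..u} - {u})"
      by (rule arg_cong[where f="emeasure M"]) (auto simp: box_real)
    also have "\<dots> = ennreal (u - l)"
      using 1 2 setsM by (subst emeasure_Diff_null_set) (auto simp: null_sets_def)
    finally show "emeasure M (box l u) = ennreal (\<Prod>b\<in>Basis. (u - l) \<bullet> b)"
      by simp
  qed (simp add: setsM)
  show ?thesis
    unfolding absolutely_continuous_def
  proof
    fix A :: "real set" assume "A \<in> null_sets lborel"
    then have "emeasure M A = 0" and A: "A \<in> sets borel"
      by (auto simp: null_sets_def \<open>lborel = M\<close> setsM)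
    then have "emeasure ?N A + emeasure ?N' A = 0"
      by (subst (asm) M) (auto simp: ennreal_divide_eq_0_iff)
    then show "A \<in> null_sets ?N" using A by (auto simp: null_sets_def)
  qed
qed

text \<open>\<open>K * x + f x\<close> and \<open>K * x - f x\<close> both increase, and their
  Stieltjes measures add up to \<open>2 * K\<close> times Lebesgue measure. So the first one has a
  density by Radon-Nikodym, and its primitive is differentiable from the right by Lebesgue's
  theorem.\<close>

lemma lipschitz_right_derivative:
  fixes f :: "real \<Rightarrow> real"
  assumes "L-lipschitz_on UNIV f"
  shows "AE x in lborel. \<exists>D. ((\<lambda>t. (f (x + t) - f x) / t) \<longlongrightarrow> D) (at_right 0)"
proof -
  \<comment> \<open>\<open>L\<close> may be \<open>0\<close>; the extra \<open>1\<close> keeps the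
    constant in the sum of the measures positive.\<close>
  define K where "K = L + 1"
  have L: "0 \<le> L" "\<And>x y. \<bar>f x - f y\<bar> \<le> L * \<bar>x - y\<bar>"
    using assms by (auto simp: lipschitz_on_def dist_real_def)
  have K: "0 < K" "\<bar>f x - f y\<bar> \<le> K * \<bar>x - y\<bar>" for x y
    using L(1) L(2)[of x y] unfolding K_def by (simp_all add: distrib_right)
  define F where "F x = f x + K * x" for x
  have contf: "continuous_on UNIV f" using assms by (rule lipschitz_on_continuous_on)
  have K': "\<bar>f x - f y\<bar> \<le> K * y - K * x" if "x \<le> y" for x y
    using K(2)[of x y] that by (simp add: right_diff_distrib')
  have F: "mono F" "continuous_on UNIV F"
  proof -
    show "mono F" unfolding mono_def F_def
    proof (intro allI impI)
      fix x y :: real assume "x \<le> y" with K(2)[of x y] show "f x + K * x \<le> f y + K * y"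
        using K'[of x y] by linarith
    qed
    show "continuous_on UNIV F" unfolding F_def by (intro continuous_intros contf)
  qed
  have G: "mono (\<lambda>x. K * x - f x)" "continuous_on UNIV (\<lambda>x. K * x - f x)"
  proof -
    show "mono (\<lambda>x. K * x - f x)" unfolding mono_def
    proof (intro allI impI)
      fix x y :: real assume "x \<le> y" with K(2)[of x y] show "K * x - f x \<le> K * y - f y"
        using K'[of x y] by linarith
    qed
    show "continuous_on UNIV (\<lambda>x. K * x - f x)" by (intro continuous_intros contf)
  qed
  let ?N = "interval_measure F"
  have "absolutely_continuous lborel ?N"
  proof (rule lipschitz_interval_measure_absolutely_continuous[OF F G])
    show "0 < 2 * K" using K(1) by simp
    show "F x + (K * x - f x) = 2 * K * x" for x by (simp add: F_def)
  qed
  then have "\<exists>h\<in>borel_measurable lborel. density lborel h = ?N"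
    by (intro sigma_finite_measure.Radon_Nikodym lborel.sigma_finite_measure_axioms) simp_all
  then obtain h where h[measurable]: "h \<in> borel_measurable lborel" and dens: "density lborel h = ?N"
    by blast
  have emF: "emeasure ?N {a<..b} = ennreal (F b - F a)" if "a \<le> b" for a b
    using F that by (intro emeasure_interval_measure_Ioc)
      (auto simp: mono_def continuous_on_eq_continuous_at continuous_at_imp_continuous_at_within)
  have nn: "(\<integral>\<^sup>+x. h x * indicator {a..b} x \<partial>lborel) = ennreal (F b - F a)" if "a \<le> b" for a b
  proof -
    have "(\<integral>\<^sup>+x. h x * indicator {a..b} x \<partial>lborel) = (\<integral>\<^sup>+x. h x * indicator {a<..b} x \<partial>lborel)"
      by (rule nn_integral_cong_AE[OF eventually_mono[OF AE_lborel_singleton[of a]]]) (auto simp: indicator_def)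
    also have "\<dots> = emeasure (density lborel h) {a<..b}"
      by (simp add: emeasure_density)
    finally show ?thesis using emF[OF that] by (simp add: dens)
  qed
  define H where "H x = enn2real (h x)" for x
  have [measurable]: "H \<in> borel_measurable borel"
    unfolding H_def using h by simp
  \<comment> \<open>The density takes extended values. Its integrals over \<open>[-n, n]\<close> are
    finite, so it may be replaced by a real function.\<close>
  have finAE: "AE x in lborel. h x < top"
  proof -
    have "AE x in lborel. h x * indicator {- real n..real n} x \<noteq> \<infinity>" for n
      by (rule nn_integral_PInf_AE) (auto simp: nn)
    then have "AE x in lborel. \<forall>n. h x * indicator {- real n..real n} x \<noteq> \<infinity>"
      by (simp add: AE_all_countable)
    then show ?thesis
    proof eventually_elim
      case (elim x)
      obtain n where "\<bar>x\<bar> \<le> real n" using real_arch_simple by blast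
      then have "- real n \<le> x \<and> x \<le> real n" by linarith
      with elim[rule_format, of n] show ?case by (auto simp: indicator_def less_top)
    qed
  qed
  have HI: "(H has_integral (F b - F a)) {a..b}" if ab: "a \<le> b" for a b
  proof -
    have "(\<integral>\<^sup>+x. ennreal (H x * indicator {a..b} x) \<partial>lborel) = (\<integral>\<^sup>+x. h x * indicator {a..b} x \<partial>lborel)"
      using finAE by (intro nn_integral_cong_AE) (auto simp: H_def indicator_def elim!: eventually_mono)
    then have "((\<lambda>x. H x * indicator {a..b} x) has_integral (F b - F a)) UNIV"
      using F ab by (intro nn_integral_has_integral) (auto simp: nn mono_def H_def)
    moreover have "(\<lambda>x. H x * indicator {a..b} x) = (\<lambda>x. if x \<in> {a..b} then H x else 0)"
      by (auto simp: indicator_def)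
    ultimately show ?thesis using has_integral_restrict_UNIV by metis
  qed
  have "H integrable_on cbox a b" for a b
    using HI[of a b] by (cases "a \<le> b") (auto simp: integrable_on_def)
  \<comment> \<open>The averages are over intervals that start at \<open>x\<close>; hence only a
    right derivative is obtained.\<close>
  then obtain N where N: "negligible N"
       "\<And>x e. \<lbrakk>x \<notin> N; 0 < e\<rbrakk> \<Longrightarrow>
               \<exists>d>0. \<forall>t. 0 < t \<and> t < d \<longrightarrow>
                  norm(integral (cbox x (x + t *\<^sub>R One)) H /\<^sub>R t ^ DIM(real) - H x) < e"
    by (rule integrable_ccontinuous_explicit) blast
  have lim: "((\<lambda>t. (f (x + t) - f x) / t) \<longlongrightarrow> H x - K) (at_right 0)" if x: "x \<notin> N" for x
  proof (rule tendstoI)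
    fix e :: real assume e: "0 < e"
    obtain d where d: "d > 0" "\<And>t. 0 < t \<Longrightarrow> t < d \<Longrightarrow>
        norm(integral (cbox x (x + t *\<^sub>R One)) H /\<^sub>R t ^ DIM(real) - H x) < e"
      using N(2)[OF x e] by auto
    show "\<forall>\<^sub>F t in at_right 0. dist ((f (x + t) - f x) / t) (H x - K) < e"
      unfolding eventually_at_right_field
    proof (intro exI conjI allI impI)
      fix t assume t: "0 < t" "t < d"
      have "integral {x..x+t} H = f (x + t) - f x + K * t"
        using HI[of x "x+t"] t by (simp add: integral_unique F_def algebra_simps)
      then have "integral {x..x+t} H / t - K = (f (x + t) - f x) / t"
        using t by (simp add: field_simps)
      with d(2)[OF t] show "dist ((f (x + t) - f x) / t) (H x - K) < e"
        by (simp add: dist_real_def inverse_eq_divide algebra_simps)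
    qed (rule d)
  qed
  have "AE x in lebesgue. x \<notin> N"
    using N(1) by (simp add: negligible_iff_null_sets AE_not_in)
  then have "AE x in lborel. x \<notin> N" by (simp add: AE_completion_iff)
  then show ?thesis by eventually_elim (use lim in blast)
qed

text \<open>Lebesgue differentiation of the indicator function of \<open>B\<close> at points where
  it is \<open>0\<close>. It serves twice: for complements of closed sets in
  \<open>closed_porosity_null\<close>, and for \<open>E\<close> in
  \<open>null_or_full\<close>.\<close>

lemma box_density_complement:
  fixes B :: "(real \<times> real) set"
  assumes B: "B \<in> sets lebesgue"
  obtains N where "negligible N"
    "\<And>x e. x \<notin> N \<Longrightarrow> x \<notin> B \<Longrightarrow> 0 < e \<Longrightarrow> \<exists>d>0. \<forall>h. 0 < h \<and> h < d \<longrightarrow>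
       measure lebesgue (B \<inter> cbox x (x + h *\<^sub>R (1, 1))) < e * h\<^sup>2"
proof -
  have One: "(One :: real \<times> real) = (1, 1)"
    by (simp add: Basis_prod_def sum.union_disjoint sum.reindex inj_on_def)
  have m: "B \<inter> cbox a b \<in> lmeasurable" for a b
    using B by (intro bounded_set_imp_lmeasurable) (auto intro: bounded_subset[OF bounded_cbox])
  have "(indicator B :: _ \<Rightarrow> real) integrable_on cbox a b" for a b
    using m by (simp add: integrable_on_indicator)
  then obtain N where N: "negligible N" "\<And>x e. \<lbrakk>x \<notin> N; 0 < e\<rbrakk> \<Longrightarrow>
      \<exists>d>0. \<forall>h. 0 < h \<and> h < d \<longrightarrow> norm(integral (cbox x (x + h *\<^sub>R One)) (indicator B :: _ \<Rightarrow> real)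
        /\<^sub>R h ^ DIM(real \<times> real) - indicator B x) < e"
    by (rule integrable_ccontinuous_explicit) blast
  show ?thesis
  proof (rule that[OF N(1)])
    fix x and e :: real assume x: "x \<notin> N" "x \<notin> B" "0 < e"
    from N(2)[OF x(1,3)] obtain d where d: "d > 0" "\<And>h. 0 < h \<Longrightarrow> h < d \<Longrightarrow>
       norm(integral (cbox x (x + h *\<^sub>R One)) (indicator B :: _ \<Rightarrow> real)
        /\<^sub>R h ^ DIM(real \<times> real) - indicator B x) < e" by blast
    show "\<exists>d>0. \<forall>h. 0 < h \<and> h < d \<longrightarrow> measure lebesgue (B \<inter> cbox x (x + h *\<^sub>R (1, 1))) < e * h\<^sup>2"
    proof (intro exI conjI allI impI; (elim conjE)?)
      fix h assume h: "0 < h" "h < d"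
      have "integral (cbox x (x + h *\<^sub>R One)) (indicator B :: _ \<Rightarrow> real)
          = measure lebesgue (B \<inter> cbox x (x + h *\<^sub>R One))"
        by (rule integral_indicator[OF m])
      with d(2)[OF h] x show "measure lebesgue (B \<inter> cbox x (x + h *\<^sub>R (1, 1))) < e * h\<^sup>2"
        using h by (simp add: One indicator_def power2_eq_square field_simps)
    qed (rule d)
  qed
qed

lemma cbox_square: "cbox (a, b) ((a, b) + h *\<^sub>R (1, 1)) = {a..a + h} \<times> {b..b + h :: real}"
  by (simp add: cbox_Pair_eq)

lemma measure_rectangle:
  "a \<le> b \<Longrightarrow> c \<le> d \<Longrightarrow> measure lebesgue ({a..b} \<times> {c..d :: real}) = (b - a) * (d - c :: real)"
  by (simp add: cbox_Pair_eq[symmetric, of a b c d, simplified] content_Pair)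

text \<open>The boxes of \<open>box_density_complement\<close> have \<open>x\<close> as a corner; reflections in the axes cover the four quadrants.\<close>
lemma closed_porosity_null:
  fixes K :: "(real \<times> real) set"
  assumes K: "closed K"
  obtains N where "negligible N"
    "\<And>x e. x \<notin> N \<Longrightarrow> x \<in> K \<Longrightarrow> 0 < e \<Longrightarrow>
       \<exists>d>0. \<forall>y. dist y x < d \<longrightarrow> (\<exists>z\<in>K. dist z y \<le> e * dist y x)"
proof -
  define S :: "real \<times> real \<Rightarrow> real \<times> real \<Rightarrow> real \<times> real"
    where "S s x = (fst s * fst x, snd s * snd x)" for s x
  define I :: "(real \<times> real) set" where "I = {1, -1} \<times> {1, -1}"
  have SS: "S s (S s x) = x" if "s \<in> I" for s x
    using that by (auto simp: S_def I_def)
  have lin: "linear (S s)" for s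
    by (auto simp: S_def linear_iff algebra_simps)
  have dS: "dist (S s x) (S s y) = dist x y" if "s \<in> I" for s x y
    using that by (auto simp: S_def I_def dist_prod_def dist_real_def abs_minus_commute algebra_simps)
      (simp_all add: power2_commute abs_minus_commute)
  have cl: "closed (S s -` K)" for s
    using K by (intro continuous_closed_vimage) (auto simp: S_def[abs_def] intro!: continuous_intros)
  have "\<exists>N. negligible N \<and> (\<forall>x e. x \<notin> N \<longrightarrow> x \<in> S s -` K \<longrightarrow> 0 < e \<longrightarrow> (\<exists>d>0. \<forall>h. 0 < h \<and> h < d \<longrightarrow>
       measure lebesgue (- (S s -` K) \<inter> cbox x (x + h *\<^sub>R (1, 1))) < e * h\<^sup>2))" for s
  proof -
    have "- (S s -` K) \<in> sets lebesgue" using cl[of s] by (simp add: borel_open sets_completionI_sets)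
    from box_density_complement[OF this] show ?thesis by (metis ComplD ComplI)
  qed
  then obtain N where N: "\<And>s. negligible (N s)"
    "\<And>s x e. x \<notin> N s \<Longrightarrow> x \<in> S s -` K \<Longrightarrow> 0 < e \<Longrightarrow> \<exists>d>0. \<forall>h. 0 < h \<and> h < d \<longrightarrow>
       measure lebesgue (- (S s -` K) \<inter> cbox x (x + h *\<^sub>R (1, 1))) < e * h\<^sup>2"
    by metis
  have finI: "finite I" by (simp add: I_def)
  show ?thesis
  proof (rule that)
    show "negligible (\<Union>s\<in>I. S s ` N s)"
      using finI N(1) lin by (intro negligible_Union)
        (auto intro!: negligible_differentiable_image_negligible linear_imp_differentiable_on)
    fix x and e :: real assume x: "x \<notin> (\<Union>s\<in>I. S s ` N s)" "x \<in> K" and e0: "0 < e"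
    define \<epsilon> where "\<epsilon> = min e 1"
    have e: "0 < \<epsilon>" "\<epsilon> \<le> 1" "\<epsilon> \<le> e" using e0 by (auto simp: \<epsilon>_def)
    \<comment> \<open>If \<open>K\<close> had no point within \<open>e * \<rho>\<close> of
      \<open>y\<close>, a square of side \<open>\<epsilon> * \<rho> / 2\<close> at \<open>y\<close>
      would miss \<open>K\<close>. Up to a reflection it lies in the square of side
      \<open>2 * \<rho>\<close> with corner \<open>x\<close>; the ratio of the areas is
      \<open>\<epsilon>\<^sup>2 / 16\<close>.\<close>
    have "\<exists>d>0. \<forall>h. 0 < h \<and> h < d \<longrightarrow>
       measure lebesgue (- (S s -` K) \<inter> cbox (S s x) (S s x + h *\<^sub>R (1, 1))) < (\<epsilon>\<^sup>2 / 16) * h\<^sup>2" if "s \<in> I" for s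
    proof (rule N(2))
      show "S s x \<notin> N s" using x that SS[OF that] by (metis UN_I image_eqI)
    qed (use x SS that e in auto)
    then obtain d where d: "\<And>s. s \<in> I \<Longrightarrow> d s > 0" "\<And>s h. s \<in> I \<Longrightarrow> 0 < h \<Longrightarrow> h < d s \<Longrightarrow>
       measure lebesgue (- (S s -` K) \<inter> cbox (S s x) (S s x + h *\<^sub>R (1, 1))) < (\<epsilon>\<^sup>2 / 16) * h\<^sup>2"
      by metis
    define D where "D = Min (d ` I) / 2"
    have "0 < D" unfolding D_def using d(1) finI by (auto simp: I_def)
    have D: "2 * D \<le> d s" if "s \<in> I" for s unfolding D_def using finI that by auto
    have "\<exists>z\<in>K. dist z y \<le> e * dist y x" if y: "dist y x < D" for y
    proof (cases "y = x")
      case True then show ?thesis using x by auto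
    next
      case False
      define \<rho> where "\<rho> = dist y x"
      have \<rho>: "0 < \<rho>" "\<rho> < D" using False y by (auto simp: \<rho>_def)
      \<comment> \<open>The reflection that brings \<open>y\<close> to the upper right of
        \<open>x\<close>.\<close>
      define s where "s = (if fst y \<ge> fst x then 1 else -1 :: real, if snd y \<ge> snd x then 1 else -1 :: real)"
      have s: "s \<in> I" by (auto simp: s_def I_def)
      have c1: "fst (S s x) \<le> fst (S s y)" "snd (S s x) \<le> snd (S s y)"
        by (auto simp: s_def S_def)
      have c2: "fst (S s y) - fst (S s x) \<le> \<rho>" "snd (S s y) - snd (S s x) \<le> \<rho>"
        using dist_fst_le[of "S s y" "S s x"] dist_snd_le[of "S s y" "S s x"] dS[OF s, of y x]
        by (auto simp: \<rho>_def dist_real_def)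
      let ?h = "\<epsilon> * \<rho> / 2"
      let ?sq = "cbox (S s y) (S s y + ?h *\<^sub>R (1, 1))"
      let ?big = "- (S s -` K) \<inter> cbox (S s x) (S s x + (2 * \<rho>) *\<^sub>R (1, 1))"
      have h: "0 \<le> ?h" "?h \<le> \<rho> / 2" using e \<rho> by (auto simp: mult_left_le_one_le)
      show ?thesis
      proof (rule ccontr)
        assume neg: "\<not> (\<exists>z\<in>K. dist z y \<le> e * dist y x)"
        have "?sq \<subseteq> ?big"
        proof
          fix w assume w: "w \<in> ?sq"
          have w': "\<bar>fst w - fst (S s y)\<bar> \<le> ?h" "\<bar>snd w - snd (S s y)\<bar> \<le> ?h"
            "fst (S s y) \<le> fst w" "snd (S s y) \<le> snd w"
            using w by (cases w, cases "S s y", auto simp: cbox_Pair_eq)+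
          have "dist (S s w) y = dist w (S s y)" using dS[OF s, of w "S s y"] SS[OF s] by simp
          also have "\<dots> \<le> \<bar>fst w - fst (S s y)\<bar> + \<bar>snd w - snd (S s y)\<bar>"
            by (cases w, cases "S s y") (auto simp: dist_prod_def dist_real_def intro!: sqrt_sum_squares_le_sum_abs)
          also have "\<dots> \<le> e * dist y x" using w'(1,2) e \<rho> mult_right_mono[OF e(3), of \<rho>]
            unfolding \<rho>_def[symmetric] by linarith
          finally have "S s w \<notin> K" using neg by blast
          moreover have "w \<in> cbox (S s x) (S s x + (2 * \<rho>) *\<^sub>R (1, 1))"
            using w' c1 c2 h by (cases w, cases "S s x") (auto simp: cbox_Pair_eq abs_le_iff)
          ultimately show "w \<in> ?big" by simp
        qed
        moreover have "?big \<in> lmeasurable"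
          using cl[of s] by (intro bounded_set_imp_lmeasurable sets.Int)
            (auto intro: bounded_subset[OF bounded_cbox] sets_completionI_sets)
        ultimately have "measure lebesgue ?sq \<le> measure lebesgue ?big"
          by (intro measure_mono_fmeasurable) auto
        also have "\<dots> < (\<epsilon>\<^sup>2 / 16) * (2 * \<rho>)\<^sup>2"
          using \<rho> D[OF s] by (intro d(2)[OF s]) auto
        also have "measure lebesgue ?sq = ?h * ?h"
          using h measure_rectangle[of "fst (S s y)" "fst (S s y) + ?h" "snd (S s y)" "snd (S s y) + ?h"]
            cbox_square[of "fst (S s y)" "snd (S s y)" ?h]
          by simp
        finally show False by (simp add: power2_eq_square)
      qed
    qed
    then show "\<exists>d>0. \<forall>y. dist y x < d \<longrightarrow> (\<exists>z\<in>K. dist z y \<le> e * dist y x)"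
      using \<open>0 < D\<close> by blast
  qed
qed

text \<open>The slope may depend on the accuracy \<open>e\<close>. Comparing two approximations
  along the difference of their slopes gives \<open>norm (q e - q e') \<le> e + e'\<close>, so the
  slopes converge, and their limit is the derivative.\<close>

lemma has_derivative_by_linear_approximations:
  fixes f :: "real \<times> real \<Rightarrow> real"
  assumes "\<And>e. 0 < e \<Longrightarrow> \<exists>q. \<exists>d>0. \<forall>y. dist y x < d \<longrightarrow> \<bar>f y - f x - q \<bullet> (y - x)\<bar> \<le> e * dist y x"
  shows "f differentiable (at x)"
proof -
  obtain q d where qd: "\<And>e. 0 < e \<Longrightarrow> d e > 0"
    "\<And>e y. 0 < e \<Longrightarrow> dist y x < d e \<Longrightarrow> \<bar>f y - f x - q e \<bullet> (y - x)\<bar> \<le> e * dist y x"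
    using assms by metis
  have qq: "norm (q e - q e') \<le> e + e'" if e: "0 < e" "0 < e'" for e e'
  proof (cases "q e = q e'")
    case False
    define w where "w = q e - q e'"
    have w: "norm w > 0" using False by (simp add: w_def)
    \<comment> \<open>The test point \<open>x + t *\<^sub>R w\<close> stays within half of both
      radii, and in the direction \<open>w\<close> the Cauchy-Schwarz inequality is an
      equality.\<close>
    define t where "t = min (d e) (d e') / (2 * norm w)"
    have t: "0 < t" using qd(1) e w by (simp add: t_def)
    define y where "y = x + t *\<^sub>R w"
    have dy: "dist y x = t * norm w" using t by (simp add: y_def dist_norm)
    have "t * norm w = min (d e) (d e') / 2" using w by (simp add: t_def)
    then have "dist y x < d e" "dist y x < d e'" using qd(1)[OF e(1)] qd(1)[OF e(2)] by (auto simp: dy)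
    then have "\<bar>f y - f x - q e \<bullet> (y - x)\<bar> \<le> e * dist y x" "\<bar>f y - f x - q e' \<bullet> (y - x)\<bar> \<le> e' * dist y x"
      using qd(2) e by auto
    then have "\<bar>w \<bullet> (y - x)\<bar> \<le> (e + e') * dist y x"
      by (simp add: w_def inner_diff_left algebra_simps)
    moreover have "w \<bullet> (y - x) = t * norm w * norm w"
      by (simp add: y_def dot_square_norm power2_eq_square)
    ultimately have "norm w * (t * norm w) \<le> (e + e') * (t * norm w)"
      using dy by (simp add: ac_simps)
    then show ?thesis using t w by (simp add: w_def)
  qed (use e in simp)
  have "Cauchy (\<lambda>n. q (1 / real (Suc n)))"
  proof (rule CauchyI)
    fix e :: real assume e: "0 < e"
    then obtain N where N: "1 / real (Suc N) < e / 2"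
      using nat_approx_posE[of "e/2"] by auto
    show "\<exists>M. \<forall>m\<ge>M. \<forall>n\<ge>M. norm (q (1 / real (Suc m)) - q (1 / real (Suc n))) < e"
    proof (intro exI allI impI)
      fix m n assume mn: "N \<le> m" "N \<le> n"
      have "norm (q (1 / real (Suc m)) - q (1 / real (Suc n))) \<le> 1 / real (Suc m) + 1 / real (Suc n)"
        by (rule qq) auto
      also have "\<dots> \<le> 1 / real (Suc N) + 1 / real (Suc N)"
        using mn by (intro add_mono divide_left_mono) auto
      finally show "norm (q (1 / real (Suc m)) - q (1 / real (Suc n))) < e" using N by linarith
    qed
  qed
  then obtain p where p: "(\<lambda>n. q (1 / real (Suc n))) \<longlonglongrightarrow> p"
    using Cauchy_convergent convergent_def by blast
  have pq: "norm (q e - p) \<le> e" if "0 < e" for e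
  proof -
    have "(\<lambda>n. e + 1 / real (Suc n)) \<longlonglongrightarrow> e + 0"
      by (intro tendsto_intros LIMSEQ_Suc lim_1_over_n)
    then have "norm (q e - p) \<le> e + 0"
      by (rule LIMSEQ_le[OF tendsto_norm[OF tendsto_diff[OF tendsto_const p]]])
        (use qq[OF that] in \<open>auto\<close>)
    then show ?thesis by simp
  qed
  have "(f has_derivative (\<lambda>h. p \<bullet> h)) (at x)"
    unfolding has_derivative_at_alt
  proof (intro conjI allI impI)
    show "bounded_linear ((\<bullet>) p)" by (rule bounded_linear_inner_right)
    fix e :: real assume e: "0 < e"
    show "\<exists>da>0. \<forall>y. norm (y - x) < da \<longrightarrow> norm (f y - f x - p \<bullet> (y - x)) \<le> e * norm (y - x)"
    proof (intro exI conjI allI impI)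
      show "0 < d (e/2)" using e by (simp add: qd)
      fix y assume y: "norm (y - x) < d (e/2)"
      have 1: "\<bar>f y - f x - q (e/2) \<bullet> (y - x)\<bar> \<le> e/2 * norm (y - x)"
        using qd(2)[of "e/2" y] e y by (simp add: dist_norm)
      have "\<bar>(q (e/2) - p) \<bullet> (y - x)\<bar> \<le> norm (q (e/2) - p) * norm (y - x)"
        by (rule Cauchy_Schwarz_ineq2)
      also have "\<dots> \<le> e/2 * norm (y - x)" using pq[of "e/2"] e by (intro mult_right_mono) auto
      finally show "norm (f y - f x - p \<bullet> (y - x)) \<le> e * norm (y - x)"
        using 1 unfolding inner_diff_left real_norm_def by linarith
    qed
  qed
  then show ?thesis by (rule differentiableI)
qed

text \<open>
  Only right difference quotients are needed: two points are joined through the lower left corner \<open>c\<close>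
  of the rectangle that they span, and the corners of this path are replaced by nearby points of the
  closed set on which the difference quotients are uniformly close to a rational pair.
\<close>
theorem rademacher_plane:
  fixes f :: "real \<times> real \<Rightarrow> real"
  assumes lip: "L-lipschitz_on UNIV f"
  shows "AE x in lborel. f differentiable (at x)"
proof -
  have L: "0 \<le> L" and fL: "\<bar>f x - f y\<bar> \<le> L * dist x y" for x y
    using lip unfolding lipschitz_on_def dist_real_def by blast+
  have contf: "continuous_on UNIV f" using lip by (rule lipschitz_on_continuous_on)
  define K where "K v e r q = {x. \<forall>t\<in>{0<..<r}. \<bar>f (x + t *\<^sub>R v) - f x - t * q\<bar> \<le> e * t}"
    for v :: "real \<times> real" and e r q :: real
  have clK: "closed (K v e r q)" for v e r q
  proof -
    have "K v e r q = (\<Inter>t\<in>{0<..<r}. {x. \<bar>f (x + t *\<^sub>R v) - f x - t * q\<bar> \<le> e * t})"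
      by (auto simp: K_def)
    also have "closed \<dots>"
      by (intro closed_INT ballI closed_Collect_le continuous_intros continuous_on_compose2[OF contf]) auto
    finally show ?thesis .
  qed
  \<comment> \<open>Existence of a derivative is replaced by a countable condition on closed sets:
    for each accuracy some scale and some rational slope work. So \<open>H v\<close> is Borel, as
    Fubini's theorem requires.\<close>
  define H where "H v = (\<Inter>n. \<Union>m. \<Union>q\<in>\<rat>. K v (1 / real (Suc n)) (1 / real (Suc m)) q)" for v
  have H_borel[measurable]: "H v \<in> sets borel" for v
    unfolding H_def
    by (intro sets.countable_INT sets.countable_UN sets.countable_UN' countable_rat image_subsetI borel_closed clK) auto
  have H_prod: "H v \<in> sets (borel \<Otimes>\<^sub>M borel)" for v
    unfolding borel_prod by (rule H_borel)
  have inH: "x \<in> H v" if "((\<lambda>t. (f (x + t *\<^sub>R v) - f x) / t) \<longlongrightarrow> D) (at_right 0)" for x v D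
    unfolding H_def
  proof safe
    fix n
    define e where "e = 1 / real (Suc n)"
    have e: "0 < e" by (simp add: e_def)
    obtain q where q: "q \<in> \<rat>" "\<bar>q - D\<bar> < e / 2"
    proof -
      obtain q where "q \<in> \<rat>" "D - e / 2 < q" "q < D + e / 2"
        using Rats_dense_in_real[of "D - e/2" "D + e/2"] e by auto
      then show ?thesis by (intro that[of q]) (auto simp: abs_if)
    qed
    have "\<forall>\<^sub>F t in at_right 0. dist ((f (x + t *\<^sub>R v) - f x) / t) D < e / 2"
      using that e by (intro tendstoD) auto
    then obtain b where b: "b > 0" "\<And>t. 0 < t \<Longrightarrow> t < b \<Longrightarrow> dist ((f (x + t *\<^sub>R v) - f x) / t) D < e / 2"
      by (auto simp: eventually_at_right_field)
    obtain m where m: "1 / real (Suc m) < b" using nat_approx_posE[OF b(1)] by auto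
    have "x \<in> K v e (1 / real (Suc m)) q"
      unfolding K_def
    proof (intro CollectI ballI)
      fix t assume t: "t \<in> {0<..<1 / real (Suc m)}"
      then have "\<bar>(f (x + t *\<^sub>R v) - f x) / t - D\<bar> < e / 2" using b(2)[of t] m by (auto simp: dist_real_def)
      then have "\<bar>(f (x + t *\<^sub>R v) - f x) / t - q\<bar> \<le> e" using q(2) by linarith
      then have "\<bar>(f (x + t *\<^sub>R v) - f x) / t - q\<bar> * t \<le> e * t" using t by (intro mult_right_mono) auto
      also have "\<bar>(f (x + t *\<^sub>R v) - f x) / t - q\<bar> * t = \<bar>((f (x + t *\<^sub>R v) - f x) / t - q) * t\<bar>"
        using t by (simp add: abs_mult)
      also have "((f (x + t *\<^sub>R v) - f x) / t - q) * t = f (x + t *\<^sub>R v) - f x - t * q"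
        using t by (simp add: field_simps)
      finally show "\<bar>f (x + t *\<^sub>R v) - f x - t * q\<bar> \<le> e * t" .
    qed
    then show "x \<in> (\<Union>m. \<Union>q\<in>\<rat>. K v (1 / real (Suc n)) (1 / real (Suc m)) q)" using q(1) unfolding e_def by blast
  qed
  \<comment> \<open>On each horizontal line the right derivative exists almost everywhere, so every
    section of the complement is null.\<close>
  have AE1: "AE x in lborel. x \<in> H (1, 0)"
  proof -
    have "AE a in lborel. (a, b) \<in> H (1, 0)" for b
    proof -
      have "L-lipschitz_on UNIV (\<lambda>a. f (a, b))"
        using L fL[of "(_, b)" "(_, b)"] by (auto simp: lipschitz_on_def dist_real_def dist_Pair_Pair)
      from lipschitz_right_derivative[OF this] show ?thesis
        by eventually_elim (use inH[of _ "(1, 0)"] in force)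
    qed
    then have "AE b in lborel. AE a in lborel. (a, b) \<in> H (1, 0)" by simp
    then have "AE a in lborel. AE b in lborel. (a, b) \<in> H (1, 0)"
      by (subst lborel_pair.AE_commute) (simp_all add: H_prod space_pair_measure)
    then show ?thesis
      by (subst lborel_prod[symmetric], intro lborel_pair.AE_pair_measure) (simp_all add: H_prod space_pair_measure)
  qed
  have AE2: "AE x in lborel. x \<in> H (0, 1)"
  proof -
    have "AE b in lborel. (a, b) \<in> H (0, 1)" for a
    proof -
      have "L-lipschitz_on UNIV (\<lambda>b. f (a, b))"
        using L fL[of "(a, _)" "(a, _)"] by (auto simp: lipschitz_on_def dist_real_def dist_Pair_Pair)
      from lipschitz_right_derivative[OF this] show ?thesis
        by eventually_elim (use inH[of _ "(0, 1)"] in force)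
    qed
    then have "AE a in lborel. AE b in lborel. (a, b) \<in> H (0, 1)" by simp
    then show ?thesis
      by (subst lborel_prod[symmetric], intro lborel_pair.AE_pair_measure) (simp_all add: H_prod space_pair_measure)
  qed
  \<comment> \<open>Both partial difference quotients with common accuracy and scale. Rational
    slopes leave countably many such sets, so their exceptional sets unite to a null set.\<close>
  define Q where "Q n m q1 q2 = K (1,0) (1 / real (Suc n)) (1 / real (Suc m)) q1
      \<inter> K (0,1) (1 / real (Suc n)) (1 / real (Suc m)) q2" for n m :: nat and q1 q2
  have "\<exists>N. negligible N \<and> (\<forall>x e. x \<notin> N \<longrightarrow> x \<in> Q n m q1 q2 \<longrightarrow> 0 < e \<longrightarrow>
       (\<exists>d>0. \<forall>y. dist y x < d \<longrightarrow> (\<exists>z\<in>Q n m q1 q2. dist z y \<le> e * dist y x)))" for n m q1 q2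
    using closed_porosity_null[of "Q n m q1 q2"] clK unfolding Q_def by (metis closed_Int)
  then obtain N where N: "\<And>n m q1 q2. negligible (N n m q1 q2)"
    "\<And>n m q1 q2 x e. x \<notin> N n m q1 q2 \<Longrightarrow> x \<in> Q n m q1 q2 \<Longrightarrow> 0 < e \<Longrightarrow>
       \<exists>d>0. \<forall>y. dist y x < d \<longrightarrow> (\<exists>z\<in>Q n m q1 q2. dist z y \<le> e * dist y x)"
    by metis
  have AEN: "AE x in lborel. \<forall>n m. \<forall>q1\<in>\<rat>. \<forall>q2\<in>\<rat>. x \<notin> N n m q1 q2"
  proof -
    have "AE x in lborel. x \<notin> N n m q1 q2" for n m q1 q2
      using N(1)[of n m q1 q2] AE_not_in[of "N n m q1 q2" lebesgue]
      by (simp add: negligible_iff_null_sets AE_completion_iff)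
    then show ?thesis by (simp add: AE_all_countable AE_ball_countable countable_rat)
  qed
  show ?thesis
    using AE1 AE2 AEN
  proof eventually_elim
    case (elim x)
    show ?case
    proof (rule has_derivative_by_linear_approximations)
      fix e :: real assume e: "0 < e"
      \<comment> \<open>Twice the constant \<open>2 + 6 * L\<close> of \<open>step\<close>, once for
        \<open>x\<close> and once for \<open>y\<close>.\<close>
      define C where "C = 4 + 12 * L"
      have C: "C > 0" using L by (simp add: C_def)
      obtain n where n: "1 / real (Suc n) < e / C" using nat_approx_posE[of "e / C"] e C by auto
      define \<epsilon> where "\<epsilon> = 1 / real (Suc n)"
      have \<epsilon>: "0 < \<epsilon>" "C * \<epsilon> \<le> e" using n C by (auto simp: \<epsilon>_def field_simps)
      obtain m1 q1 where 1: "q1 \<in> \<rat>" "x \<in> K (1,0) \<epsilon> (1 / real (Suc m1)) q1"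
        using elim(1) unfolding H_def \<epsilon>_def by blast
      obtain m2 q2 where 2: "q2 \<in> \<rat>" "x \<in> K (0,1) \<epsilon> (1 / real (Suc m2)) q2"
        using elim(2) unfolding H_def \<epsilon>_def by blast
      define m where "m = max m1 m2"
      have m: "1 / real (Suc m) \<le> 1 / real (Suc m1)" "1 / real (Suc m) \<le> 1 / real (Suc m2)"
        by (auto simp: m_def intro!: divide_left_mono)
      have xQ: "x \<in> Q n m q1 q2" using 1 2 m unfolding Q_def K_def \<epsilon>_def by (auto dest: order_less_le_trans)
      have "x \<notin> N n m q1 q2" using elim(3) 1 2 by blast
      from N(2)[OF this xQ \<epsilon>(1)] obtain d where d: "d > 0"
        "\<And>y. dist y x < d \<Longrightarrow> \<exists>z\<in>Q n m q1 q2. dist z y \<le> \<epsilon> * dist y x" by blast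
      \<comment> \<open>\<open>step\<close> also visits \<open>c + (a, 0)\<close>, at distance up to
        \<open>2 * \<rho>\<close> from \<open>x\<close>; the factor \<open>1/3\<close> keeps this
        point within \<open>d\<close>.\<close>
      define d' where "d' = min (d / 3) (1 / real (Suc m))"
      have d': "0 < d'" using d by (simp add: d'_def)
      have Q1: "\<bar>f (z + (t, 0)) - f z - t * q1\<bar> \<le> \<epsilon> * t" if "z \<in> Q n m q1 q2" "0 \<le> t" "t < d'" for z t
        using that by (cases "t = 0") (auto simp: Q_def K_def \<epsilon>_def d'_def zero_prod_def[symmetric])
      have Q2: "\<bar>f (z + (0, t)) - f z - t * q2\<bar> \<le> \<epsilon> * t" if "z \<in> Q n m q1 q2" "0 \<le> t" "t < d'" for z t
        using that by (cases "t = 0") (auto simp: Q_def K_def \<epsilon>_def d'_def zero_prod_def[symmetric])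
      \<comment> \<open>The points \<open>c\<close> and \<open>c + (a, 0)\<close> are moved to
        \<open>z\<close> and \<open>w\<close> in \<open>Q\<close>, by at most
        \<open>\<epsilon> * \<rho>\<close> and \<open>2 * \<epsilon> * \<rho>\<close>. Each
        displacement is paid for twice by the Lipschitz bound, which makes \<open>6 * L\<close>; the
        two difference quotients contribute \<open>2\<close>.\<close>
      have step: "\<bar>f (c + (a, b)) - f c - a * q1 - b * q2\<bar> \<le> (2 + 6 * L) * \<epsilon> * \<rho>"
        if c: "dist c x \<le> \<rho>" and ab: "0 \<le> a" "a \<le> \<rho>" "0 \<le> b" "b \<le> \<rho>" and \<rho>: "\<rho> < d'" for a b c \<rho>
      proof -
        have \<rho>0: "0 \<le> \<rho>" using ab by simp
        have "dist c x < d" using c \<rho> d unfolding d'_def by linarith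
        then obtain z where z: "z \<in> Q n m q1 q2" "dist z c \<le> \<epsilon> * dist c x" using d by blast
        have zc: "dist z c \<le> \<epsilon> * \<rho>" using z(2) c \<epsilon> by (meson mult_left_mono order_trans less_imp_le)
        have "dist (c + (a, 0)) x \<le> dist (c + (a, 0)) c + dist c x" by (rule dist_triangle)
        also have "dist (c + (a, 0)) c = a" using ab by (simp add: dist_norm norm_Pair)
        finally have c2: "dist (c + (a, 0)) x \<le> 2 * \<rho>" using c ab by linarith
        also have "\<dots> < d" using \<rho> d unfolding d'_def by linarith
        finally obtain w where w: "w \<in> Q n m q1 q2" "dist w (c + (a, 0)) \<le> \<epsilon> * dist (c + (a, 0)) x"
          using d by blast
        have wc: "dist w (c + (a, 0)) \<le> \<epsilon> * (2 * \<rho>)" using w(2) c2 \<epsilon> by (meson mult_left_mono order_trans less_imp_le)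
        have z1: "\<bar>f (z + (a, 0)) - f z - a * q1\<bar> \<le> \<epsilon> * \<rho>"
          using Q1[OF z(1), of a] ab \<rho> mult_left_mono[OF ab(2), of \<epsilon>] \<epsilon> by linarith
        have w1: "\<bar>f (w + (0, b)) - f w - b * q2\<bar> \<le> \<epsilon> * \<rho>"
          using Q2[OF w(1), of b] ab \<rho> mult_left_mono[OF ab(4), of \<epsilon>] \<epsilon> by linarith
        have l1: "\<bar>f z - f c\<bar> \<le> L * (\<epsilon> * \<rho>)" using fL[of z c] mult_left_mono[OF zc L] by linarith
        have l2: "\<bar>f (z + (a, 0)) - f (c + (a, 0))\<bar> \<le> L * (\<epsilon> * \<rho>)"
          using fL[of "z + (a,0)" "c + (a,0)"] mult_left_mono[OF zc L] by (simp add: dist_norm)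
        have l3: "\<bar>f w - f (c + (a, 0))\<bar> \<le> L * (\<epsilon> * (2 * \<rho>))" using fL[of w "c + (a,0)"] mult_left_mono[OF wc L] by linarith
        have "dist (w + (0, b)) (c + (a, b)) = dist w (c + (a, 0))"
          unfolding dist_norm by (rule arg_cong[where f=norm]) (simp add: prod_eq_iff)
        then have l4: "\<bar>f (w + (0, b)) - f (c + (a, b))\<bar> \<le> L * (\<epsilon> * (2 * \<rho>))"
          using fL[of "w + (0,b)" "c + (a,b)"] mult_left_mono[OF wc L] by simp
        have "\<bar>f (c + (a, b)) - f c - a * q1 - b * q2\<bar> \<le> 2 * (\<epsilon> * \<rho>) + 2 * (L * (\<epsilon> * \<rho>)) + 2 * (L * (\<epsilon> * (2 * \<rho>)))"
          using z1 w1 l1 l2 l3 l4 by linarith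
        also have "\<dots> = (2 + 6 * L) * \<epsilon> * \<rho>" by (simp add: algebra_simps)
        finally show ?thesis .
      qed
      show "\<exists>q. \<exists>d>0. \<forall>y. dist y x < d \<longrightarrow> \<bar>f y - f x - q \<bullet> (y - x)\<bar> \<le> e * dist y x"
      proof (intro exI conjI allI impI)
        fix y assume y: "dist y x < d'"
        define \<rho> where "\<rho> = dist y x"
        define c where "c = (min (fst x) (fst y), min (snd x) (snd y))"
        have fs: "\<bar>fst y - fst x\<bar> \<le> \<rho>" "\<bar>snd y - snd x\<bar> \<le> \<rho>"
          using dist_fst_le[of y x] dist_snd_le[of y x] by (auto simp: \<rho>_def dist_real_def)
        have "dist c x \<le> \<rho>" unfolding \<rho>_def dist_prod_def c_def
          by (intro real_sqrt_le_mono add_mono power_mono) (auto simp: dist_real_def)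
        note st = step[OF this _ _ _ _ y[folded \<rho>_def]]
        have x: "x = c + (fst x - fst c, snd x - snd c)" and y: "y = c + (fst y - fst c, snd y - snd c)"
          by (simp_all add: plus_prod_def)
        have "\<bar>f x - f c - (fst x - fst c) * q1 - (snd x - snd c) * q2\<bar> \<le> (2 + 6 * L) * \<epsilon> * \<rho>"
          using st[of "fst x - fst c" "snd x - snd c"] fs by (subst x) (auto simp: c_def)
        moreover have "\<bar>f y - f c - (fst y - fst c) * q1 - (snd y - snd c) * q2\<bar> \<le> (2 + 6 * L) * \<epsilon> * \<rho>"
          using st[of "fst y - fst c" "snd y - snd c"] fs by (subst y) (auto simp: c_def)
        ultimately have "\<bar>f y - f x - (q1, q2) \<bullet> (y - x)\<bar> \<le> 2 * ((2 + 6 * L) * \<epsilon> * \<rho>)"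
          by (simp add: inner_prod_def abs_le_iff algebra_simps)
        also have "\<dots> = C * \<epsilon> * \<rho>" by (simp add: C_def algebra_simps)
        also have "\<dots> \<le> e * \<rho>" using \<epsilon> by (intro mult_right_mono) (auto simp: \<rho>_def)
        finally show "\<bar>f y - f x - (q1, q2) \<bullet> (y - x)\<bar> \<le> e * dist y x" by (simp add: \<rho>_def)
      qed (rule d')
    qed
  qed
qed

section \<open>A smooth bump function\<close>

lemma C_k_Suc_lower: "C_k (Suc k) f \<Longrightarrow> C_k k f"
proof (induction k arbitrary: f)
  case 0
  then show ?case
    by (auto simp: continuous_on_eq_continuous_at intro: differentiable_imp_continuous_within)
qed auto

lemma C_k_const: "C_k k (\<lambda>_. c)"
  by (induction k arbitrary: c) auto

lemma C_k_add:
  assumes "C_k k f" "C_k k g" shows "C_k k (\<lambda>x. f x + g x)"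
  using assms
proof (induction k arbitrary: f g)
  case (Suc k)
  have "frechet_derivative (\<lambda>x. f x + g x) (at x)
      = (\<lambda>v. frechet_derivative f (at x) v + frechet_derivative g (at x) v)" for x
    using Suc.prems by (intro frechet_derivative_at[symmetric] has_derivative_add)
      (auto simp: frechet_derivative_works[symmetric])
  then show ?case using Suc by (auto intro!: differentiable_add)
qed (auto intro: continuous_on_add)

lemma C_k_scaleR:
  fixes f :: "'a::real_normed_vector \<Rightarrow> real" and g :: "'a \<Rightarrow> 'b::real_normed_vector"
  assumes "C_k k f" "C_k k g" shows "C_k k (\<lambda>x. f x *\<^sub>R g x)"
  using assms
proof (induction k arbitrary: f g)
  case (Suc k)
  have d: "((\<lambda>x. f x *\<^sub>R g x) has_derivative (\<lambda>v. f x *\<^sub>R frechet_derivative g (at x) v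
      + frechet_derivative f (at x) v *\<^sub>R g x)) (at x)" for x
    using Suc.prems by (intro has_derivative_scaleR) (auto simp: frechet_derivative_works[symmetric])
  have "C_k k (\<lambda>x. f x *\<^sub>R frechet_derivative g (at x) v + frechet_derivative f (at x) v *\<^sub>R g x)" for v
    using Suc.prems by (intro C_k_add Suc.IH) (auto intro: C_k_Suc_lower)
  then show ?case using d by (auto intro: differentiableI simp: frechet_derivative_at[OF d, symmetric])
qed (auto intro: continuous_on_scaleR)

lemma C_k_compose_affine:
  assumes "C_k k f" "bounded_linear l" shows "C_k k (\<lambda>x. f (c + l x))"
  using assms(1)
proof (induction k arbitrary: f)
  case 0
  then show ?case
    by (auto intro!: continuous_on_compose2[of UNIV f] continuous_on_add linear_continuous_on[OF assms(2)])
next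
  case (Suc k)
  have l: "((\<lambda>x. c + l x) has_derivative l) (at x)" for x
    using has_derivative_add[OF has_derivative_const bounded_linear_imp_has_derivative[OF assms(2)]]
    by simp
  have d: "((\<lambda>x. f (c + l x)) has_derivative (\<lambda>v. frechet_derivative f (at (c + l x)) (l v))) (at x)" for x
    using diff_chain_at[OF l, of f "frechet_derivative f (at (c + l x))" x] Suc.prems
    by (simp add: frechet_derivative_works[symmetric] o_def)
  have "C_k k (\<lambda>x. frechet_derivative f (at (c + l x)) (l v))" for v
    using Suc.prems by (intro Suc.IH[of "\<lambda>y. frechet_derivative f (at y) (l v)"]) auto
  then show ?case using d by (auto intro: differentiableI simp: frechet_derivative_at[OF d, symmetric])
qed

lemma C_k_Suc_real:
  fixes f :: "real \<Rightarrow> real"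
  assumes "\<And>x. (f has_real_derivative f' x) (at x)" "C_k k f'"
  shows "C_k (Suc k) f"
proof -
  have "frechet_derivative f (at x) = (\<lambda>v. f' x *\<^sub>R v)" for x
    using frechet_derivative_at[OF assms(1)[unfolded has_field_derivative_def, of x]] by simp
  moreover have "C_k k (\<lambda>x. f' x *\<^sub>R v)" for v :: real
    by (rule C_k_scaleR[OF assms(2) C_k_const])
  ultimately show ?thesis
    using assms by (auto simp: real_differentiable_def)
qed

lemma C_k_real_deriv:
  fixes f :: "real \<Rightarrow> real"
  assumes "C_k (Suc k) f"
  shows "(f has_real_derivative deriv f x) (at x)" "C_k k (deriv f)"
proof -
  have d: "(f has_real_derivative deriv f x) (at x)" for x
    using assms by (simp add: DERIV_deriv_iff_real_differentiable)
  then show "(f has_real_derivative deriv f x) (at x)" .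
  have "frechet_derivative f (at x) 1 = deriv f x" for x
    using frechet_derivative_at[OF d[unfolded has_field_derivative_def, of x]] by (metis mult.right_neutral)
  then show "C_k k (deriv f)" using assms by (auto dest: spec[of _ 1])
qed

text \<open>The polynomial parameter makes the family closed under differentiation: the derivative
  replaces \<open>p\<close> by \<open>X\<^sup>2 * (p - p')\<close>. Smoothness of all members then
  follows by a single induction in \<open>C_k_flat\<close>.\<close>

definition flat :: "real poly \<Rightarrow> real \<Rightarrow> real"
  where "flat p x = (if x \<le> 0 then 0 else poly p (1 / x) * exp (- 1 / x))"

lemma poly_times_exp_neg_tendsto_0:
  fixes p :: "real poly"
  shows "((\<lambda>y. poly p y * exp (- y)) \<longlongrightarrow> 0) at_top"
proof -
  have "((\<lambda>y. \<Sum>i\<le>degree p. coeff p i * (y ^ i / exp y)) \<longlongrightarrow> (\<Sum>i\<le>degree p. coeff p i * 0)) at_top"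
    by (intro tendsto_intros tendsto_power_div_exp_0)
  then show ?thesis
    by (simp add: poly_altdef sum_distrib_right exp_minus divide_inverse mult.assoc)
qed

lemma flat_has_derivative:
  "(flat p has_real_derivative flat ([:0, 0, 1:] * (p - pderiv p)) x) (at x)"
proof -
  consider "x < 0" | "x = 0" | "x > 0" by linarith
  then show ?thesis
  proof cases
    case 1
    have "((\<lambda>_. 0) has_real_derivative 0) (at x)" by simp
    then show ?thesis using 1
      by (subst has_field_derivative_cong_ev[where g="\<lambda>_. 0" and y=x])
        (auto simp: flat_def intro!: eventually_nhds_in_open[of "{..<0}" x, THEN eventually_mono])
  next
    case 2
    \<comment> \<open>The difference quotient at \<open>0\<close> has the same form; its factor
      \<open>1 / t\<close> is absorbed into the polynomial.\<close>
    have "((\<lambda>t. poly ([:0, 1:] * p) (1 / t) * exp (- (1 / t))) \<longlongrightarrow> 0) (at_right 0)"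
      by (rule filterlim_compose[OF poly_times_exp_neg_tendsto_0])
        (simp add: filterlim_inverse_at_top_right divide_inverse)
    then have r: "((\<lambda>t. flat p t / t) \<longlongrightarrow> 0) (at_right 0)"
      by (rule Lim_transform_eventually)
        (auto simp: flat_def eventually_at_right_field intro!: exI[of _ 1])
    have l: "((\<lambda>t. flat p t / t) \<longlongrightarrow> 0) (at_left 0)"
      by (rule Lim_transform_eventually[OF tendsto_const])
        (auto simp: flat_def eventually_at_left_field intro!: exI[of _ "-1"])
    have "((\<lambda>t. flat p t / t) \<longlongrightarrow> 0) (at 0)"
      using l r by (simp add: filterlim_split_at)
    moreover have "flat r 0 = 0" for r by (simp add: flat_def)
    ultimately show ?thesis unfolding 2 DERIV_def by simp
  next
    case 3
    have "((\<lambda>x. poly p (1 / x) * exp (- 1 / x)) has_real_derivative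
        poly ([:0, 0, 1:] * (p - pderiv p)) (1 / x) * exp (- 1 / x)) (at x)"
      using 3 by (auto intro!: derivative_eq_intros simp: field_simps power2_eq_square)
    then show ?thesis using 3
      by (subst has_field_derivative_cong_ev[where g="\<lambda>x. poly p (1 / x) * exp (- 1 / x)" and y=x])
        (auto simp: flat_def intro!: eventually_nhds_in_open[of "{0<..}" x, THEN eventually_mono])
  qed
qed

lemma C_k_flat: "C_k k (flat p)"
proof (induction k arbitrary: p)
  case 0
  show ?case using flat_has_derivative[of p]
    by (auto intro!: DERIV_isCont continuous_at_imp_continuous_on)
next
  case (Suc k)
  show ?case by (rule C_k_Suc_real[OF flat_has_derivative Suc])
qed

definition bump0 :: "real \<Rightarrow> real" where "bump0 x = flat 1 (1 + x) *\<^sub>R flat 1 (1 + - x)"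
definition bump :: "real \<Rightarrow> real" where "bump x = (1 / (LINT x|lborel. bump0 x)) *\<^sub>R bump0 x"

lemma C_k_bump0: "C_k k bump0"
proof -
  have "C_k k (\<lambda>x. flat 1 (1 + x) *\<^sub>R flat 1 (1 + - x))"
    by (intro C_k_scaleR C_k_compose_affine[where l="\<lambda>x. x"] C_k_compose_affine[where l=uminus] C_k_flat
      bounded_linear_ident bounded_linear_minus)
  then show ?thesis unfolding bump0_def[abs_def] .
qed

lemma C_k_bump: "C_k k bump"
proof -
  have "C_k k (\<lambda>x. (1 / (LINT x|lborel. bump0 x)) *\<^sub>R bump0 x)"
    by (intro C_k_scaleR C_k_const C_k_bump0)
  then show ?thesis unfolding bump_def[abs_def] .
qed

lemma bump0_nonneg: "0 \<le> bump0 x" and bump0_pos: "\<bar>x\<bar> < 1 \<Longrightarrow> 0 < bump0 x" and bump0_zero: "1 \<le> \<bar>x\<bar> \<Longrightarrow> bump0 x = 0"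
  by (auto simp: bump0_def flat_def)

lemma cont_bump0: "continuous_on UNIV bump0"
  using C_k_bump0[of 0] by simp

lemma integrable_bump0: "integrable lborel bump0"
proof -
  have "set_integrable lborel {-1..1} bump0"
    by (rule borel_integrable_atLeastAtMost') (rule continuous_on_subset[OF cont_bump0], simp)
  then show ?thesis unfolding set_integrable_def
  proof (rule Bochner_Integration.integrable_cong[THEN iffD1, OF refl, rotated])
    show "indicat_real {-1..1} x *\<^sub>R bump0 x = bump0 x" for x
      by (cases "1 \<le> \<bar>x\<bar>") (auto simp: indicator_def bump0_zero abs_le_iff)
  qed
qed

lemma integral_bump0_pos: "0 < (LINT x|lborel. bump0 x)"
proof -
  have "\<not> (AE x in lborel. bump0 x = 0)"
  proof
    assume "AE x in lborel. bump0 x = 0"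
    then have "AE x in lborel. x \<notin> {-1<..<1::real}"
      by eventually_elim (use bump0_pos in \<open>force simp: abs_less_iff\<close>)
    then have "{-1<..<1::real} \<in> null_sets lborel"
      by (subst AE_iff_null_sets) auto
    then show False by (simp add: null_sets_def)
  qed
  then show ?thesis
    using integral_nonneg_eq_0_iff_AE[OF integrable_bump0] bump0_nonneg
      integral_nonneg_AE[of bump0 lborel] by (simp add: less_le)
qed

lemma bump_nonneg: "0 \<le> bump x"
  using bump0_nonneg integral_bump0_pos by (simp add: bump_def)

lemma bump_zero: "1 \<le> \<bar>x\<bar> \<Longrightarrow> bump x = 0"
  by (simp add: bump_def bump0_zero)

lemma integral_bump: "integrable lborel bump" "(LINT x|lborel. bump x) = 1"
  using integrable_bump0 integral_bump0_pos by (simp_all add: bump_def[abs_def])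

lemma deriv_bump_zero: "1 < \<bar>x\<bar> \<Longrightarrow> deriv bump x = 0"
proof -
  assume x: "1 < \<bar>x\<bar>"
  have "((\<lambda>_. 0) has_real_derivative 0) (at x)" by simp
  then have "(bump has_real_derivative 0) (at x)" using x
    by (subst has_field_derivative_cong_ev[where g="\<lambda>_. 0" and y=x])
      (auto simp: bump_zero abs_if intro!: eventually_nhds_in_open[of "{x. 1 < \<bar>x\<bar>}" x, THEN eventually_mono]
        open_Collect_less continuous_intros)
  then show ?thesis by (rule DERIV_imp_deriv)
qed

section \<open>Mollification\<close>

text \<open>By the mean value theorem the bound \<open>w\<close>, uniform in the parameter, also
  bounds all difference quotients, so dominated convergence applies.\<close>

lemma DERIV_integral_dominated:
  fixes f :: "real \<Rightarrow> 'a \<Rightarrow> real"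
  assumes f: "\<And>t y. ((\<lambda>t. f t y) has_real_derivative f' t y) (at t)"
    and int: "\<And>t. integrable M (f t)" and meas: "\<And>t. f' t \<in> borel_measurable M"
    and w: "integrable M w" "\<And>t y. \<bar>f' t y\<bar> \<le> w y"
  shows "((\<lambda>t. LINT y|M. f t y) has_real_derivative (LINT y|M. f' t y)) (at t)"
  unfolding DERIV_def
proof (subst tendsto_at_iff_sequentially, intro allI impI, simp only: o_def)
  fix h :: "nat \<Rightarrow> real" assume h: "\<forall>i. h i \<in> UNIV - {0}" "h \<longlonglongrightarrow> 0"
  have eq: "((LINT y|M. f (t + h i) y) - (LINT y|M. f t y)) / h i = (LINT y|M. (f (t + h i) y - f t y) / h i)" for i
    using int by simp
  show "(\<lambda>i. ((LINT y|M. f (t + h i) y) - (LINT y|M. f t y)) / h i) \<longlonglongrightarrow> (LINT y|M. f' t y)"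
    unfolding eq
  proof (rule integral_dominated_convergence[where w=w])
    show "AE y in M. (\<lambda>i. (f (t + h i) y - f t y) / h i) \<longlonglongrightarrow> f' t y"
    proof (rule AE_I2)
      fix y
      have "((\<lambda>h. (f (t + h) y - f t y) / h) \<longlongrightarrow> f' t y) (at 0)" using f[of y t] unfolding DERIV_def .
      then show "(\<lambda>i. (f (t + h i) y - f t y) / h i) \<longlonglongrightarrow> f' t y"
        using h by (auto simp: tendsto_at_iff_sequentially o_def)
    qed
    show "AE y in M. norm ((f (t + h i) y - f t y) / h i) \<le> w y" for i
    proof (rule AE_I2)
      fix y
      have "norm (f (t + h i) y - f t y) \<le> w y * norm (t + h i - t)"
        by (rule field_differentiable_bound[of UNIV "\<lambda>t. f t y" "\<lambda>t. f' t y"])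
          (use f w in auto)
      then show "norm ((f (t + h i) y - f t y) / h i) \<le> w y"
        using h by (simp add: divide_le_eq)
    qed
  qed (use int meas w in auto)
qed

text \<open>Convolution with a product kernel at scale \<open>1 / k\<close>, without normalisation.
  The two factors are separate arguments because a derivative of a mollification has the same form,
  with \<open>deriv bump\<close> in one of the slots.\<close>

definition smear :: "(real \<Rightarrow> real) \<Rightarrow> (real \<Rightarrow> real) \<Rightarrow> real \<Rightarrow> (real \<times> real \<Rightarrow> real) \<Rightarrow> real \<times> real \<Rightarrow> real" where
  "smear \<phi> \<psi> k p z = (LINT y|lborel. p y * (\<phi> (k * (fst z - fst y)) * \<psi> (k * (snd z - snd y))))"

definition cont_bdd :: "(real \<Rightarrow> real) \<Rightarrow> bool" where
  "cont_bdd \<phi> \<longleftrightarrow> continuous_on UNIV \<phi> \<and> (\<exists>C. \<forall>x. \<bar>\<phi> x\<bar> \<le> C)"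

lemma cont_bddI_support:
  assumes "continuous_on UNIV \<phi>" "\<And>x. 1 < \<bar>x\<bar> \<Longrightarrow> \<phi> x = 0"
  shows "cont_bdd \<phi>"
proof -
  have "compact (\<phi> ` {-1..1})"
    using assms(1) by (intro compact_continuous_image continuous_on_subset[OF assms(1)]) auto
  then obtain C where C: "\<forall>y\<in>\<phi> ` {-1..1}. norm y \<le> C"
    using compact_imp_bounded bounded_iff by blast
  have "\<bar>\<phi> x\<bar> \<le> max C 0" for x
  proof (cases "1 < \<bar>x\<bar>")
    case False
    then have "x \<in> {-1..1}" by auto
    then have "\<bar>\<phi> x\<bar> \<le> C" using C by auto
    then show ?thesis by simp
  qed (use assms(2)[of x] in simp)
  then show ?thesis using assms(1) unfolding cont_bdd_def by blast
qed

lemma cont_bdd_bump: "cont_bdd bump" "cont_bdd (deriv bump)" "cont_bdd (deriv (deriv bump))"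
proof -
  have d2: "C_k k (deriv (deriv bump))" "C_k k (deriv bump)" for k
    using C_k_real_deriv(2)[OF C_k_bump[of "Suc (Suc k)"]] C_k_real_deriv(2)[of k "deriv bump"]
      C_k_real_deriv(2)[OF C_k_bump[of "Suc k"]] by auto
  have z: "deriv (deriv bump) x = 0" if "1 < \<bar>x\<bar>" for x
  proof -
    have "((\<lambda>_. 0) has_real_derivative 0) (at x)" by simp
    then have "(deriv bump has_real_derivative 0) (at x)" using that
      by (subst has_field_derivative_cong_ev[where g="\<lambda>_. 0" and y=x])
        (auto simp: deriv_bump_zero intro!: eventually_nhds_in_open[of "{x. 1 < \<bar>x\<bar>}" x, THEN eventually_mono]
          open_Collect_less continuous_intros)
    then show ?thesis by (rule DERIV_imp_deriv)
  qed
  show "cont_bdd bump" "cont_bdd (deriv bump)" "cont_bdd (deriv (deriv bump))"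
    using C_k_bump[of 0] d2[of 0] z by (auto intro!: cont_bddI_support simp: bump_zero deriv_bump_zero)
qed

lemma cont_bdd_measurable: "cont_bdd \<phi> \<Longrightarrow> \<phi> \<in> borel_measurable borel"
  by (auto simp: cont_bdd_def intro: borel_measurable_continuous_onI)

lemma smear_bound:
  assumes "cont_bdd \<phi>" "cont_bdd \<psi>"
  obtains C where "0 \<le> C" "\<And>s t. \<bar>\<phi> s * \<psi> t\<bar> \<le> C"
proof -
  obtain A B where A: "\<And>x. \<bar>\<phi> x\<bar> \<le> A" and B: "\<And>x. \<bar>\<psi> x\<bar> \<le> B" using assms by (auto simp: cont_bdd_def)
  have "\<bar>\<phi> s * \<psi> t\<bar> \<le> A * B" for s t
    unfolding abs_mult using A[of s] B[of t] by (intro mult_mono) (auto intro: order_trans[OF abs_ge_zero])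
  moreover from this[of 0 0] have "0 \<le> A * B" by (rule order_trans[OF abs_ge_zero])
  ultimately show ?thesis by (rule that[rotated])
qed

lemma smear_integrand_measurable [measurable]:
  assumes "cont_bdd \<phi>" "cont_bdd \<psi>" "p \<in> borel_measurable borel"
  shows "(\<lambda>y. p y * (\<phi> (k * (fst z - fst y)) * \<psi> (k * (snd z - snd y)))) \<in> borel_measurable borel"
proof -
  have "continuous_on UNIV (\<lambda>y. \<phi> (k * (fst z - fst y)) * \<psi> (k * (snd z - snd y)))"
    using assms(1,2) unfolding cont_bdd_def
    by (intro continuous_on_mult continuous_on_compose2[of UNIV \<phi> UNIV "\<lambda>y. k * (fst z - fst y)"]
        continuous_on_compose2[of UNIV \<psi> UNIV "\<lambda>y. k * (snd z - snd y)"])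
      (auto intro!: continuous_intros)
  from borel_measurable_continuous_onI[OF this] show ?thesis using assms(3) by simp
qed

lemma smear_integrable:
  assumes "cont_bdd \<phi>" "cont_bdd \<psi>" "integrable lborel p"
  shows "integrable lborel (\<lambda>y. p y * (\<phi> (k * (fst z - fst y)) * \<psi> (k * (snd z - snd y))))"
proof -
  obtain C where C: "0 \<le> C" "\<And>s t. \<bar>\<phi> s * \<psi> t\<bar> \<le> C" using smear_bound[OF assms(1,2)] by blast
  show ?thesis
  proof (rule Bochner_Integration.integrable_bound)
    show "integrable lborel (\<lambda>y. p y * C)" using assms(3) by simp
    show "(\<lambda>y. p y * (\<phi> (k * (fst z - fst y)) * \<psi> (k * (snd z - snd y)))) \<in> borel_measurable lborel"
      using smear_integrand_measurable[OF assms(1,2)] borel_measurable_integrable[OF assms(3)] by simp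
    show "AE y in lborel. norm (p y * (\<phi> (k * (fst z - fst y)) * \<psi> (k * (snd z - snd y)))) \<le> norm (p y * C)"
      using C by (intro AE_I2) (simp add: abs_mult[of "p _"] mult_left_mono)
  qed
qed

lemma smear_continuous:
  assumes "cont_bdd \<phi>" "cont_bdd \<psi>" "integrable lborel p"
  shows "continuous_on UNIV (smear \<phi> \<psi> k p)"
proof -
  obtain C where C: "0 \<le> C" "\<And>s t. \<bar>\<phi> s * \<psi> t\<bar> \<le> C" using smear_bound[OF assms(1,2)] by blast
  have cont: "isCont \<phi> s" "isCont \<psi> s" for s
    using assms by (auto simp: cont_bdd_def continuous_on_eq_continuous_at)
  have [measurable]: "p \<in> borel_measurable borel" using borel_measurable_integrable[OF assms(3)] by simp
  have "isCont (smear \<phi> \<psi> k p) z" for z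
    unfolding continuous_at_sequentially o_def
  proof (intro allI impI)
    fix x :: "nat \<Rightarrow> real \<times> real" assume x: "x \<longlonglongrightarrow> z"
    show "(\<lambda>n. smear \<phi> \<psi> k p (x n)) \<longlonglongrightarrow> smear \<phi> \<psi> k p z"
      unfolding smear_def
    proof (rule integral_dominated_convergence[where w="\<lambda>y. \<bar>p y\<bar> * C"])
      show "AE y in lborel. (\<lambda>i. p y * (\<phi> (k * (fst (x i) - fst y)) * \<psi> (k * (snd (x i) - snd y))))
         \<longlonglongrightarrow> p y * (\<phi> (k * (fst z - fst y)) * \<psi> (k * (snd z - snd y)))"
        by (intro AE_I2 tendsto_intros isCont_tendsto_compose[OF cont(1)] isCont_tendsto_compose[OF cont(2)] x)
      show "AE y in lborel. norm (p y * (\<phi> (k * (fst (x i) - fst y)) * \<psi> (k * (snd (x i) - snd y)))) \<le> \<bar>p y\<bar> * C" for i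
        using C by (intro AE_I2) (simp add: abs_mult[of "p _"] mult_left_mono)
    qed (use assms smear_integrand_measurable[OF assms(1,2)] in auto)
  qed
  then show ?thesis by (simp add: continuous_on_eq_continuous_at)
qed

lemma smear_DERIV:
  assumes \<phi>: "cont_bdd \<phi>" "cont_bdd \<phi>'" "\<And>x. (\<phi> has_real_derivative \<phi>' x) (at x)"
    and \<psi>: "cont_bdd \<psi>" and p: "integrable lborel p"
  shows "((\<lambda>a. smear \<phi> \<psi> k p (a, b)) has_real_derivative k * smear \<phi>' \<psi> k p (a, b)) (at a)"
    and "((\<lambda>b. smear \<psi> \<phi> k p (a, b)) has_real_derivative k * smear \<psi> \<phi>' k p (a, b)) (at b)"
proof -
  have pb: "p \<in> borel_measurable borel" using borel_measurable_integrable[OF p] by simp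
  obtain C where C: "0 \<le> C" "\<And>s t. \<bar>\<phi>' s * \<psi> t\<bar> \<le> C" using smear_bound[OF \<phi>(2) \<psi>] by blast
  have C': "\<bar>\<psi> t * \<phi>' s\<bar> \<le> C" for s t using C(2)[of s t] by (simp add: mult.commute)
  have b: "\<bar>k * (p y * r)\<bar> \<le> \<bar>p y\<bar> * (C * \<bar>k\<bar>)" if "\<bar>r\<bar> \<le> C" for y r
    using mult_left_mono[OF that, of "\<bar>k\<bar> * \<bar>p y\<bar>"] by (simp add: abs_mult ac_simps)
  have d: "((\<lambda>a. \<phi> (k * (a - c))) has_real_derivative k * \<phi>' (k * (a - c))) (at a)" for a c
    by (rule DERIV_cong[OF DERIV_chain2[OF \<phi>(3)]]) (auto intro!: derivative_eq_intros)
  show "((\<lambda>a. smear \<phi> \<psi> k p (a, b)) has_real_derivative k * smear \<phi>' \<psi> k p (a, b)) (at a)"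
    unfolding smear_def integral_mult_right_zero[symmetric] fst_conv snd_conv
  proof (rule DERIV_integral_dominated[where w="\<lambda>y. \<bar>p y\<bar> * (C * \<bar>k\<bar>)"])
    show "((\<lambda>t. p y * (\<phi> (k * (t - fst y)) * \<psi> (k * (b - snd y)))) has_real_derivative
          k * (p y * (\<phi>' (k * (t - fst y)) * \<psi> (k * (b - snd y))))) (at t)" for t y
      by (rule DERIV_cong, rule DERIV_cmult, rule DERIV_mult'[OF d DERIV_const]) (simp add: algebra_simps)
    show "integrable lborel (\<lambda>y. p y * (\<phi> (k * (t - fst y)) * \<psi> (k * (b - snd y))))" for t
      using smear_integrable[OF \<phi>(1) \<psi> p, of k "(t, b)"] by simp
    show "(\<lambda>y. k * (p y * (\<phi>' (k * (t - fst y)) * \<psi> (k * (b - snd y))))) \<in> borel_measurable lborel" for t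
      using smear_integrand_measurable[OF \<phi>(2) \<psi> pb, of k "(t, b)"] by simp
  qed (use p b C in auto)
  show "((\<lambda>b. smear \<psi> \<phi> k p (a, b)) has_real_derivative k * smear \<psi> \<phi>' k p (a, b)) (at b)"
    unfolding smear_def integral_mult_right_zero[symmetric] fst_conv snd_conv
  proof (rule DERIV_integral_dominated[where w="\<lambda>y. \<bar>p y\<bar> * (C * \<bar>k\<bar>)"])
    show "((\<lambda>t. p y * (\<psi> (k * (a - fst y)) * \<phi> (k * (t - snd y)))) has_real_derivative
          k * (p y * (\<psi> (k * (a - fst y)) * \<phi>' (k * (t - snd y))))) (at t)" for t y
      by (rule DERIV_cong, rule DERIV_cmult, rule DERIV_mult'[OF DERIV_const d]) (simp add: algebra_simps)
    show "integrable lborel (\<lambda>y. p y * (\<psi> (k * (a - fst y)) * \<phi> (k * (t - snd y))))" for t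
      using smear_integrable[OF \<psi> \<phi>(1) p, of k "(a, t)"] by simp
    show "(\<lambda>y. k * (p y * (\<psi> (k * (a - fst y)) * \<phi>' (k * (t - snd y))))) \<in> borel_measurable lborel" for t
      using smear_integrand_measurable[OF \<psi> \<phi>(2) pb, of k "(a, t)"] by simp
  qed (use p b C' in auto)
qed

definition mollify :: "real \<Rightarrow> (real \<times> real \<Rightarrow> real) \<Rightarrow> real \<times> real \<Rightarrow> real" where
  "mollify k p z = k\<^sup>2 * smear bump bump k p z"

lemma nn_integral_bump_scaled:
  assumes "0 < k"
  shows "(\<integral>\<^sup>+x. ennreal (k * bump (k * (x - c))) \<partial>lborel) = 1"
    "(\<integral>\<^sup>+x. ennreal (k * bump (k * (c - x))) \<partial>lborel) = 1"
proof -
  have [measurable]: "bump \<in> borel_measurable borel" by (rule cont_bdd_measurable[OF cont_bdd_bump(1)])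
  have 1: "(\<integral>\<^sup>+x. ennreal (bump x) \<partial>lborel) = 1"
    using integral_bump bump_nonneg by (subst nn_integral_eq_integral) auto
  have "(\<integral>\<^sup>+x. ennreal (bump x) \<partial>lborel) = ennreal \<bar>k\<bar> * (\<integral>\<^sup>+x. ennreal (bump (- k * c + k * x)) \<partial>lborel)"
    using assms by (intro nn_integral_real_affine) auto
  also have "\<dots> = (\<integral>\<^sup>+x. ennreal (k * bump (k * (x - c))) \<partial>lborel)"
    using assms by (subst nn_integral_cmult[symmetric]) (auto simp: ennreal_mult' algebra_simps)
  finally show "(\<integral>\<^sup>+x. ennreal (k * bump (k * (x - c))) \<partial>lborel) = 1" using 1 by simp
  have "(\<integral>\<^sup>+x. ennreal (bump x) \<partial>lborel) = ennreal \<bar>- k\<bar> * (\<integral>\<^sup>+x. ennreal (bump (k * c + - k * x)) \<partial>lborel)"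
    using assms by (intro nn_integral_real_affine) auto
  also have "\<dots> = (\<integral>\<^sup>+x. ennreal (k * bump (k * (c - x))) \<partial>lborel)"
    using assms by (subst nn_integral_cmult[symmetric]) (auto simp: ennreal_mult' algebra_simps)
  finally show "(\<integral>\<^sup>+x. ennreal (k * bump (k * (c - x))) \<partial>lborel) = 1" using 1 by simp
qed

text \<open>The kernel of \<open>mollify\<close>, with \<open>k\<^sup>2\<close> split between the
  coordinates so that each one-dimensional factor has mass one.\<close>

definition kern :: "real \<Rightarrow> real \<times> real \<Rightarrow> real \<times> real \<Rightarrow> real" where
  "kern k z y = (k * bump (k * (fst z - fst y))) * (k * bump (k * (snd z - snd y)))"

lemma kern_measurable [measurable]:
  "case_prod (kern k) \<in> borel_measurable ((lborel :: (real \<times> real) measure) \<Otimes>\<^sub>M lborel)"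
  "kern k z \<in> borel_measurable borel" "(\<lambda>z. kern k z y) \<in> borel_measurable borel"
proof -
  have b: "continuous_on UNIV bump" using cont_bdd_bump(1) by (simp add: cont_bdd_def)
  have "continuous_on UNIV (\<lambda>w. kern k (fst w) (snd w))"
    unfolding kern_def by (intro continuous_intros continuous_on_compose2[OF b]) auto
  then show "case_prod (kern k) \<in> borel_measurable ((lborel :: (real \<times> real) measure) \<Otimes>\<^sub>M lborel)"
    by (simp add: lborel_prod case_prod_beta' borel_measurable_continuous_onI)
  have "continuous_on UNIV (kern k z)" "continuous_on UNIV (\<lambda>z. kern k z y)"
    unfolding kern_def[abs_def] by (intro continuous_intros continuous_on_compose2[OF b]; auto)+
  then show "kern k z \<in> borel_measurable borel" "(\<lambda>z. kern k z y) \<in> borel_measurable borel"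
    by (auto intro: borel_measurable_continuous_onI)
qed

lemma kern_nonneg: "0 \<le> k \<Longrightarrow> 0 \<le> kern k z y"
  by (simp add: kern_def bump_nonneg)

lemma nn_integral_kern:
  assumes "0 < k"
  shows "(\<integral>\<^sup>+z. ennreal (kern k z y) \<partial>lborel) = 1" "(\<integral>\<^sup>+y. ennreal (kern k z y) \<partial>lborel) = 1"
proof -
  note [measurable] = cont_bdd_measurable[OF cont_bdd_bump(1)]
  have "(\<integral>\<^sup>+z. ennreal (kern k z y) \<partial>lborel) = (\<integral>\<^sup>+z. ennreal (kern k z y) \<partial>(lborel \<Otimes>\<^sub>M lborel))"
    by (simp add: lborel_prod)
  also have "\<dots> = (\<integral>\<^sup>+a. \<integral>\<^sup>+b. ennreal (kern k (a, b) y) \<partial>lborel \<partial>lborel)"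
    by (rule lborel.nn_integral_fst[symmetric]) (simp add: lborel_prod)
  also have "\<dots> = (\<integral>\<^sup>+a. ennreal (k * bump (k * (a - fst y))) * (\<integral>\<^sup>+b. ennreal (k * bump (k * (b - snd y))) \<partial>lborel) \<partial>lborel)"
    unfolding kern_def fst_conv snd_conv using assms bump_nonneg
    by (intro nn_integral_cong, subst nn_integral_cmult[symmetric]) (auto simp: ennreal_mult')
  also have "\<dots> = 1" using nn_integral_bump_scaled[OF assms] by simp
  finally show "(\<integral>\<^sup>+z. ennreal (kern k z y) \<partial>lborel) = 1" .
  have "(\<integral>\<^sup>+y. ennreal (kern k z y) \<partial>lborel) = (\<integral>\<^sup>+y. ennreal (kern k z y) \<partial>(lborel \<Otimes>\<^sub>M lborel))"
    by (simp add: lborel_prod)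
  also have "\<dots> = (\<integral>\<^sup>+a. \<integral>\<^sup>+b. ennreal (kern k z (a, b)) \<partial>lborel \<partial>lborel)"
    by (rule lborel.nn_integral_fst[symmetric]) (simp add: lborel_prod)
  also have "\<dots> = (\<integral>\<^sup>+a. ennreal (k * bump (k * (fst z - a))) * (\<integral>\<^sup>+b. ennreal (k * bump (k * (snd z - b))) \<partial>lborel) \<partial>lborel)"
    unfolding kern_def fst_conv snd_conv using assms bump_nonneg
    by (intro nn_integral_cong, subst nn_integral_cmult[symmetric]) (auto simp: ennreal_mult')
  also have "\<dots> = 1" using nn_integral_bump_scaled[OF assms] by simp
  finally show "(\<integral>\<^sup>+y. ennreal (kern k z y) \<partial>lborel) = 1" .
qed

lemma kern_integrable: "0 < k \<Longrightarrow> integrable lborel (kern k z)" "0 < k \<Longrightarrow> (LINT y|lborel. kern k z y) = 1"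
proof -
  assume k: "0 < k"
  show i: "integrable lborel (kern k z)"
    by (rule integrableI_nonneg) (use k kern_nonneg[of k] in \<open>auto simp: nn_integral_kern(2)[OF k]\<close>)
  show "(LINT y|lborel. kern k z y) = 1"
    using k kern_nonneg[of k] nn_integral_kern(2)[OF k, of z]
    by (subst integral_eq_nn_integral) auto
qed

lemma mollify_eq: "mollify k p z = (LINT y|lborel. p y * kern k z y)"
  unfolding mollify_def smear_def kern_def integral_mult_right_zero[symmetric]
  by (rule Bochner_Integration.integral_cong) (auto simp: power2_eq_square)

lemma mollify_integrable: "integrable lborel p \<Longrightarrow> integrable lborel (\<lambda>y. p y * kern k z y)"
  using smear_integrable[OF cont_bdd_bump(1) cont_bdd_bump(1), of p k z, THEN integrable_mult_left, of "k * k"]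
  by (simp add: kern_def ac_simps)

lemma mollify_diff:
  "integrable lborel p \<Longrightarrow> integrable lborel q \<Longrightarrow> mollify k (\<lambda>y. p y - q y) z = mollify k p z - mollify k q z"
  unfolding mollify_eq by (simp add: left_diff_distrib mollify_integrable)

lemma mollify_continuous: "integrable lborel p \<Longrightarrow> continuous_on UNIV (mollify k p)"
  unfolding mollify_def[abs_def] by (intro continuous_intros smear_continuous cont_bdd_bump)

lemma mollify_bound:
  assumes k: "0 < k" and p: "integrable lborel p" and M: "\<And>y. \<bar>p y\<bar> \<le> M"
  shows "\<bar>mollify k p z\<bar> \<le> M"
proof -
  have "\<bar>mollify k p z\<bar> \<le> (LINT y|lborel. \<bar>p y * kern k z y\<bar>)"
    unfolding mollify_eq by (rule integral_abs_bound)
  also have "\<dots> \<le> (LINT y|lborel. M * kern k z y)"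
  proof (rule integral_mono)
    show "integrable lborel (\<lambda>y. \<bar>p y * kern k z y\<bar>)" using mollify_integrable[OF p] by simp
    show "\<bar>p y * kern k z y\<bar> \<le> M * kern k z y" for y
      using M kern_nonneg[of k z y] k by (simp add: abs_mult mult_right_mono)
  qed (use k in \<open>simp add: kern_integrable\<close>)
  also have "\<dots> = M" using k by (simp add: kern_integrable)
  finally show ?thesis .
qed

lemma kern_zero:
  assumes "0 < k" "1 / k \<le> \<bar>fst z - fst y\<bar> \<or> 1 / k \<le> \<bar>snd z - snd y\<bar>"
  shows "kern k z y = 0"
proof -
  have "bump (k * t) = 0" if "1 / k \<le> \<bar>t\<bar>" for t
    using that assms(1) by (intro bump_zero) (simp add: abs_mult field_simps)
  then show ?thesis using assms(2) by (auto simp: kern_def)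
qed

text \<open>Tonelli's theorem and the unit mass of the kernel in \<open>z\<close>. It allows
  \<open>L\<^sup>1\<close> convergence to be checked on a dense class.\<close>

lemma mollify_contraction:
  assumes k: "0 < k" and p: "integrable lborel p"
  shows "(\<integral>\<^sup>+z. ennreal \<bar>mollify k p z\<bar> \<partial>lborel) \<le> (\<integral>\<^sup>+y. ennreal \<bar>p y\<bar> \<partial>lborel)"
proof -
  have [measurable]: "p \<in> borel_measurable borel" using borel_measurable_integrable[OF p] by simp
  have "(\<integral>\<^sup>+z. ennreal \<bar>mollify k p z\<bar> \<partial>lborel) \<le> (\<integral>\<^sup>+z. \<integral>\<^sup>+y. ennreal (\<bar>p y\<bar> * kern k z y) \<partial>lborel \<partial>lborel)"
  proof (rule nn_integral_mono)
    fix z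
    have "ennreal \<bar>mollify k p z\<bar> \<le> (\<integral>\<^sup>+y. ennreal (norm (p y * kern k z y)) \<partial>lborel)"
      unfolding mollify_eq real_norm_def[symmetric] by (rule integral_norm_bound_ennreal[OF mollify_integrable[OF p]])
    also have "(\<lambda>y. norm (p y * kern k z y)) = (\<lambda>y. \<bar>p y\<bar> * kern k z y)"
      using kern_nonneg[of k z] k by (simp add: abs_mult fun_eq_iff)
    finally show "ennreal \<bar>mollify k p z\<bar> \<le> (\<integral>\<^sup>+y. ennreal (\<bar>p y\<bar> * kern k z y) \<partial>lborel)" .
  qed
  also have "\<dots> = (\<integral>\<^sup>+y. \<integral>\<^sup>+z. ennreal (\<bar>p y\<bar> * kern k z y) \<partial>lborel \<partial>lborel)"
    by (rule lborel_pair.Fubini') measurable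
  also have "\<dots> = (\<integral>\<^sup>+y. ennreal \<bar>p y\<bar> * (\<integral>\<^sup>+z. ennreal (kern k z y) \<partial>lborel) \<partial>lborel)"
    by (intro nn_integral_cong, subst nn_integral_cmult[symmetric])
      (auto simp: ennreal_mult kern_nonneg k less_imp_le)
  also have "\<dots> = (\<integral>\<^sup>+y. ennreal \<bar>p y\<bar> \<partial>lborel)" using nn_integral_kern[OF k] by simp
  finally show ?thesis .
qed

text \<open>The continuous functions \<open>h n\<close> behind \<open>measurable_on\<close> converge
  only pointwise almost everywhere. Clipping to \<open>[-M, M]\<close> and the cutoff
  \<open>c\<close> provide a majorant for dominated convergence and do not change the limit.\<close>

lemma bounded_support_approx_continuous:
  fixes p :: "real \<times> real \<Rightarrow> real"
  assumes [measurable]: "p \<in> borel_measurable borel" and M: "\<And>z. \<bar>p z\<bar> \<le> M"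
    and R: "\<And>z. R < norm z \<Longrightarrow> p z = 0" and e: "0 < e"
  obtains g where "continuous_on UNIV g" "\<And>z. \<bar>g z\<bar> \<le> M" "\<And>z. R + 1 < norm z \<Longrightarrow> g z = 0"
    "(\<integral>\<^sup>+z. ennreal \<bar>p z - g z\<bar> \<partial>lborel) < ennreal e"
proof -
  have M0: "0 \<le> M" using M[of 0] by simp
  have "p measurable_on UNIV"
    by (intro lebesgue_measurable_imp_measurable_on) (auto intro: measurable_completion)
  then obtain N h where N: "negligible N" and h: "\<And>n. continuous_on UNIV (h n)"
    and lim: "\<And>x. x \<notin> N \<Longrightarrow> (\<lambda>n. h n x) \<longlonglongrightarrow> p x"
    unfolding measurable_on_def by auto
  define c where "c z = max 0 (min 1 (R + 1 - norm z))" for z :: "real \<times> real"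
  have c: "0 \<le> c z" "c z \<le> 1" "R + 1 < norm z \<Longrightarrow> c z = 0" "norm z \<le> R \<Longrightarrow> c z = 1" for z
    by (auto simp: c_def)
  define g where "g n z = c z * max (- M) (min M (h n z))" for n z
  have gc: "continuous_on UNIV (g n)" for n
    unfolding g_def c_def by (intro continuous_intros h)
  have clip: "\<bar>max (- M) (min M t)\<bar> \<le> M" for t using M0 by auto
  have gM: "\<bar>g n z\<bar> \<le> M" for n z
    using mult_mono[OF c(2)[of z] clip[of "h n z"]] c(1)[of z] by (simp add: g_def abs_mult)
  have g0: "g n z = 0" if "R + 1 < norm z" for n z using that c(3) by (simp add: g_def)
  have glim: "(\<lambda>n. g n z) \<longlonglongrightarrow> p z" if "z \<notin> N" for z
  proof -
    have "(\<lambda>n. g n z) \<longlonglongrightarrow> c z * max (- M) (min M (p z))"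
      unfolding g_def by (intro tendsto_intros lim that)
    moreover have "max (- M) (min M (p z)) = p z" using M[of z] by (auto simp: abs_le_iff)
    moreover have "c z * p z = p z" using R[of z] c(4)[of z] by (cases "R < norm z") auto
    ultimately show ?thesis by simp
  qed
  have AEN: "AE z in lborel. z \<notin> N"
    using N AE_not_in[of N lebesgue] by (simp add: negligible_iff_null_sets AE_completion_iff)
  have [measurable]: "g n \<in> borel_measurable borel" for n by (rule borel_measurable_continuous_onI[OF gc])
  have "(\<lambda>n. \<integral>\<^sup>+z. ennreal \<bar>p z - g n z\<bar> \<partial>lborel) \<longlonglongrightarrow> (\<integral>\<^sup>+z. 0 \<partial>(lborel :: (real \<times> real) measure))"
  proof (rule nn_integral_dominated_convergence[where w="\<lambda>z. ennreal (2 * M) * indicator (cball (0 :: real \<times> real) (R + 1)) z"])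
    show "AE z in lborel. ennreal \<bar>p z - g n z\<bar> \<le> ennreal (2 * M) * indicator (cball (0 :: real \<times> real) (R + 1)) z" for n
    proof (rule AE_I2)
      fix z
      have "\<bar>p z - g n z\<bar> \<le> 2 * M" using M[of z] gM[of n z] by linarith
      moreover have "p z - g n z = 0" if "R + 1 < norm z" using R[of z] g0[OF that] that by simp
      ultimately show "ennreal \<bar>p z - g n z\<bar> \<le> ennreal (2 * M) * indicator (cball (0 :: real \<times> real) (R + 1)) z"
        by (cases "R + 1 < norm z") (auto simp: indicator_def intro: ennreal_leI)
    qed
    have "emeasure lborel (cball (0 :: real \<times> real) (R + 1)) < \<infinity>"
      by (intro emeasure_bounded_finite) simp
    then show "(\<integral>\<^sup>+z. ennreal (2 * M) * indicator (cball (0 :: real \<times> real) (R + 1)) z \<partial>(lborel :: (real \<times> real) measure)) < \<infinity>"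
      by (subst nn_integral_cmult_indicator) (auto simp: ennreal_mult_less_top)
    show "AE z in lborel. (\<lambda>n. ennreal \<bar>p z - g n z\<bar>) \<longlonglongrightarrow> 0"
      using AEN
    proof eventually_elim
      case (elim z)
      have "(\<lambda>n. ennreal \<bar>p z - g n z\<bar>) \<longlonglongrightarrow> ennreal \<bar>p z - p z\<bar>"
        by (intro tendsto_intros tendsto_ennrealI glim elim)
      then show ?case by simp
    qed
    have "cball (0 :: real \<times> real) (R + 1) \<in> sets borel" by simp
    then show "(\<lambda>z. ennreal (2 * M) * indicator (cball (0 :: real \<times> real) (R + 1)) z) \<in> borel_measurable lborel"
      by measurable
  qed auto
  then have "(\<lambda>n. \<integral>\<^sup>+z. ennreal \<bar>p z - g n z\<bar> \<partial>lborel) \<longlonglongrightarrow> 0" by simp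
  then have "\<forall>\<^sub>F n in sequentially. (\<integral>\<^sup>+z. ennreal \<bar>p z - g n z\<bar> \<partial>lborel) < ennreal e"
    using e by (intro order_tendstoD(2)) auto
  then obtain n where "(\<integral>\<^sup>+z. ennreal \<bar>p z - g n z\<bar> \<partial>lborel) < ennreal e"
    by (auto simp: eventually_sequentially)
  then show ?thesis using gc gM g0 by (intro that)
qed

lemma integrable_bounded_support:
  fixes p :: "real \<times> real \<Rightarrow> real"
  assumes "p \<in> borel_measurable borel" "\<And>z. \<bar>p z\<bar> \<le> M" "\<And>z. R < norm z \<Longrightarrow> p z = 0"
  shows "integrable lborel p"
proof (rule Bochner_Integration.integrable_bound)
  show "integrable lborel (\<lambda>z. M * indicator (cball (0 :: real \<times> real) R) z)"
    by (intro integrable_mult_right integrable_real_indicator emeasure_bounded_finite) auto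
  show "AE z in lborel. norm (p z) \<le> norm (M * indicator (cball 0 R) z)"
  proof (rule AE_I2)
    fix z show "norm (p z) \<le> norm (M * indicator (cball 0 R) z)"
      using assms(2)[of z] assms(3)[of z] by (cases "R < norm z") (auto simp: indicator_def)
  qed
qed (use assms in simp)

lemma mollify_L1_continuous:
  fixes g :: "real \<times> real \<Rightarrow> real"
  assumes g: "continuous_on UNIV g" "\<And>z. R < norm z \<Longrightarrow> g z = 0" and R: "0 < R" and e: "0 < e"
  shows "\<exists>K>0. \<forall>k\<ge>K. (\<integral>\<^sup>+z. ennreal \<bar>mollify k g z - g z\<bar> \<partial>lborel) < ennreal e"
proof -
  define A where "A = measure lborel (cball (0 :: real \<times> real) (R + 2))"
  have A: "0 \<le> A" by (simp add: A_def)
  define d0 where "d0 = e / (A + 1) / 2"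
  have d0: "0 < d0" using e A by (simp add: d0_def)
  have "d0 * (A + 1) = e / 2" using A by (simp add: d0_def divide_simps)
  then have "2 * (d0 * A) + 2 * d0 = e" by (simp add: distrib_left)
  then have d0A: "d0 * A < e" using d0 mult_nonneg_nonneg[of d0 A] A by linarith
  have "uniformly_continuous_on (cball 0 (R + 4)) g"
    by (intro compact_uniformly_continuous continuous_on_subset[OF g(1)]) auto
  then obtain d where d: "d > 0" "\<And>x y. x \<in> cball 0 (R + 4) \<Longrightarrow> y \<in> cball 0 (R + 4) \<Longrightarrow> dist y x < d \<Longrightarrow> dist (g y) (g x) < d0"
    using d0 unfolding uniformly_continuous_on_def by metis
  \<comment> \<open>The kernel reaches points at distance below \<open>2 / k\<close>. This must be
    less than \<open>d\<close>, and at most \<open>2\<close>: then everything is supported in radius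
    \<open>R + 2\<close>, and uniform continuity on radius \<open>R + 4\<close> suffices.\<close>
  define K where "K = max 1 (3 / d)"
  have close: "\<bar>g y - g z\<bar> \<le> d0" if yz: "\<bar>fst z - fst y\<bar> < 1 / k" "\<bar>snd z - snd y\<bar> < 1 / k" and k: "K \<le> k"
    and z: "norm z \<le> R + 2" for y z k
  proof -
    have k1: "1 \<le> k" "3 / d \<le> k" using k by (auto simp: K_def)
    have "dist y z \<le> \<bar>fst z - fst y\<bar> + \<bar>snd z - snd y\<bar>"
      unfolding dist_prod_def dist_real_def using sqrt_sum_squares_le_sum_abs[of "fst y - fst z" "snd y - snd z"]
      by (simp add: abs_minus_commute)
    then have 1: "dist y z < 2 / k" using yz by simp
    also have "2 / k \<le> 2" using k1 by (simp add: divide_le_eq)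
    finally have "norm y \<le> R + 4" using z norm_triangle_sub[of y z] by (simp add: dist_norm)
    moreover have "2 / k < d" using k1 d(1) by (simp add: field_simps)
    ultimately have "dist (g y) (g z) < d0" using d(2)[of z y] 1 z by simp
    then show ?thesis by (simp add: dist_real_def)
  qed
  obtain M where M: "\<And>z. \<bar>g z\<bar> \<le> M"
  proof -
    have "compact (g ` cball 0 R)" by (intro compact_continuous_image continuous_on_subset[OF g(1)]) auto
    then obtain C where C: "\<forall>y\<in>g ` cball 0 R. norm y \<le> C" using compact_imp_bounded bounded_iff by blast
    show ?thesis
    proof (rule that[of "max C 0"])
      fix z show "\<bar>g z\<bar> \<le> max C 0"
      proof (cases "R < norm z")
        case False then have "\<bar>g z\<bar> \<le> C" using C by auto then show ?thesis by simp
      qed (use g(2) in simp)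
    qed
  qed
  have [measurable]: "g \<in> borel_measurable borel" by (rule borel_measurable_continuous_onI[OF g(1)])
  have gi: "integrable lborel g" by (rule integrable_bounded_support[OF _ M g(2)]) auto
  show ?thesis
  proof (intro exI conjI allI impI)
    show "K > 0" by (simp add: K_def)
    fix k assume k: "K \<le> k"
    have k1: "1 \<le> k" "0 < k" using k by (auto simp: K_def)
    have bound: "\<bar>mollify k g z - g z\<bar> \<le> d0 * indicator (cball (0 :: real \<times> real) (R + 2)) z" for z
    proof (cases "norm z \<le> R + 2")
      case True
      have "mollify k g z - g z = (LINT y|lborel. g y * kern k z y - g z * kern k z y)"
        using k1 by (subst Bochner_Integration.integral_diff)
          (auto simp: mollify_integrable[OF gi] kern_integrable mollify_eq)
      also have "\<bar>\<dots>\<bar> \<le> (LINT y|lborel. \<bar>g y * kern k z y - g z * kern k z y\<bar>)" by (rule integral_abs_bound)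
      also have "\<dots> \<le> (LINT y|lborel. d0 * kern k z y)"
      proof (rule integral_mono)
        show "integrable lborel (\<lambda>y. \<bar>g y * kern k z y - g z * kern k z y\<bar>)"
          using k1 by (auto simp: mollify_integrable[OF gi] kern_integrable)
        show "\<bar>g y * kern k z y - g z * kern k z y\<bar> \<le> d0 * kern k z y" for y
        proof (cases "kern k z y = 0")
          case False
          then have "\<bar>fst z - fst y\<bar> < 1 / k" "\<bar>snd z - snd y\<bar> < 1 / k"
            using kern_zero[of k z y] k1 by force+
          from mult_right_mono[OF close[OF this k True] kern_nonneg[of k z y]] k1 show ?thesis
            by (simp add: abs_mult kern_nonneg left_diff_distrib[symmetric])
        qed simp
      qed (use k1 in \<open>simp add: kern_integrable\<close>)
      also have "\<dots> = d0" using k1 by (simp add: kern_integrable)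
      finally show ?thesis using True by simp
    next
      case False
      have "g y * kern k z y = 0" for y
      proof (cases "kern k z y = 0")
        case nz: False
        have le: "1 / k \<le> 1" using k1 by simp
        have "\<bar>fst z - fst y\<bar> < 1 / k" "\<bar>snd z - snd y\<bar> < 1 / k"
          using kern_zero[of k z y] k1 nz by force+
        then have "\<bar>fst y - fst z\<bar> + \<bar>snd y - snd z\<bar> < 2" using le by linarith
        then have "dist y z < 2"
          unfolding dist_prod_def dist_real_def using sqrt_sum_squares_le_sum_abs[of "fst y - fst z" "snd y - snd z"]
          by simp
        then have "norm y > R" using False norm_triangle_sub[of z y] by (simp add: dist_norm norm_minus_commute)
        then show ?thesis using g(2) by simp
      qed simp
      then have "mollify k g z = (LINT y|(lborel :: (real \<times> real) measure). 0)" unfolding mollify_eq by (simp only:)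
      moreover have "g z = 0" using False R by (intro g(2)) simp
      ultimately show ?thesis using False by simp
    qed
    have "(\<integral>\<^sup>+z. ennreal \<bar>mollify k g z - g z\<bar> \<partial>lborel) \<le> (\<integral>\<^sup>+z. ennreal d0 * indicator (cball (0 :: real \<times> real) (R + 2)) z \<partial>lborel)"
    proof (rule nn_integral_mono)
      fix z show "ennreal \<bar>mollify k g z - g z\<bar> \<le> ennreal d0 * indicator (cball (0 :: real \<times> real) (R + 2)) z"
        using bound[of z] by (cases "norm z \<le> R + 2") (auto intro: ennreal_leI)
    qed
    also have "\<dots> = ennreal d0 * emeasure lborel (cball (0 :: real \<times> real) (R + 2))"
      by (simp add: nn_integral_cmult_indicator)
    also have "emeasure lborel (cball (0 :: real \<times> real) (R + 2)) = ennreal A"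
      unfolding A_def by (intro emeasure_eq_ennreal_measure) (use emeasure_bounded_finite[of "cball (0::real\<times>real) (R+2)"] in auto)
    also have "ennreal d0 * ennreal A = ennreal (d0 * A)" using A d0 by (simp add: ennreal_mult)
    also have "\<dots> < ennreal e" using d0A e by (simp add: ennreal_lessI)
    finally show "(\<integral>\<^sup>+z. ennreal \<bar>mollify k g z - g z\<bar> \<partial>lborel) < ennreal e" .
  qed
qed

text \<open>The contraction property reduces the claim to a continuous approximation
  \<open>g\<close>; an error \<open>e / 3\<close> comes from mollifying \<open>p - g\<close>, from
  mollifying \<open>g\<close>, and from \<open>p - g\<close> itself.\<close>

lemma mollify_L1:
  fixes p :: "real \<times> real \<Rightarrow> real"
  assumes p: "p \<in> borel_measurable borel" "\<And>z. \<bar>p z\<bar> \<le> M" "\<And>z. R < norm z \<Longrightarrow> p z = 0" and R: "0 < R"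
  shows "(\<lambda>n. LINT z|lborel. \<bar>mollify (real (Suc n)) p z - p z\<bar>) \<longlonglongrightarrow> 0"
    and "\<And>n. integrable lborel (mollify (real (Suc n)) p)"
proof -
  have pi: "integrable lborel p" by (rule integrable_bounded_support[OF p])
  have mm[measurable]: "mollify k q \<in> borel_measurable borel" if "integrable lborel q" for k q
    by (rule borel_measurable_continuous_onI[OF mollify_continuous[OF that]])
  show mi: "integrable lborel (mollify (real (Suc n)) p)" for n
  proof (rule integrableI_bounded)
    have "(\<integral>\<^sup>+z. ennreal (norm (mollify (real (Suc n)) p z)) \<partial>lborel) \<le> (\<integral>\<^sup>+y. ennreal \<bar>p y\<bar> \<partial>lborel)"
      using mollify_contraction[OF _ pi, of "real (Suc n)"] by simp
    also have "\<dots> < \<infinity>" using pi by (simp add: integrable_iff_bounded)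
    finally show "(\<integral>\<^sup>+z. ennreal (norm (mollify (real (Suc n)) p z)) \<partial>lborel) < \<infinity>" .
  qed (use mm[OF pi] in simp)
  have main: "\<exists>N. \<forall>n\<ge>N. (\<integral>\<^sup>+z. ennreal \<bar>mollify (real (Suc n)) p z - p z\<bar> \<partial>lborel) < ennreal e" if e: "0 < e" for e
  proof -
    obtain g where g: "continuous_on UNIV g" "\<And>z. \<bar>g z\<bar> \<le> M" "\<And>z. R + 1 < norm z \<Longrightarrow> g z = 0"
      and pg: "(\<integral>\<^sup>+z. ennreal \<bar>p z - g z\<bar> \<partial>lborel) < ennreal (e / 3)"
      using bounded_support_approx_continuous[OF p, where e="e/3"] e by auto
    have gm[measurable]: "g \<in> borel_measurable borel" by (rule borel_measurable_continuous_onI[OF g(1)])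
    have gi: "integrable lborel g" by (rule integrable_bounded_support[OF gm g(2,3)])
    obtain K where K: "K > 0" "\<And>k. k \<ge> K \<Longrightarrow> (\<integral>\<^sup>+z. ennreal \<bar>mollify k g z - g z\<bar> \<partial>lborel) < ennreal (e / 3)"
      using mollify_L1_continuous[of g "R + 1" "e/3"] g e R by auto
    obtain N where N: "K \<le> real N" using real_arch_simple by blast
    show ?thesis
    proof (intro exI allI impI)
      fix n assume n: "N \<le> n"
      define k where "k = real (Suc n)"
      have k: "k > 0" "k \<ge> K" using n N by (auto simp: k_def)
      have "(\<integral>\<^sup>+z. ennreal \<bar>mollify k p z - p z\<bar> \<partial>lborel)
        \<le> (\<integral>\<^sup>+z. ennreal \<bar>mollify k (\<lambda>y. p y - g y) z\<bar> + ennreal \<bar>mollify k g z - g z\<bar> + ennreal \<bar>p z - g z\<bar> \<partial>lborel)"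
      proof (rule nn_integral_mono)
        fix z
        have "\<bar>mollify k p z - p z\<bar> \<le> \<bar>mollify k (\<lambda>y. p y - g y) z\<bar> + \<bar>mollify k g z - g z\<bar> + \<bar>p z - g z\<bar>"
          unfolding mollify_diff[OF pi gi] by linarith
        then show "ennreal \<bar>mollify k p z - p z\<bar> \<le> ennreal \<bar>mollify k (\<lambda>y. p y - g y) z\<bar>
            + ennreal \<bar>mollify k g z - g z\<bar> + ennreal \<bar>p z - g z\<bar>"
          by (simp add: ennreal_plus[symmetric] ennreal_leI del: ennreal_plus)
      qed
      also have "\<dots> = (\<integral>\<^sup>+z. ennreal \<bar>mollify k (\<lambda>y. p y - g y) z\<bar> \<partial>lborel)
          + (\<integral>\<^sup>+z. ennreal \<bar>mollify k g z - g z\<bar> \<partial>lborel) + (\<integral>\<^sup>+z. ennreal \<bar>p z - g z\<bar> \<partial>lborel)"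
      proof -
        have [measurable]: "mollify k (\<lambda>y. p y - g y) \<in> borel_measurable borel" "mollify k g \<in> borel_measurable borel"
          "p \<in> borel_measurable borel"
          using pi gi p by (auto intro!: mm)
        show ?thesis by (simp add: nn_integral_add)
      qed
      also have "\<dots> < ennreal (e / 3) + ennreal (e / 3) + ennreal (e / 3)"
      proof -
        have "(\<integral>\<^sup>+z. ennreal \<bar>mollify k (\<lambda>y. p y - g y) z\<bar> \<partial>lborel) \<le> (\<integral>\<^sup>+z. ennreal \<bar>p z - g z\<bar> \<partial>lborel)"
          using pi gi by (intro mollify_contraction[OF k(1)]) simp
        also note pg
        finally show ?thesis using K(2)[OF k(2)] pg by (intro add_strict_mono)
      qed
      also have "\<dots> = ennreal e" using e by (simp add: ennreal_plus[symmetric] del: ennreal_plus)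
      finally show "(\<integral>\<^sup>+z. ennreal \<bar>mollify k p z - p z\<bar> \<partial>lborel) < ennreal e" .
    qed
  qed
  show "(\<lambda>n. LINT z|lborel. \<bar>mollify (real (Suc n)) p z - p z\<bar>) \<longlonglongrightarrow> 0"
  proof (rule LIMSEQ_I)
    fix e :: real assume e: "0 < e"
    from main[OF this] obtain N where N: "\<And>n. n \<ge> N \<Longrightarrow> (\<integral>\<^sup>+z. ennreal \<bar>mollify (real (Suc n)) p z - p z\<bar> \<partial>lborel) < ennreal e" by blast
    show "\<exists>N. \<forall>n\<ge>N. norm ((LINT z|lborel. \<bar>mollify (real (Suc n)) p z - p z\<bar>) - 0) < e"
    proof (intro exI allI impI)
      fix n assume n: "N \<le> n"
      have "ennreal (LINT z|lborel. \<bar>mollify (real (Suc n)) p z - p z\<bar>)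
          = (\<integral>\<^sup>+z. ennreal \<bar>mollify (real (Suc n)) p z - p z\<bar> \<partial>lborel)"
        using mi pi by (intro nn_integral_eq_integral[symmetric]) auto
      with N[OF n] have "ennreal (LINT z|lborel. \<bar>mollify (real (Suc n)) p z - p z\<bar>) < ennreal e" by simp
      then have "(LINT z|lborel. \<bar>mollify (real (Suc n)) p z - p z\<bar>) < e"
        by (simp add: ennreal_less_iff)
      then show "norm ((LINT z|lborel. \<bar>mollify (real (Suc n)) p z - p z\<bar>) - 0) < e" by simp
    qed
  qed
qed

section \<open>Green's formula on rectangles\<close>

text \<open>Squares take the place of discs, so that boundary integrals run along coordinate
  lines.\<close>

definition sq :: "real \<times> real \<Rightarrow> real \<Rightarrow> (real \<times> real) set" where
  "sq z r = {fst z - r..fst z + r} \<times> {snd z - r..snd z + r}"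

lemma sq_cbox: "sq z r = cbox (fst z - r, snd z - r) (fst z + r, snd z + r)"
  by (simp add: sq_def cbox_Pair_eq)

lemma rect_cbox: "{a..b} \<times> {c..d} = cbox (a, c) (b, d :: real)" for a b :: real
  by (simp add: cbox_Pair_eq)

lemma sq_mono: "r \<le> s \<Longrightarrow> sq z r \<subseteq> sq z s"
  by (auto simp: sq_def)

lemma integral_rectangle_iterated:
  fixes f :: "real \<times> real \<Rightarrow> real"
  assumes "continuous_on ({a..b} \<times> {c..d}) f"
  shows "integral ({a..b} \<times> {c..d}) f = integral {a..b} (\<lambda>x. integral {c..d} (\<lambda>y. f (x, y)))"
    "integral ({a..b} \<times> {c..d}) f = integral {c..d} (\<lambda>y. integral {a..b} (\<lambda>x. f (x, y)))"
    "continuous_on {a..b} (\<lambda>x. integral {c..d} (\<lambda>y. f (x, y)))"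
    "continuous_on {c..d} (\<lambda>y. integral {a..b} (\<lambda>x. f (x, y)))"
proof -
  have c: "continuous_on (cbox (a, c) (b, d)) (\<lambda>(x, y). f (x, y))"
    using assms by (simp add: rect_cbox split_beta')
  show 1: "integral ({a..b} \<times> {c..d}) f = integral {a..b} (\<lambda>x. integral {c..d} (\<lambda>y. f (x, y)))"
    using integral_prod_continuous[OF c] by (simp add: rect_cbox)
  show "integral ({a..b} \<times> {c..d}) f = integral {c..d} (\<lambda>y. integral {a..b} (\<lambda>x. f (x, y)))"
    using integral_swap_continuous[OF c] unfolding 1 by simp
  show "continuous_on {a..b} (\<lambda>x. integral {c..d} (\<lambda>y. f (x, y)))"
    using integral_continuous_on_param[of "{a..b}" c d "\<lambda>x y. f (x, y)"] assms by (simp add: split_beta')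
  show "continuous_on {c..d} (\<lambda>y. integral {a..b} (\<lambda>x. f (x, y)))"
  proof -
    have "continuous_on ({c..d} \<times> cbox a b) (\<lambda>(y, x). f (x, y))"
      unfolding split_beta' by (rule continuous_on_compose2[OF assms]) (auto intro!: continuous_intros)
    from integral_continuous_on_param[OF this] show ?thesis by simp
  qed
qed

lemma slice_continuous:
  fixes f :: "real \<times> real \<Rightarrow> real"
  assumes "continuous_on ({a..b} \<times> {c..d}) f"
  shows "x \<in> {a..b} \<Longrightarrow> continuous_on {c..d} (\<lambda>y. f (x, y))" "y \<in> {c..d} \<Longrightarrow> continuous_on {a..b} (\<lambda>x. f (x, y))"
  by (auto intro!: continuous_on_compose2[OF assms] continuous_intros)

lemma green_rectangle:
  fixes A B A1 B2 :: "real \<times> real \<Rightarrow> real"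
  assumes ab: "a \<le> b" "c \<le> d"
    and A: "\<And>x y. x \<in> {a..b} \<Longrightarrow> y \<in> {c..d} \<Longrightarrow> ((\<lambda>x. A (x, y)) has_real_derivative A1 (x, y)) (at x)"
    and B: "\<And>x y. x \<in> {a..b} \<Longrightarrow> y \<in> {c..d} \<Longrightarrow> ((\<lambda>y. B (x, y)) has_real_derivative B2 (x, y)) (at y)"
    and cont: "continuous_on ({a..b} \<times> {c..d}) A1" "continuous_on ({a..b} \<times> {c..d}) B2"
  shows "integral ({a..b} \<times> {c..d}) (\<lambda>z. A1 z + B2 z)
    = integral {c..d} (\<lambda>t. A (b, t) - A (a, t)) + integral {a..b} (\<lambda>t. B (t, d) - B (t, c))"
proof -
  have int: "A1 integrable_on {a..b} \<times> {c..d}" "B2 integrable_on {a..b} \<times> {c..d}"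
    using cont unfolding rect_cbox by (auto intro: integrable_continuous)
  have 1: "integral {a..b} (\<lambda>x. A1 (x, y)) = A (b, y) - A (a, y)" if "y \<in> {c..d}" for y
    using ab A that by (intro integral_unique fundamental_theorem_of_calculus)
      (auto simp: has_real_derivative_iff_has_vector_derivative[symmetric] intro: has_field_derivative_at_within)
  have 2: "integral {c..d} (\<lambda>y. B2 (x, y)) = B (x, d) - B (x, c)" if "x \<in> {a..b}" for x
    using ab B that by (intro integral_unique fundamental_theorem_of_calculus)
      (auto simp: has_real_derivative_iff_has_vector_derivative[symmetric] intro: has_field_derivative_at_within)
  have "integral ({a..b} \<times> {c..d}) (\<lambda>z. A1 z + B2 z) = integral ({a..b} \<times> {c..d}) A1 + integral ({a..b} \<times> {c..d}) B2"
    by (rule integral_add[OF int])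
  also have "integral ({a..b} \<times> {c..d}) A1 = integral {c..d} (\<lambda>t. A (b, t) - A (a, t))"
    unfolding integral_rectangle_iterated(2)[OF cont(1)] by (rule integral_cong) (rule 1)
  also have "integral ({a..b} \<times> {c..d}) B2 = integral {a..b} (\<lambda>t. B (t, d) - B (t, c))"
    unfolding integral_rectangle_iterated(1)[OF cont(2)] by (rule integral_cong) (rule 2)
  finally show ?thesis .
qed

lemma ftc_bound:
  fixes F F' :: "real \<Rightarrow> real"
  assumes F: "\<And>x. x \<in> {l..u} \<Longrightarrow> (F has_real_derivative F' x) (at x)" and c: "continuous_on {l..u} F'"
    and ab: "a \<in> {l..u}" "b \<in> {l..u}"
  shows "\<bar>F b - F a\<bar> \<le> integral {l..u} (\<lambda>x. \<bar>F' x\<bar>)"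
proof -
  have *: "\<bar>F b - F a\<bar> \<le> integral {l..u} (\<lambda>x. \<bar>F' x\<bar>)" if ab: "l \<le> a" "a \<le> b" "b \<le> u" for a b
  proof -
    have sub: "{a..b} \<subseteq> {l..u}" using ab by auto
    have c': "continuous_on {a..b} F'" by (rule continuous_on_subset[OF c sub])
    have "(F' has_integral (F b - F a)) {a..b}"
      using ab sub F by (intro fundamental_theorem_of_calculus)
        (auto simp: has_real_derivative_iff_has_vector_derivative[symmetric] intro: has_field_derivative_at_within)
    then have "F b - F a = integral {a..b} F'" by (simp add: integral_unique)
    also have "\<bar>\<dots>\<bar> \<le> integral {a..b} (\<lambda>x. \<bar>F' x\<bar>)"
      using integral_norm_bound_integral[of F' "{a..b}" "\<lambda>x. \<bar>F' x\<bar>"] c'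
      by (auto intro!: integrable_continuous_real continuous_intros)
    also have "\<dots> \<le> integral {l..u} (\<lambda>x. \<bar>F' x\<bar>)"
      using sub c c' by (intro integral_subset_le) (auto intro!: integrable_continuous_real continuous_intros)
    finally show ?thesis .
  qed
  show ?thesis using *[of a b] *[of b a] ab by (cases "a \<le> b") auto
qed

text \<open>The minimum over \<open>[a, b]\<close> is at most the mean. This is how lines are found
  along which the integral of a gradient is small.\<close>

lemma good_line:
  fixes \<phi> :: "real \<Rightarrow> real"
  assumes c: "continuous_on {l..u} \<phi>" and nn: "\<And>t. t \<in> {l..u} \<Longrightarrow> 0 \<le> \<phi> t" and ab: "l \<le> a" "a \<le> b" "b \<le> u"
  shows "\<exists>t\<in>{a..b}. (b - a) * \<phi> t \<le> integral {l..u} \<phi>"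
proof -
  have sub: "{a..b} \<subseteq> {l..u}" using ab by auto
  have c': "continuous_on {a..b} \<phi>" by (rule continuous_on_subset[OF c sub])
  obtain t where t: "t \<in> {a..b}" "\<And>y. y \<in> {a..b} \<Longrightarrow> \<phi> t \<le> \<phi> y"
    using continuous_attains_inf[OF _ _ c'] ab by auto
  have "(b - a) * \<phi> t = integral {a..b} (\<lambda>_. \<phi> t)" using ab by simp
  also have "\<dots> \<le> integral {a..b} \<phi>" using t c' by (intro integral_le) (auto intro: integrable_continuous_real)
  also have "\<dots> \<le> integral {l..u} \<phi>"
    using sub c c' nn by (intro integral_subset_le) (auto intro!: integrable_continuous_real)
  finally show ?thesis using t by blast
qed

text \<open>Each side is chosen by averaging over the strip of width \<open>s - r\<close> next to a side of the outer square.\<close>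
lemma good_rectangle:
  fixes w :: "real \<times> real \<Rightarrow> real"
  assumes c: "continuous_on (sq z s) w" and nn: "\<And>x. x \<in> sq z s \<Longrightarrow> 0 \<le> w x" and rs: "0 < r" "r < s"
  obtains a b c d where "fst z - s \<le> a" "a \<le> fst z - r" "fst z + r \<le> b" "b \<le> fst z + s"
    "snd z - s \<le> c" "c \<le> snd z - r" "snd z + r \<le> d" "d \<le> snd z + s"
    "(s - r) * integral {c..d} (\<lambda>t. w (a, t)) \<le> integral (sq z s) w"
    "(s - r) * integral {c..d} (\<lambda>t. w (b, t)) \<le> integral (sq z s) w"
    "(s - r) * integral {a..b} (\<lambda>t. w (t, c)) \<le> integral (sq z s) w"
    "(s - r) * integral {a..b} (\<lambda>t. w (t, d)) \<le> integral (sq z s) w"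
proof -
  let ?X = "{fst z - s..fst z + s}" and ?Y = "{snd z - s..snd z + s}"
  have c': "continuous_on (?X \<times> ?Y) w" using c by (simp add: sq_def)
  note it = integral_rectangle_iterated[OF c'] and sl = slice_continuous[OF c']
  define f where "f x = integral ?Y (\<lambda>y. w (x, y))" for x
  define h where "h y = integral ?X (\<lambda>x. w (x, y))" for y
  have W: "integral (sq z s) w = integral ?X f" "integral (sq z s) w = integral ?Y h"
    using it unfolding f_def[abs_def] h_def[abs_def] sq_def by simp_all
  have cf: "continuous_on ?X f" "continuous_on ?Y h" using it unfolding f_def h_def by simp_all
  have nn': "x \<in> ?X \<Longrightarrow> y \<in> ?Y \<Longrightarrow> 0 \<le> w (x, y)" for x y using nn by (simp add: sq_def)
  have fh: "x \<in> ?X \<Longrightarrow> 0 \<le> f x" "y \<in> ?Y \<Longrightarrow> 0 \<le> h y" for x y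
    unfolding f_def h_def by (auto intro!: integral_nonneg integrable_continuous_real sl nn' simp del: atLeastAtMost_iff)
  obtain a where a: "a \<in> {fst z - s..fst z - r}" "(fst z - r - (fst z - s)) * f a \<le> integral ?X f"
    using good_line[OF cf(1) fh(1), of "fst z - s" "fst z - r"] rs by auto
  obtain b where b: "b \<in> {fst z + r..fst z + s}" "(fst z + s - (fst z + r)) * f b \<le> integral ?X f"
    using good_line[OF cf(1) fh(1), of "fst z + r" "fst z + s"] rs by auto
  obtain c where c: "c \<in> {snd z - s..snd z - r}" "(snd z - r - (snd z - s)) * h c \<le> integral ?Y h"
    using good_line[OF cf(2) fh(2), of "snd z - s" "snd z - r"] rs by auto
  obtain d where d: "d \<in> {snd z + r..snd z + s}" "(snd z + s - (snd z + r)) * h d \<le> integral ?Y h"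
    using good_line[OF cf(2) fh(2), of "snd z + r" "snd z + s"] rs by auto
  have subY: "{c..d} \<subseteq> ?Y" and subX: "{a..b} \<subseteq> ?X" using a b c d rs by auto
  have i1: "integral {c..d} (\<lambda>t. w (x, t)) \<le> f x" if "x \<in> ?X" for x
    unfolding f_def using that subY sl(1)[OF that] nn'
    by (intro integral_subset_le) (auto intro!: integrable_continuous_real intro: continuous_on_subset)
  have i2: "integral {a..b} (\<lambda>t. w (t, y)) \<le> h y" if "y \<in> ?Y" for y
    unfolding h_def using that subX sl(2)[OF that] nn'
    by (intro integral_subset_le) (auto intro!: integrable_continuous_real intro: continuous_on_subset)
  show ?thesis
  proof (rule that[of a b c d])
    show "(s - r) * integral {c..d} (\<lambda>t. w (a, t)) \<le> integral (sq z s) w"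
      unfolding W(1) by (rule order_trans[OF mult_left_mono[OF i1]]) (use a rs in auto)
    show "(s - r) * integral {c..d} (\<lambda>t. w (b, t)) \<le> integral (sq z s) w"
      unfolding W(1) by (rule order_trans[OF mult_left_mono[OF i1]]) (use b rs in auto)
    show "(s - r) * integral {a..b} (\<lambda>t. w (t, c)) \<le> integral (sq z s) w"
      unfolding W(2) by (rule order_trans[OF mult_left_mono[OF i2]]) (use c rs in auto)
    show "(s - r) * integral {a..b} (\<lambda>t. w (t, d)) \<le> integral (sq z s) w"
      unfolding W(2) by (rule order_trans[OF mult_left_mono[OF i2]]) (use d rs in auto)
  qed (use a b c d in auto)
qed

lemma potential_rectangle:
  fixes P Q P2 Q1 :: "real \<times> real \<Rightarrow> real"
  assumes P: "\<And>x y. ((\<lambda>y. P (x, y)) has_real_derivative P2 (x, y)) (at y)" and Q: "\<And>x y. ((\<lambda>x. Q (x, y)) has_real_derivative Q1 (x, y)) (at x)"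
    and c: "continuous_on UNIV P" "continuous_on UNIV Q" "continuous_on UNIV P2" "continuous_on UNIV Q1"
    and eq: "\<And>x y. x \<in> {a..b} \<Longrightarrow> y \<in> {c..d} \<Longrightarrow> P2 (x, y) = Q1 (x, y)"
  obtains v where "\<And>x y. x \<in> {a<..<b} \<Longrightarrow> y \<in> {c<..<d} \<Longrightarrow> ((\<lambda>x. v (x, y)) has_real_derivative P (x, y)) (at x)"
    "\<And>x y. x \<in> {a<..<b} \<Longrightarrow> y \<in> {c<..<d} \<Longrightarrow> ((\<lambda>y. v (x, y)) has_real_derivative Q (x, y)) (at y)"
proof -
  \<comment> \<open>Integration along the bottom side, then upwards. The derivative in
    \<open>y\<close> is immediate; for the one in \<open>x\<close>, the vertical integral is
    differentiated under the integral sign, and \<open>P2 = Q1\<close> makes it a difference of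
    boundary values.\<close>
  define v where "v z = integral {a..fst z} (\<lambda>t. P (t, c)) + integral {c..snd z} (\<lambda>t. Q (fst z, t))" for z
  have cP: "continuous_on A (\<lambda>t. P (t, y))" and cQ: "continuous_on A (\<lambda>t. Q (x, t))" for A x y
    by (auto intro!: continuous_on_compose2[OF c(1)] continuous_on_compose2[OF c(2)] continuous_intros)
  show ?thesis
  proof (rule that[of v])
    fix x y assume x: "x \<in> {a<..<b}" and y: "y \<in> {c<..<d}"
    have atx: "at x within {a..b} = at x" using x by (intro at_within_interior) auto
    have aty: "at y within {c..d} = at y" using y by (intro at_within_interior) auto
    have "((\<lambda>y. integral {c..y} (\<lambda>t. Q (x, t))) has_real_derivative Q (x, y)) (at y within {c..d})"
      using y by (intro integral_has_real_derivative cQ) auto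
    then show "((\<lambda>y. v (x, y)) has_real_derivative Q (x, y)) (at y)"
      unfolding v_def aty by (auto intro!: derivative_eq_intros)
    have 1: "((\<lambda>x. integral {a..x} (\<lambda>t. P (t, c))) has_real_derivative P (x, c)) (at x within {a..b})"
      using x by (intro integral_has_real_derivative cP) auto
    have "((\<lambda>x. integral (cbox c y) (\<lambda>t. Q (x, t))) has_real_derivative integral (cbox c y) (\<lambda>t. Q1 (x, t))) (at x within {a..b})"
    proof (rule leibniz_rule_field_derivative)
      show "((\<lambda>x. Q (x, t)) has_real_derivative Q1 (x', t)) (at x' within {a..b})" for x' t
        by (rule has_field_derivative_at_within[OF Q])
      show "(\<lambda>t. Q (x', t)) integrable_on cbox c y" for x' by (intro integrable_continuous cQ)
      show "continuous_on ({a..b} \<times> cbox c y) (\<lambda>(x, t). Q1 (x, t))"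
        using continuous_on_subset[OF c(4)] by (simp add: split_beta')
    qed (use x in auto)
    moreover have i: "integral (cbox c y) (\<lambda>t. Q1 (x, t)) = P (x, y) - P (x, c)"
    proof -
      have "integral (cbox c y) (\<lambda>t. Q1 (x, t)) = integral {c..y} (\<lambda>t. P2 (x, t))"
        unfolding box_real by (rule integral_cong) (use eq[of x] x y in auto)
      also have "\<dots> = P (x, y) - P (x, c)"
        using y P by (intro integral_unique fundamental_theorem_of_calculus)
          (auto simp: has_real_derivative_iff_has_vector_derivative[symmetric] intro: has_field_derivative_at_within)
      finally show ?thesis .
    qed
    ultimately have 2: "((\<lambda>x. integral (cbox c y) (\<lambda>t. Q (x, t))) has_real_derivative P (x, y) - P (x, c)) (at x within {a..b})"
      by simp
    show "((\<lambda>x. v (x, y)) has_real_derivative P (x, y)) (at x)"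
      using DERIV_add[OF 1 2] unfolding v_def atx by simp
  qed
qed

lemma integral_side_bound:
  fixes f w :: "real \<Rightarrow> real"
  assumes "continuous_on {a..b} f" "continuous_on {a..b} w" "\<And>t. t \<in> {a..b} \<Longrightarrow> \<bar>f t\<bar> \<le> w t"
  shows "\<bar>integral {a..b} f\<bar> \<le> integral {a..b} w"
  using integral_norm_bound_integral[of f "{a..b}" w] assms by (auto intro!: integrable_continuous_real)

text \<open>On a good rectangle each of the four boundary terms in Green's formula is at most
  \<open>1 / (s - r)\<close> times the area integral. The rectangle itself is only known to lie
  between the two squares.\<close>

lemma flux_rectangle:
  fixes A B A1 B2 :: "real \<times> real \<Rightarrow> real"
  assumes rs: "0 < r" "r < s"
    and A: "\<And>x y. (x, y) \<in> sq z s \<Longrightarrow> ((\<lambda>x. A (x, y)) has_real_derivative A1 (x, y)) (at x)"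
    and B: "\<And>x y. (x, y) \<in> sq z s \<Longrightarrow> ((\<lambda>y. B (x, y)) has_real_derivative B2 (x, y)) (at y)"
    and cont: "continuous_on (sq z s) A" "continuous_on (sq z s) B" "continuous_on (sq z s) A1" "continuous_on (sq z s) B2"
  obtains a b c d where "sq z r \<subseteq> {a..b} \<times> {c..d}" "{a..b} \<times> {c..d} \<subseteq> sq z s"
    "integral ({a..b} \<times> {c..d}) (\<lambda>z. A1 z + B2 z) \<le> 4 / (s - r) * integral (sq z s) (\<lambda>z. \<bar>A z\<bar> + \<bar>B z\<bar>)"
proof -
  define w where "w z = \<bar>A z\<bar> + \<bar>B z\<bar>" for z
  have cw: "continuous_on (sq z s) w" unfolding w_def by (intro continuous_intros cont)
  have w0: "0 \<le> w x" for x by (simp add: w_def)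
  obtain a b c d where abcd: "fst z - s \<le> a" "a \<le> fst z - r" "fst z + r \<le> b" "b \<le> fst z + s"
    "snd z - s \<le> c" "c \<le> snd z - r" "snd z + r \<le> d" "d \<le> snd z + s"
    and sides: "(s - r) * integral {c..d} (\<lambda>t. w (a, t)) \<le> integral (sq z s) w"
    "(s - r) * integral {c..d} (\<lambda>t. w (b, t)) \<le> integral (sq z s) w"
    "(s - r) * integral {a..b} (\<lambda>t. w (t, c)) \<le> integral (sq z s) w"
    "(s - r) * integral {a..b} (\<lambda>t. w (t, d)) \<le> integral (sq z s) w"
    using good_rectangle[OF cw w0 rs] by blast
  have sub: "{a..b} \<times> {c..d} \<subseteq> sq z s" using abcd by (auto simp: sq_def)
  have ord: "a \<le> b" "c \<le> d" using abcd rs by auto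
  define W where "W = integral (sq z s) w"
  have cA: "continuous_on ({a..b} \<times> {c..d}) A" and cB: "continuous_on ({a..b} \<times> {c..d}) B"
    and cw': "continuous_on ({a..b} \<times> {c..d}) w"
    using cont cw continuous_on_subset[OF _ sub] by auto
  note slA = slice_continuous[OF cA] and slB = slice_continuous[OF cB] and slw = slice_continuous[OF cw']
  have "integral ({a..b} \<times> {c..d}) (\<lambda>z. A1 z + B2 z)
    = integral {c..d} (\<lambda>t. A (b, t) - A (a, t)) + integral {a..b} (\<lambda>t. B (t, d) - B (t, c))"
    using sub A B continuous_on_subset[OF cont(3) sub] continuous_on_subset[OF cont(4) sub]
    by (intro green_rectangle ord) blast+
  also have "integral {c..d} (\<lambda>t. A (b, t) - A (a, t)) = integral {c..d} (\<lambda>t. A (b, t)) - integral {c..d} (\<lambda>t. A (a, t))"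
    using ord slA by (intro integral_diff integrable_continuous_real) auto
  also have "integral {a..b} (\<lambda>t. B (t, d) - B (t, c)) = integral {a..b} (\<lambda>t. B (t, d)) - integral {a..b} (\<lambda>t. B (t, c))"
    using ord slB by (intro integral_diff integrable_continuous_real) auto
  finally have eq: "integral ({a..b} \<times> {c..d}) (\<lambda>z. A1 z + B2 z) =
    integral {c..d} (\<lambda>t. A (b, t)) - integral {c..d} (\<lambda>t. A (a, t)) + (integral {a..b} (\<lambda>t. B (t, d)) - integral {a..b} (\<lambda>t. B (t, c)))" .
  have div: "X \<le> W / (s - r)" if "(s - r) * X \<le> W" for X
    using that rs by (simp add: field_simps)
  have "\<bar>integral {c..d} (\<lambda>t. A (b, t))\<bar> \<le> integral {c..d} (\<lambda>t. w (b, t))"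
    "\<bar>integral {c..d} (\<lambda>t. A (a, t))\<bar> \<le> integral {c..d} (\<lambda>t. w (a, t))"
    "\<bar>integral {a..b} (\<lambda>t. B (t, c))\<bar> \<le> integral {a..b} (\<lambda>t. w (t, c))"
    "\<bar>integral {a..b} (\<lambda>t. B (t, d))\<bar> \<le> integral {a..b} (\<lambda>t. w (t, d))"
    using ord slA slB slw by (auto intro!: integral_side_bound simp: w_def)
  moreover note div[OF sides(1)[folded W_def]] div[OF sides(2)[folded W_def]]
    div[OF sides(3)[folded W_def]] div[OF sides(4)[folded W_def]]
  ultimately have "integral ({a..b} \<times> {c..d}) (\<lambda>z. A1 z + B2 z) \<le> 4 * (W / (s - r))"
    unfolding eq by linarith
  then have fin: "integral ({a..b} \<times> {c..d}) (\<lambda>z. A1 z + B2 z) \<le> 4 / (s - r) * integral (sq z s) (\<lambda>z. \<bar>A z\<bar> + \<bar>B z\<bar>)"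
    unfolding W_def w_def by simp
  have "sq z r \<subseteq> {a..b} \<times> {c..d}" using abcd by (auto simp: sq_def)
  from this sub fin show ?thesis by (rule that)
qed

text \<open>For every constant \<open>v0\<close>, the Jacobian of a map whose gradient has the rows
  \<open>(P, Q)\<close> and \<open>(P', Q')\<close> is the divergence of
  \<open>((v - v0) * Q', - (v - v0) * P')\<close>, since the terms with \<open>R\<close> cancel.
  With \<open>v0\<close> a value of \<open>v\<close> on the boundary, \<open>v - v0\<close> is there
  bounded by the boundary integral of the gradient, which produces the square.\<close>

lemma isoperimetric_rectangle:
  fixes v P Q P' Q' R :: "real \<times> real \<Rightarrow> real"
  assumes rs: "0 < r" "r < s"
    and v: "\<And>x y. (x, y) \<in> sq z s \<Longrightarrow> ((\<lambda>x. v (x, y)) has_real_derivative P (x, y)) (at x)"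
       "\<And>x y. (x, y) \<in> sq z s \<Longrightarrow> ((\<lambda>y. v (x, y)) has_real_derivative Q (x, y)) (at y)"
    and P': "\<And>x y. (x, y) \<in> sq z s \<Longrightarrow> ((\<lambda>y. P' (x, y)) has_real_derivative R (x, y)) (at y)"
    and Q': "\<And>x y. (x, y) \<in> sq z s \<Longrightarrow> ((\<lambda>x. Q' (x, y)) has_real_derivative R (x, y)) (at x)"
    and cont: "continuous_on (sq z s) v" "continuous_on (sq z s) P" "continuous_on (sq z s) Q"
      "continuous_on (sq z s) P'" "continuous_on (sq z s) Q'" "continuous_on (sq z s) R"
  obtains a b c d where "sq z r \<subseteq> {a..b} \<times> {c..d}" "{a..b} \<times> {c..d} \<subseteq> sq z s"
    "integral ({a..b} \<times> {c..d}) (\<lambda>z. P z * Q' z - Q z * P' z)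
      \<le> (4 / (s - r) * integral (sq z s) (\<lambda>z. \<bar>P z\<bar> + \<bar>Q z\<bar> + \<bar>P' z\<bar> + \<bar>Q' z\<bar>))\<^sup>2"
proof -
  define w where "w z = \<bar>P z\<bar> + \<bar>Q z\<bar> + \<bar>P' z\<bar> + \<bar>Q' z\<bar>" for z
  have cw: "continuous_on (sq z s) w" unfolding w_def by (intro continuous_intros cont)
  have w0: "0 \<le> w x" for x by (simp add: w_def)
  obtain a b c d where abcd: "fst z - s \<le> a" "a \<le> fst z - r" "fst z + r \<le> b" "b \<le> fst z + s"
    "snd z - s \<le> c" "c \<le> snd z - r" "snd z + r \<le> d" "d \<le> snd z + s"
    and sides: "(s - r) * integral {c..d} (\<lambda>t. w (a, t)) \<le> integral (sq z s) w"
    "(s - r) * integral {c..d} (\<lambda>t. w (b, t)) \<le> integral (sq z s) w"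
    "(s - r) * integral {a..b} (\<lambda>t. w (t, c)) \<le> integral (sq z s) w"
    "(s - r) * integral {a..b} (\<lambda>t. w (t, d)) \<le> integral (sq z s) w"
    using good_rectangle[OF cw w0 rs] by blast
  have sub: "{a..b} \<times> {c..d} \<subseteq> sq z s" using abcd by (auto simp: sq_def)
  have ord: "a \<le> b" "c \<le> d" using abcd rs by auto
  have inS: "(x, y) \<in> sq z s" if "x \<in> {a..b}" "y \<in> {c..d}" for x y using sub that by blast
  define K where "K = integral (sq z s) w / (s - r)"
  have div: "X \<le> K" if "(s - r) * X \<le> integral (sq z s) w" for X
    using that rs by (simp add: K_def field_simps)
  note sides' = div[OF sides(1)] div[OF sides(2)] div[OF sides(3)] div[OF sides(4)]
  have cR: "continuous_on ({a..b} \<times> {c..d}) f" if "continuous_on (sq z s) f" for f :: "real \<times> real \<Rightarrow> real"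
    by (rule continuous_on_subset[OF that sub])
  have "0 \<le> integral {c..d} (\<lambda>t. w (a, t))"
    using slice_continuous(1)[OF cR[OF cw], of a] ord w0 by (intro integral_nonneg integrable_continuous_real) auto
  then have K0: "0 \<le> K" using sides'(1) by linarith
  have vert: "\<bar>v (x, t) - v (x, c)\<bar> \<le> integral {c..d} (\<lambda>t. w (x, t))" if x: "x \<in> {a..b}" and t: "t \<in> {c..d}" for x t
  proof -
    have "\<bar>v (x, t) - v (x, c)\<bar> \<le> integral {c..d} (\<lambda>t. \<bar>Q (x, t)\<bar>)"
      using v(2) sub x t ord slice_continuous(1)[OF cR[OF cont(3)] x]
      by (intro ftc_bound[of c d "\<lambda>y. v (x, y)" "\<lambda>y. Q (x, y)" c t] v(2) inS) auto
    also have "\<dots> \<le> integral {c..d} (\<lambda>t. w (x, t))"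
      using slice_continuous(1)[OF cR[OF cont(3)] x] slice_continuous(1)[OF cR[OF cw] x]
      by (intro integral_le) (auto intro!: integrable_continuous_real continuous_intros simp: w_def)
    finally show ?thesis .
  qed
  have hor: "\<bar>v (t, y) - v (a, y)\<bar> \<le> integral {a..b} (\<lambda>t. w (t, y))" if y: "y \<in> {c..d}" and t: "t \<in> {a..b}" for y t
  proof -
    have "\<bar>v (t, y) - v (a, y)\<bar> \<le> integral {a..b} (\<lambda>t. \<bar>P (t, y)\<bar>)"
      using v(1) sub y t ord slice_continuous(2)[OF cR[OF cont(2)] y]
      by (intro ftc_bound[of a b "\<lambda>x. v (x, y)" "\<lambda>x. P (x, y)" a t] v(1) inS) auto
    also have "\<dots> \<le> integral {a..b} (\<lambda>t. w (t, y))"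
      using slice_continuous(2)[OF cR[OF cont(2)] y] slice_continuous(2)[OF cR[OF cw] y]
      by (intro integral_le) (auto intro!: integrable_continuous_real continuous_intros simp: w_def)
    finally show ?thesis .
  qed
  define A where "A x = (v x - v (a, c)) * Q' x" for x
  define B where "B x = - ((v x - v (a, c)) * P' x)" for x
  have cA: "continuous_on ({a..b} \<times> {c..d}) A" and cB: "continuous_on ({a..b} \<times> {c..d}) B"
    unfolding A_def B_def by (intro continuous_intros cR cont)+
  note slA = slice_continuous[OF cA] and slB = slice_continuous[OF cB] and slw = slice_continuous[OF cR[OF cw]]
  have "integral ({a..b} \<times> {c..d}) (\<lambda>x. (P x * Q' x + (v x - v (a, c)) * R x) + - (Q x * P' x + (v x - v (a, c)) * R x))
    = integral {c..d} (\<lambda>t. A (b, t) - A (a, t)) + integral {a..b} (\<lambda>t. B (t, d) - B (t, c))"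
  proof (rule green_rectangle[OF ord])
    fix x y assume "x \<in> {a..b}" "y \<in> {c..d}"
    then have xy: "(x, y) \<in> sq z s" using sub by blast
    show "((\<lambda>x. A (x, y)) has_real_derivative P (x, y) * Q' (x, y) + (v (x, y) - v (a, c)) * R (x, y)) (at x)"
      unfolding A_def using v(1)[OF xy] Q'[OF xy] by (auto intro!: derivative_eq_intros)
    show "((\<lambda>y. B (x, y)) has_real_derivative - (Q (x, y) * P' (x, y) + (v (x, y) - v (a, c)) * R (x, y))) (at y)"
      unfolding B_def using v(2)[OF xy] P'[OF xy] by (auto intro!: derivative_eq_intros)
  qed (intro continuous_intros cR cont)+
  also have "integral {c..d} (\<lambda>t. A (b, t) - A (a, t)) = integral {c..d} (\<lambda>t. A (b, t)) - integral {c..d} (\<lambda>t. A (a, t))"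
    using ord slA by (intro integral_diff integrable_continuous_real) auto
  also have "integral {a..b} (\<lambda>t. B (t, d) - B (t, c)) = integral {a..b} (\<lambda>t. B (t, d)) - integral {a..b} (\<lambda>t. B (t, c))"
    using ord slB by (intro integral_diff integrable_continuous_real) auto
  finally have eq: "integral ({a..b} \<times> {c..d}) (\<lambda>z. P z * Q' z - Q z * P' z) =
    integral {c..d} (\<lambda>t. A (b, t)) - integral {c..d} (\<lambda>t. A (a, t)) + (integral {a..b} (\<lambda>t. B (t, d)) - integral {a..b} (\<lambda>t. B (t, c)))"
    by simp
  \<comment> \<open>Every boundary point is reached from the corner \<open>(a, c)\<close> along at
    most two sides, and each side contributes at most \<open>K\<close>.\<close>
  have osc: "\<bar>v x - v (a, c)\<bar> \<le> 2 * K" if xb: "x \<in> {a, b} \<times> {c..d} \<union> {a..b} \<times> {c, d}" for x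
  proof -
    obtain x1 x2 where x: "x = (x1, x2)" by fastforce
    consider "x1 = a" "x2 \<in> {c..d}" | "x1 = b" "x2 \<in> {c..d}" | "x2 = c" "x1 \<in> {a..b}" | "x2 = d" "x1 \<in> {a..b}"
      using xb x by auto
    then show ?thesis
    proof cases
      case 1 then show ?thesis using vert[of a x2] sides' ord K0 x by auto
    next
      case 2 then show ?thesis using vert[of b x2] hor[of c b] sides' ord K0 x by auto
    next
      case 3 then show ?thesis using hor[of c x1] sides' ord K0 x by auto
    next
      case 4 then show ?thesis using hor[of d x1] vert[of a d] sides' ord K0 x by auto
    qed
  qed
  have AB: "\<bar>A x\<bar> \<le> 2 * K * w x" "\<bar>B x\<bar> \<le> 2 * K * w x" if "x \<in> {a, b} \<times> {c..d} \<union> {a..b} \<times> {c, d}" for x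
  proof -
    have w: "\<bar>P' x\<bar> \<le> w x" "\<bar>Q' x\<bar> \<le> w x" by (auto simp: w_def)
    show "\<bar>A x\<bar> \<le> 2 * K * w x" unfolding A_def abs_mult using osc[OF that] K0 w by (intro mult_mono) auto
    show "\<bar>B x\<bar> \<le> 2 * K * w x" unfolding B_def abs_minus_cancel abs_mult using osc[OF that] K0 w by (intro mult_mono) auto
  qed
  have bd: "integral I (\<lambda>t. 2 * K * w (f t)) \<le> 2 * K * K" if "integral I (\<lambda>t. w (f t)) \<le> K" for I :: "real set" and f
    using mult_left_mono[OF that, of "2 * K"] K0 by simp
  have 1: "\<bar>integral {c..d} (\<lambda>t. A (x, t))\<bar> \<le> 2 * K * K" if "x = a \<or> x = b" for x
  proof -
    have "\<bar>integral {c..d} (\<lambda>t. A (x, t))\<bar> \<le> integral {c..d} (\<lambda>t. 2 * K * w (x, t))"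
      using that ord slA(1)[of x] slw(1)[of x] AB by (intro integral_side_bound) (auto intro!: continuous_intros)
    also have "\<dots> \<le> 2 * K * K" using that sides' by (intro bd) auto
    finally show ?thesis .
  qed
  have 2: "\<bar>integral {a..b} (\<lambda>t. B (t, y))\<bar> \<le> 2 * K * K" if "y = c \<or> y = d" for y
  proof -
    have "\<bar>integral {a..b} (\<lambda>t. B (t, y))\<bar> \<le> integral {a..b} (\<lambda>t. 2 * K * w (t, y))"
      using that ord slB(2)[of y] slw(2)[of y] AB by (intro integral_side_bound) (auto intro!: continuous_intros)
    also have "\<dots> \<le> 2 * K * K" using that sides' by (intro bd) auto
    finally show ?thesis .
  qed
  have "integral ({a..b} \<times> {c..d}) (\<lambda>z. P z * Q' z - Q z * P' z) \<le> 8 * (K * K)"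
    unfolding eq using 1[of a] 1[of b] 2[of c] 2[of d] by simp
  also have "\<dots> \<le> (4 * K)\<^sup>2" using K0 by (simp add: power2_eq_square)
  also have "4 * K = 4 / (s - r) * integral (sq z s) w" by (simp add: K_def)
  finally have fin: "integral ({a..b} \<times> {c..d}) (\<lambda>z. P z * Q' z - Q z * P' z)
      \<le> (4 / (s - r) * integral (sq z s) (\<lambda>z. \<bar>P z\<bar> + \<bar>Q z\<bar> + \<bar>P' z\<bar> + \<bar>Q' z\<bar>))\<^sup>2"
    unfolding w_def .
  have "sq z r \<subseteq> {a..b} \<times> {c..d}" using abcd by (auto simp: sq_def)
  from this sub fin show ?thesis by (rule that)
qed

text \<open>Each point of the square is joined to the small square by a vertical and a horizontal segment.\<close>
lemma poincare_square:
  fixes T T1 T2 :: "real \<times> real \<Rightarrow> real"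
  assumes ts: "0 < \<tau>" "\<tau> \<le> s"
    and T: "\<And>x y. (x, y) \<in> sq z s \<Longrightarrow> ((\<lambda>x. T (x, y)) has_real_derivative T1 (x, y)) (at x)"
       "\<And>x y. (x, y) \<in> sq z s \<Longrightarrow> ((\<lambda>y. T (x, y)) has_real_derivative T2 (x, y)) (at y)"
    and cont: "continuous_on (sq z s) T" "continuous_on (sq z s) T1" "continuous_on (sq z s) T2"
    and const: "\<And>x. x \<in> sq z \<tau> \<Longrightarrow> T x = T0"
  shows "2 * \<tau> * integral (sq z s) (\<lambda>x. \<bar>T0 - T x\<bar>) \<le> 4 * s\<^sup>2 * integral (sq z s) (\<lambda>x. \<bar>T1 x\<bar> + \<bar>T2 x\<bar>)"
proof -
  let ?X = "{fst z - s..fst z + s}" and ?Y = "{snd z - s..snd z + s}" and ?Y' = "{snd z - \<tau>..snd z + \<tau>}"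
  have s: "sq z s = ?X \<times> ?Y" by (simp add: sq_def)
  have c1: "continuous_on (?X \<times> ?Y) (\<lambda>x. \<bar>T1 x\<bar>)" and c2: "continuous_on (?X \<times> ?Y) (\<lambda>x. \<bar>T2 x\<bar>)"
    and cT: "continuous_on (?X \<times> ?Y) (\<lambda>x. \<bar>T0 - T x\<bar>)"
    using cont unfolding s by (auto intro!: continuous_intros)
  define \<alpha> where "\<alpha> y = integral ?X (\<lambda>x. \<bar>T1 (x, y)\<bar>)" for y
  define \<gamma> where "\<gamma> x = integral ?Y (\<lambda>y. \<bar>T2 (x, y)\<bar>)" for x
  define I1 where "I1 = integral (sq z s) (\<lambda>x. \<bar>T1 x\<bar>)"
  define I2 where "I2 = integral (sq z s) (\<lambda>x. \<bar>T2 x\<bar>)"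
  have I1: "I1 = integral ?Y \<alpha>" and I2: "I2 = integral ?X \<gamma>"
    unfolding I1_def I2_def s \<alpha>_def \<gamma>_def
    by (rule integral_rectangle_iterated(2)[OF c1], rule integral_rectangle_iterated(1)[OF c2])
  have ca: "continuous_on ?Y \<alpha>" and cg: "continuous_on ?X \<gamma>"
    unfolding \<alpha>_def \<gamma>_def
    by (rule integral_rectangle_iterated(4)[OF c1], rule integral_rectangle_iterated(3)[OF c2])
  have a0: "0 \<le> \<alpha> y" if "y \<in> ?Y" for y unfolding \<alpha>_def
    using slice_continuous(2)[OF c1 that] by (intro integral_nonneg integrable_continuous_real) auto
  have pt: "\<bar>T0 - T (x, y)\<bar> \<le> \<alpha> y' + \<gamma> x" if x: "x \<in> ?X" and y: "y \<in> ?Y" and y': "y' \<in> ?Y'" for x y y'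
  proof -
    have y'Y: "y' \<in> ?Y" using y' ts by auto
    have "T (fst z, y') = T0" using y' ts by (intro const) (auto simp: sq_def)
    moreover have "\<bar>T (x, y') - T (fst z, y')\<bar> \<le> \<alpha> y'"
      unfolding \<alpha>_def using x y'Y T(1) cont(2) ts unfolding s
      by (intro ftc_bound) (auto intro!: slice_continuous(2)[of _ _ _ _ T1])
    moreover have "\<bar>T (x, y) - T (x, y')\<bar> \<le> \<gamma> x"
      unfolding \<gamma>_def using x y y'Y T(2) cont(3) unfolding s
      by (intro ftc_bound) (auto intro!: slice_continuous(1)[of _ _ _ _ T2])
    ultimately show ?thesis by linarith
  qed
  have subY: "?Y' \<subseteq> ?Y" using ts by auto
  \<comment> \<open>Integrating over the height \<open>y'\<close> of the horizontal segment replaces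
    the line integral \<open>\<alpha> y'\<close> by the area integral \<open>I1\<close>.\<close>
  have pt2: "2 * \<tau> * \<bar>T0 - T (x, y)\<bar> \<le> I1 + 2 * \<tau> * \<gamma> x" if x: "x \<in> ?X" and y: "y \<in> ?Y" for x y
  proof -
    have "2 * \<tau> * \<bar>T0 - T (x, y)\<bar> = integral ?Y' (\<lambda>_. \<bar>T0 - T (x, y)\<bar>)" using ts by simp
    also have "\<dots> \<le> integral ?Y' (\<lambda>y'. \<alpha> y' + \<gamma> x)"
      using pt[OF x y] continuous_on_subset[OF ca subY]
      by (intro integral_le) (auto intro!: integrable_continuous_real continuous_intros)
    also have "\<dots> = integral ?Y' \<alpha> + 2 * \<tau> * \<gamma> x"
      using continuous_on_subset[OF ca subY] ts
      by (subst integral_add) (auto intro!: integrable_continuous_real)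
    also have "integral ?Y' \<alpha> \<le> I1" unfolding I1
      using subY ca continuous_on_subset[OF ca subY] a0
      by (intro integral_subset_le) (auto intro!: integrable_continuous_real)
    finally show ?thesis by simp
  qed
  have cg2: "continuous_on (?X \<times> ?Y) (\<lambda>x. \<gamma> (fst x))"
    by (rule continuous_on_compose2[OF cg]) (auto intro!: continuous_intros)
  have "2 * \<tau> * integral (sq z s) (\<lambda>x. \<bar>T0 - T x\<bar>) = integral (sq z s) (\<lambda>x. 2 * \<tau> * \<bar>T0 - T x\<bar>)" by simp
  also have "\<dots> \<le> integral (sq z s) (\<lambda>x. I1 + 2 * \<tau> * \<gamma> (fst x))"
    unfolding s using pt2 cT cg2
    by (intro integral_le) (auto simp: rect_cbox intro!: integrable_continuous continuous_intros)
  also have "\<dots> = integral ?X (\<lambda>x. integral ?Y (\<lambda>y. I1 + 2 * \<tau> * \<gamma> x))"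
    unfolding s using cg2 by (subst integral_rectangle_iterated(1)) (auto intro!: continuous_intros)
  also have "\<dots> = integral ?X (\<lambda>x. 2 * s * I1 + 2 * s * 2 * \<tau> * \<gamma> x)"
    using ts by (simp add: algebra_simps)
  also have "\<dots> = 4 * s\<^sup>2 * I1 + 4 * s * \<tau> * I2"
    using ts cg unfolding I2
    by (subst integral_add) (auto intro!: integrable_continuous_real continuous_intros simp: power2_eq_square)
  also have "\<dots> \<le> 4 * s\<^sup>2 * I1 + 4 * s\<^sup>2 * I2"
  proof -
    have "0 \<le> I2" unfolding I2_def s rect_cbox using c2
      by (intro integral_nonneg integrable_continuous) (auto simp: rect_cbox)
    moreover have "s * \<tau> \<le> s\<^sup>2" using ts by (simp add: power2_eq_square)
    ultimately show ?thesis by (simp add: mult_right_mono)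
  qed
  also have "\<dots> = 4 * s\<^sup>2 * integral (sq z s) (\<lambda>x. \<bar>T1 x\<bar> + \<bar>T2 x\<bar>)"
    unfolding I1_def I2_def s rect_cbox using c1 c2
    by (subst integral_add) (auto simp: rect_cbox algebra_simps intro!: integrable_continuous)
  finally show ?thesis .
qed

section \<open>Maps of bounded distortion\<close>

text \<open>\<open>k\<^sup>2\<close> from \<open>mollify\<close>, one more \<open>k\<close> from the
  chain rule.\<close>

definition mollify_dx :: "real \<Rightarrow> (real \<times> real \<Rightarrow> real) \<Rightarrow> real \<times> real \<Rightarrow> real" where
  "mollify_dx k p z = k ^ 3 * smear (deriv bump) bump k p z"

definition mollify_dy :: "real \<Rightarrow> (real \<times> real \<Rightarrow> real) \<Rightarrow> real \<times> real \<Rightarrow> real" where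
  "mollify_dy k p z = k ^ 3 * smear bump (deriv bump) k p z"

lemma mollify_DERIV:
  assumes "integrable lborel p"
  shows "((\<lambda>x. mollify k p (x, y)) has_real_derivative mollify_dx k p (x, y)) (at x)"
    "((\<lambda>y. mollify k p (x, y)) has_real_derivative mollify_dy k p (x, y)) (at y)"
proof -
  have d: "(bump has_real_derivative deriv bump x) (at x)" for x
    by (rule C_k_real_deriv(1)[OF C_k_bump[of "Suc 0"]])
  note D = smear_DERIV[OF cont_bdd_bump(1,2) d cont_bdd_bump(1) assms]
  show "((\<lambda>x. mollify k p (x, y)) has_real_derivative mollify_dx k p (x, y)) (at x)"
    unfolding mollify_def mollify_dx_def
    by (rule DERIV_cong[OF DERIV_cmult[OF D(1)]]) (simp add: power2_eq_square power3_eq_cube)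
  show "((\<lambda>y. mollify k p (x, y)) has_real_derivative mollify_dy k p (x, y)) (at y)"
    unfolding mollify_def mollify_dy_def
    by (rule DERIV_cong[OF DERIV_cmult[OF D(2)]]) (simp add: power2_eq_square power3_eq_cube)
qed

lemma mollify_deriv_continuous:
  assumes "integrable lborel p"
  shows "continuous_on UNIV (mollify_dx k p)" "continuous_on UNIV (mollify_dy k p)"
  unfolding mollify_dx_def[abs_def] mollify_dy_def[abs_def]
  by (intro continuous_intros smear_continuous cont_bdd_bump assms)+

lemma compact_sq: "compact (sq z r)" "compact ({a..b} \<times> {c..d :: real})" for a b :: real
  by (auto simp: sq_cbox rect_cbox)

lemma sq_borel [measurable]: "sq z r \<in> sets borel" "{a..b} \<times> {c..d} \<in> sets borel" for a b c d :: real
  by (auto intro: borel_compact compact_sq)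

lemma compact_LINT:
  fixes f :: "real \<times> real \<Rightarrow> real"
  assumes "compact S" "continuous_on S f"
  shows "set_integrable lborel S f" "integral S f = (LINT x:S|lborel. f x)"
proof -
  show i: "set_integrable lborel S f"
    unfolding set_integrable_def by (rule borel_integrable_compact[OF assms])
  then show "integral S f = (LINT x:S|lborel. f x)" by (rule set_borel_integral_eq_integral(2)[symmetric])
qed

lemma set_integral_tendsto:
  fixes f :: "nat \<Rightarrow> real \<times> real \<Rightarrow> real"
  assumes S: "compact S" and A: "A \<in> sets borel" "A \<subseteq> S"
    and f: "\<And>n. continuous_on S (f n)" "continuous_on S g" and K: "\<And>n x. x \<in> S \<Longrightarrow> \<bar>f n x\<bar> \<le> K"
    and lim: "\<And>x. x \<in> A \<Longrightarrow> (\<lambda>n. f n x) \<longlonglongrightarrow> g x"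
  shows "(\<lambda>n. LINT x:A|lborel. f n x) \<longlonglongrightarrow> (LINT x:A|lborel. g x)"
  unfolding set_lebesgue_integral_def
proof (rule integral_dominated_convergence[where w="\<lambda>x. K * indicator A x"])
  have "set_integrable lborel A h" if "continuous_on S h" for h :: "real \<times> real \<Rightarrow> real"
    by (rule set_integrable_subset[OF compact_LINT(1)[OF S that]]) (use A in auto)
  then show "(\<lambda>x. indicat_real A x *\<^sub>R g x) \<in> borel_measurable lborel"
    "(\<lambda>x. indicat_real A x *\<^sub>R f n x) \<in> borel_measurable lborel" for n
    using f unfolding set_integrable_def by (auto intro: borel_measurable_integrable)
  have "bounded A" using S A by (auto intro: bounded_subset compact_imp_bounded)
  then show "integrable lborel (\<lambda>x. K * indicat_real A x)"
    using A by (intro integrable_mult_right integrable_real_indicator emeasure_bounded_finite) auto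
  show "AE x in lborel. (\<lambda>n. indicat_real A x *\<^sub>R f n x) \<longlonglongrightarrow> indicat_real A x *\<^sub>R g x"
    using lim by (intro AE_I2) (auto simp: indicator_def)
  show "AE x in lborel. norm (indicat_real A x *\<^sub>R f n x) \<le> K * indicat_real A x" for n
    using K A by (intro AE_I2) (auto simp: indicator_def)
qed

text \<open>Induction over the radii \<open>\<rho> (1/2 + 2\<^sup>-\<^sup>k\<^sup>-\<^sup>1)\<close> gives decay like \<open>4\<^sup>-\<^sup>k\<close>.\<close>
lemma de_giorgi_iteration:
  fixes A :: "real \<Rightarrow> real"
  assumes \<rho>: "0 < \<rho>" and b: "0 < b" and C: "0 < C"
    and A: "\<And>r. 0 < r \<Longrightarrow> 0 \<le> A r" "\<And>r s. 0 < r \<Longrightarrow> r \<le> s \<Longrightarrow> A r \<le> A s"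
    and step: "\<And>r s. 0 < r \<Longrightarrow> r < s \<Longrightarrow> s \<le> \<rho> \<Longrightarrow> b * A r \<le> (C / (s - r) * A s)\<^sup>2"
    and small: "A \<rho> \<le> b * \<rho>\<^sup>2 / (64 * C\<^sup>2)"
  shows "A (\<rho> / 2) = 0"
proof -
  define r where "r k = \<rho> * (1 / 2 + 1 / 2 ^ Suc k)" for k :: nat
  \<comment> \<open>Chosen so that
    \<open>16 * C\<^sup>2 * \<alpha> / \<rho>\<^sup>2 = b / 4\<close>. As consecutive radii differ
    by \<open>\<rho> / (4 * 2 ^ k)\<close>, the quadratic step turns the bound
    \<open>\<alpha> / 4 ^ k\<close> into exactly a quarter of itself.\<close>
  define \<alpha> where "\<alpha> = b * \<rho>\<^sup>2 / (64 * C\<^sup>2)"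
  have \<alpha>: "64 * C\<^sup>2 * \<alpha> = b * \<rho>\<^sup>2" using C by (simp add: \<alpha>_def)
  have r1: "\<rho> / 2 < r k" for k using \<rho> by (simp add: r_def distrib_left)
  have r0: "\<rho> / 2 < r k" "0 < r k" for k using r1[of k] \<rho> by linarith+
  have alg: "(C / (\<rho> / (4 * X)) * (\<alpha> / Y))\<^sup>2 = (16 * C\<^sup>2 * \<alpha> / \<rho>\<^sup>2) * \<alpha> * (X\<^sup>2 / Y\<^sup>2)" if "Y \<noteq> 0" for X Y
    using \<rho> that by (simp add: power2_eq_square field_simps)
  have A: "A (r k) \<le> \<alpha> / 4 ^ k" for k
  proof (induction k)
    case 0 then show ?case using small by (simp add: r_def \<alpha>_def)
  next
    case (Suc k)
    have diff: "r k - r (Suc k) = \<rho> / (4 * 2 ^ k)" by (simp add: r_def field_simps)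
    have "r k \<le> \<rho> * 1" unfolding r_def using \<rho> by (intro mult_left_mono) (auto simp: field_simps)
    moreover have "r (Suc k) < r k" using diff \<rho> by (smt (verit) divide_pos_pos zero_less_power)
    ultimately have "b * A (r (Suc k)) \<le> (C / (\<rho> / (4 * 2 ^ k)) * A (r k))\<^sup>2"
      using step[of "r (Suc k)" "r k"] r0 diff by simp
    also have "\<dots> \<le> (C / (\<rho> / (4 * 2 ^ k)) * (\<alpha> / 4 ^ k))\<^sup>2"
      using Suc A(1)[OF r0(2)[of k]] C \<rho> by (intro power_mono mult_left_mono mult_nonneg_nonneg) auto
    also have "\<dots> = (16 * C\<^sup>2 * \<alpha> / \<rho>\<^sup>2) * \<alpha> * ((2 ^ k)\<^sup>2 / (4 ^ k)\<^sup>2)"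
      by (rule alg) simp
    also have "(2 ^ k)\<^sup>2 = (4 :: real) ^ k" by (simp add: power_mult[symmetric] mult.commute[of k] power_mult)
    also have "16 * C\<^sup>2 * \<alpha> / \<rho>\<^sup>2 = b / 4" using \<alpha> \<rho> by (simp add: field_simps)
    also have "b / 4 * \<alpha> * (4 ^ k / (4 ^ k)\<^sup>2) = b * (\<alpha> / 4 ^ Suc k)" by (simp add: power2_eq_square)
    finally show ?case using b by (simp only: mult_le_cancel_left_pos)
  qed
  have "A (\<rho> / 2) \<le> \<alpha> / 4 ^ k" for k
    using assms(5)[of "\<rho> / 2" "r k"] A[of k] r0[of k] \<rho> by simp
  moreover have "(\<lambda>k. \<alpha> / 4 ^ k) \<longlonglongrightarrow> 0"
    by (rule LIMSEQ_divide_realpow_zero) simp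
  ultimately have "A (\<rho> / 2) \<le> 0" by (intro LIMSEQ_le_const) auto
  then show ?thesis using assms(4)[of "\<rho> / 2"] \<rho> by simp
qed

text \<open>
  The rows \<open>(p, q)\<close> and \<open>(p', q')\<close> are weakly curl free; equality of the derivatives of the
  mollifications is the only form in which this is used.
\<close>
locale qr_gradient =
  fixes E :: "(real \<times> real) set" and p q p' q' :: "real \<times> real \<Rightarrow> real" and M b R s0 :: real
    and z0 :: "real \<times> real" and n0 :: nat
  assumes E [measurable]: "E \<in> sets borel"
    and meas [measurable]: "p \<in> borel_measurable borel" "q \<in> borel_measurable borel"
      "p' \<in> borel_measurable borel" "q' \<in> borel_measurable borel"
    and bound: "\<bar>p x\<bar> \<le> M * indicator E x" "\<bar>q x\<bar> \<le> M * indicator E x"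
      "\<bar>p' x\<bar> \<le> M * indicator E x" "\<bar>q' x\<bar> \<le> M * indicator E x"
    and jac: "p x * q' x - q x * p' x = b * indicator E x"
    and E_bdd: "x \<in> E \<Longrightarrow> norm x \<le> R" and pos: "0 < M" "0 < b" "0 < R"
    and curl: "n0 \<le> n \<Longrightarrow> x \<in> sq z0 s0 \<Longrightarrow> mollify_dy (real (Suc n)) p x = mollify_dx (real (Suc n)) q x"
      "n0 \<le> n \<Longrightarrow> x \<in> sq z0 s0 \<Longrightarrow> mollify_dy (real (Suc n)) p' x = mollify_dx (real (Suc n)) q' x"
begin

abbreviation mo where "mo n f \<equiv> mollify (real (Suc n)) f"

definition dist_mo where "dist_mo n f x = \<bar>mo n f x - f x\<bar>" for n f x

definition \<delta> where "\<delta> n x = dist_mo n p x + dist_mo n q x + dist_mo n p' x + dist_mo n q' x" for n x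

text \<open>The estimates for the mollified map hold at fixed \<open>n\<close> up to multiples of
  \<open>err n\<close>, which vanish in the limit.\<close>

definition err where "err n = (LINT x|lborel. \<delta> n x)" for n

definition jn where "jn n x = mo n p x * mo n q' x - mo n q x * mo n p' x" for n x

definition wn where "wn n x = \<bar>mo n p x\<bar> + \<bar>mo n q x\<bar> + \<bar>mo n p' x\<bar> + \<bar>mo n q' x\<bar>" for n x

definition comp where "comp = {p, q, p', q'}"

lemma comp_props:
  assumes "f \<in> comp"
  shows "f \<in> borel_measurable borel" "\<bar>f x\<bar> \<le> M" "R < norm x \<Longrightarrow> f x = 0" "\<bar>f x\<bar> \<le> M * indicator E x"
    "integrable lborel f"
proof -
  show m: "f \<in> borel_measurable borel"
    using assms meas by (auto simp: comp_def)
  show 1: "\<bar>f x\<bar> \<le> M * indicator E x" for x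
    using assms bound[of x] unfolding comp_def by (elim insertE) simp_all
  show 2: "\<bar>f x\<bar> \<le> M" for x using 1[of x] pos by (cases "x \<in> E") auto
  show 3: "R < norm x \<Longrightarrow> f x = 0" for x using 1[of x] E_bdd[of x] by (cases "x \<in> E") auto
  show "integrable lborel f" by (rule integrable_bounded_support[OF m 2 3])
qed

lemma in_comp: "p \<in> comp" "q \<in> comp" "p' \<in> comp" "q' \<in> comp" by (auto simp: comp_def)

lemma mo_props:
  assumes "f \<in> comp"
  shows "continuous_on UNIV (mo n f)" "\<bar>mo n f x\<bar> \<le> M"
    "(\<lambda>n. LINT x|lborel. dist_mo n f x) \<longlonglongrightarrow> 0" "integrable lborel (dist_mo n f)"
proof -
  note c = comp_props[OF assms]
  show "continuous_on UNIV (mo n f)" by (rule mollify_continuous[OF c(5)])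
  show "\<bar>mo n f x\<bar> \<le> M" by (rule mollify_bound[OF _ c(5) c(2)]) simp
  show "(\<lambda>n. LINT x|lborel. dist_mo n f x) \<longlonglongrightarrow> 0"
    unfolding dist_mo_def by (rule mollify_L1(1)[OF c(1,2,3) pos(3)])
  show "integrable lborel (dist_mo n f)"
    unfolding dist_mo_def[abs_def]
    by (intro integrable_abs Bochner_Integration.integrable_diff c(5) mollify_L1(2)[OF c(1,2,3) pos(3)])
qed

lemma \<delta>_nonneg: "0 \<le> \<delta> n x" by (simp add: \<delta>_def dist_mo_def)

lemma \<delta>_integrable: "integrable lborel (\<delta> n)"
  unfolding \<delta>_def[abs_def] by (intro Bochner_Integration.integrable_add mo_props(4) in_comp)

lemma err_tendsto: "err \<longlonglongrightarrow> 0"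
proof -
  have "err = (\<lambda>n. (LINT x|lborel. dist_mo n p x) + (LINT x|lborel. dist_mo n q x)
    + (LINT x|lborel. dist_mo n p' x) + (LINT x|lborel. dist_mo n q' x))"
    unfolding err_def \<delta>_def fun_eq_iff using mo_props(4)[OF in_comp(1)] mo_props(4)[OF in_comp(2)]
      mo_props(4)[OF in_comp(3)] mo_props(4)[OF in_comp(4)] by simp
  then show ?thesis
    using tendsto_add[OF tendsto_add[OF tendsto_add[OF mo_props(3)[OF in_comp(1)] mo_props(3)[OF in_comp(2)]]
      mo_props(3)[OF in_comp(3)]] mo_props(3)[OF in_comp(4)]]
    by simp
qed

lemma set_integral_\<delta>_le: "S \<in> sets borel \<Longrightarrow> (LINT x:S|lborel. \<delta> n x) \<le> err n"
  unfolding err_def set_lebesgue_integral_def using \<delta>_integrable \<delta>_nonneg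
  by (intro integral_mono integrable_mult_indicator) (auto simp: indicator_def)

lemma set_integrable_\<delta>: "S \<in> sets borel \<Longrightarrow> set_integrable lborel S (\<delta> n)"
  unfolding set_integrable_def using \<delta>_integrable by (intro integrable_mult_indicator) auto

text \<open>The determinant is bilinear in entries bounded by \<open>M\<close>, so its error is
  linear in the errors of the entries.\<close>

lemma jn_close: "b * indicator E x \<le> jn n x + M * \<delta> n x"
proof -
  have "jn n x - b * indicator E x = mo n p x * (mo n q' x - q' x) + (mo n p x - p x) * q' x
      - (mo n q x * (mo n p' x - p' x) + (mo n q x - q x) * p' x)"
    unfolding jac[symmetric] jn_def by (simp add: algebra_simps)
  moreover have "\<bar>mo n p x * (mo n q' x - q' x)\<bar> \<le> M * dist_mo n q' x"
      "\<bar>(mo n p x - p x) * q' x\<bar> \<le> M * dist_mo n p x"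
      "\<bar>mo n q x * (mo n p' x - p' x)\<bar> \<le> M * dist_mo n p' x"
      "\<bar>(mo n q x - q x) * p' x\<bar> \<le> M * dist_mo n q x"
    using mo_props(2)[OF in_comp(1), of n x] mo_props(2)[OF in_comp(2), of n x]
      comp_props(2)[OF in_comp(3), of x] comp_props(2)[OF in_comp(4), of x]
    by (auto simp: dist_mo_def abs_mult mult.commute[of _ "\<bar>q' x\<bar>"] mult.commute[of _ "\<bar>p' x\<bar>"] intro!: mult_right_mono)
  ultimately have "\<bar>jn n x - b * indicator E x\<bar> \<le> M * dist_mo n q' x + M * dist_mo n p x + (M * dist_mo n p' x + M * dist_mo n q x)"
    by linarith
  then show ?thesis by (simp add: \<delta>_def algebra_simps)
qed

lemma wn_close: "wn n x \<le> 4 * M * indicator E x + \<delta> n x"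
proof -
  have t: "\<bar>mo n f x\<bar> \<le> M * indicator E x + dist_mo n f x" if "f \<in> comp" for f
    using comp_props(4)[OF that, of x] unfolding dist_mo_def by linarith
  have "wn n x \<le> (M * indicator E x + dist_mo n p x) + (M * indicator E x + dist_mo n q x)
      + (M * indicator E x + dist_mo n p' x) + (M * indicator E x + dist_mo n q' x)"
    unfolding wn_def by (intro add_mono t in_comp)
  then show ?thesis by (simp add: \<delta>_def algebra_simps)
qed

lemma jn_cont: "continuous_on S (jn n)" and wn_cont: "continuous_on S (wn n)"
proof -
  have "continuous_on UNIV (jn n)" "continuous_on UNIV (wn n)"
    unfolding jn_def[abs_def] wn_def[abs_def] by (intro continuous_intros mo_props(1) in_comp)+
  then show "continuous_on S (jn n)" "continuous_on S (wn n)" by (auto intro: continuous_on_subset)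
qed

text \<open>In the applications \<open>S\<close> is the good rectangle, of which only an inner
  square \<open>A\<close> is known. Passing from \<open>A\<close> to \<open>S\<close> has to happen
  for the nonnegative \<open>b * indicator E\<close>; afterwards it is compared with
  \<open>jn\<close>, which may be negative somewhere.\<close>

lemma jacobian_lower:
  assumes S: "compact S" "A \<subseteq> S" "A \<in> sets borel" and \<phi>: "continuous_on S \<phi>" "\<And>x. x \<in> S \<Longrightarrow> 0 \<le> \<phi> x" "\<And>x. x \<in> S \<Longrightarrow> \<phi> x \<le> K" and K: "0 \<le> K"
  shows "b * (LINT x:A \<inter> E|lborel. \<phi> x) \<le> integral S (\<lambda>x. \<phi> x * jn n x) + K * M * err n"
proof -
  have Sb: "S \<in> sets borel" using S(1) by (rule borel_compact)
  have i\<phi>: "set_integrable lborel S \<phi>" by (rule compact_LINT(1)[OF S(1) \<phi>(1)])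
  have "(LINT x:A \<inter> E|lborel. \<phi> x) \<le> (LINT x:S \<inter> E|lborel. \<phi> x)"
    unfolding set_lebesgue_integral_def
  proof (rule integral_mono)
    show "integrable lborel (\<lambda>x. indicat_real (A \<inter> E) x *\<^sub>R \<phi> x)" "integrable lborel (\<lambda>x. indicat_real (S \<inter> E) x *\<^sub>R \<phi> x)"
      using set_integrable_subset[OF i\<phi>, of "A \<inter> E"] set_integrable_subset[OF i\<phi>, of "S \<inter> E"] S Sb
      unfolding set_integrable_def by auto
    show "indicat_real (A \<inter> E) x *\<^sub>R \<phi> x \<le> indicat_real (S \<inter> E) x *\<^sub>R \<phi> x" for x
      using \<phi>(2)[of x] S(2) by (auto simp: indicator_def)
  qed
  then have "b * (LINT x:A \<inter> E|lborel. \<phi> x) \<le> b * (LINT x:S \<inter> E|lborel. \<phi> x)"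
    using pos by simp
  also have "\<dots> = (LINT x:S|lborel. b * indicator E x * \<phi> x)"
    unfolding set_lebesgue_integral_def integral_mult_right_zero[symmetric]
    by (rule Bochner_Integration.integral_cong) (auto simp: indicator_def)
  also have "\<dots> \<le> (LINT x:S|lborel. \<phi> x * jn n x + K * M * \<delta> n x)"
  proof (rule set_integral_mono)
    have "set_integrable lborel (S \<inter> E) (\<lambda>x. b * \<phi> x)"
      using i\<phi> Sb by (intro set_integrable_mult_right set_integrable_subset[OF i\<phi>]) auto
    then show "set_integrable lborel S (\<lambda>x. b * indicat_real E x * \<phi> x)"
      unfolding set_integrable_def
      by (rule Bochner_Integration.integrable_cong[THEN iffD1, rotated 2]) (auto simp: indicator_def)
    show "set_integrable lborel S (\<lambda>x. \<phi> x * jn n x + K * M * \<delta> n x)"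
      using \<phi> S Sb by (intro set_integral_add compact_LINT(1) continuous_intros jn_cont set_integrable_mult_right set_integrable_\<delta>) auto
    fix x assume x: "x \<in> S"
    have "b * indicat_real E x * \<phi> x \<le> (jn n x + M * \<delta> n x) * \<phi> x"
      using jn_close \<phi>(2)[OF x] by (intro mult_right_mono)
    also have "\<dots> = \<phi> x * jn n x + \<phi> x * (M * \<delta> n x)" by (simp add: algebra_simps)
    also have "\<phi> x * (M * \<delta> n x) \<le> K * (M * \<delta> n x)"
      using \<phi>(3)[OF x] \<delta>_nonneg pos by (intro mult_right_mono) auto
    finally show "b * indicat_real E x * \<phi> x \<le> \<phi> x * jn n x + K * M * \<delta> n x" by simp
  qed
  also have "\<dots> = (LINT x:S|lborel. \<phi> x * jn n x) + (LINT x:S|lborel. K * M * \<delta> n x)"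
    using \<phi> S Sb by (intro set_integral_add compact_LINT(1) continuous_intros jn_cont set_integrable_mult_right set_integrable_\<delta>) auto
  also have "(LINT x:S|lborel. \<phi> x * jn n x) = integral S (\<lambda>x. \<phi> x * jn n x)"
    using \<phi> S by (intro compact_LINT(2)[symmetric] continuous_intros jn_cont)
  also have "(LINT x:S|lborel. K * M * \<delta> n x) = K * M * (LINT x:S|lborel. \<delta> n x)" by simp
  also have "\<dots> \<le> K * M * err n" using K pos set_integral_\<delta>_le[OF Sb] by (intro mult_left_mono) auto
  finally show ?thesis by simp
qed

text \<open>Each of the four entries is at most \<open>M\<close> on \<open>E\<close> and
  \<open>0\<close> elsewhere. Together with \<open>jacobian_lower\<close> this turns an inequality
  between Jacobian and gradient of the smooth map into one between integrals over
  \<open>E\<close>.\<close>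

lemma gradient_upper:
  assumes S: "compact S" and \<phi>: "continuous_on S \<phi>" "\<And>x. x \<in> S \<Longrightarrow> 0 \<le> \<phi> x" "\<And>x. x \<in> S \<Longrightarrow> \<phi> x \<le> K" and K: "0 \<le> K"
  shows "integral S (\<lambda>x. \<phi> x * wn n x) \<le> 4 * M * (LINT x:S \<inter> E|lborel. \<phi> x) + K * err n"
proof -
  have Sb: "S \<in> sets borel" using S(1) by (rule borel_compact)
  have i\<phi>: "set_integrable lborel S \<phi>" by (rule compact_LINT(1)[OF S(1) \<phi>(1)])
  have i1: "set_integrable lborel S (\<lambda>x. 4 * M * indicat_real E x * \<phi> x)"
  proof -
    have "set_integrable lborel (S \<inter> E) (\<lambda>x. 4 * M * \<phi> x)"
      using i\<phi> Sb by (intro set_integrable_mult_right set_integrable_subset[OF i\<phi>]) auto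
    then show ?thesis unfolding set_integrable_def
      by (rule Bochner_Integration.integrable_cong[THEN iffD1, rotated 2]) (auto simp: indicator_def)
  qed
  have i2: "set_integrable lborel S (\<lambda>x. K * \<delta> n x)" by (intro set_integrable_mult_right set_integrable_\<delta> Sb)
  have "integral S (\<lambda>x. \<phi> x * wn n x) = (LINT x:S|lborel. \<phi> x * wn n x)"
    using \<phi> S by (intro compact_LINT(2) continuous_intros wn_cont)
  also have "\<dots> \<le> (LINT x:S|lborel. 4 * M * indicat_real E x * \<phi> x + K * \<delta> n x)"
  proof (rule set_integral_mono)
    show "set_integrable lborel S (\<lambda>x. \<phi> x * wn n x)" using \<phi> S by (intro compact_LINT(1) continuous_intros wn_cont)
    show "set_integrable lborel S (\<lambda>x. 4 * M * indicat_real E x * \<phi> x + K * \<delta> n x)" by (rule set_integral_add[OF i1 i2])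
    fix x assume x: "x \<in> S"
    have "wn n x * \<phi> x \<le> (4 * M * indicator E x + \<delta> n x) * \<phi> x"
      using wn_close \<phi>(2)[OF x] by (intro mult_right_mono)
    also have "\<dots> = 4 * M * indicat_real E x * \<phi> x + \<phi> x * \<delta> n x" by (simp add: algebra_simps)
    also have "\<phi> x * \<delta> n x \<le> K * \<delta> n x" using \<phi>(3)[OF x] \<delta>_nonneg by (intro mult_right_mono) auto
    finally show "\<phi> x * wn n x \<le> 4 * M * indicat_real E x * \<phi> x + K * \<delta> n x" by (simp add: mult.commute)
  qed
  also have "\<dots> = (LINT x:S|lborel. 4 * M * indicat_real E x * \<phi> x) + (LINT x:S|lborel. K * \<delta> n x)"
    by (rule set_integral_add[OF i1 i2])
  also have "(LINT x:S|lborel. 4 * M * indicat_real E x * \<phi> x) = 4 * M * (LINT x:S \<inter> E|lborel. \<phi> x)"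
    unfolding set_lebesgue_integral_def integral_mult_right_zero[symmetric]
    by (rule Bochner_Integration.integral_cong) (auto simp: indicator_def)
  also have "(LINT x:S|lborel. K * \<delta> n x) = K * (LINT x:S|lborel. \<delta> n x)" by simp
  also have "\<dots> \<le> K * err n" using K set_integral_\<delta>_le[OF Sb] by (intro mult_left_mono) auto
  finally show ?thesis by simp
qed

text \<open>Open, because \<open>potential_rectangle\<close> yields two-sided derivatives only in
  the interior of \<open>sq z0 s0\<close>.\<close>

definition box0 where "box0 = {fst z0 - s0<..<fst z0 + s0} \<times> {snd z0 - s0<..<snd z0 + s0}"

definition is_pot where "is_pot n v f g \<longleftrightarrow> (\<forall>x y. (x, y) \<in> box0 \<longrightarrow>
    ((\<lambda>x. v (x, y)) has_real_derivative mo n f (x, y)) (at x) \<and>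
    ((\<lambda>y. v (x, y)) has_real_derivative mo n g (x, y)) (at y))" for n v f g

lemma potentials:
  assumes n: "n0 \<le> n"
  obtains v v' where "is_pot n v p q" "is_pot n v' p' q'"
proof -
  have "\<exists>v. is_pot n v f g" if fg: "f \<in> comp" "g \<in> comp"
    and eq: "\<And>x. x \<in> sq z0 s0 \<Longrightarrow> mollify_dy (real (Suc n)) f x = mollify_dx (real (Suc n)) g x" for f g
  proof -
    note f = comp_props(5)[OF fg(1)] and g = comp_props(5)[OF fg(2)]
    show ?thesis
    proof (rule potential_rectangle[OF mollify_DERIV(2)[OF f] mollify_DERIV(1)[OF g] mollify_continuous[OF f]
        mollify_continuous[OF g] mollify_deriv_continuous(2)[OF f] mollify_deriv_continuous(1)[OF g]])
      show "mollify_dy (real (Suc n)) f (x, y) = mollify_dx (real (Suc n)) g (x, y)"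
        if "x \<in> {fst z0 - s0..fst z0 + s0}" "y \<in> {snd z0 - s0..snd z0 + s0}" for x y
        using eq[of "(x, y)"] that by (simp add: sq_def)
      fix v :: "real \<times> real \<Rightarrow> real"
      assume "\<And>x y. x \<in> {fst z0 - s0<..<fst z0 + s0} \<Longrightarrow> y \<in> {snd z0 - s0<..<snd z0 + s0} \<Longrightarrow>
          ((\<lambda>x. v (x, y)) has_real_derivative mo n f (x, y)) (at x)"
        "\<And>x y. x \<in> {fst z0 - s0<..<fst z0 + s0} \<Longrightarrow> y \<in> {snd z0 - s0<..<snd z0 + s0} \<Longrightarrow>
          ((\<lambda>y. v (x, y)) has_real_derivative mo n g (x, y)) (at y)"
      then have "is_pot n v f g" unfolding is_pot_def box0_def mem_Sigma_iff by blast
      then show ?thesis by blast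
    qed
  qed
  from this[OF in_comp(1,2) curl(1)[OF n]] this[OF in_comp(3,4) curl(2)[OF n]] show ?thesis using that by blast
qed

lemma is_potD:
  assumes "is_pot n v f g" "S \<subseteq> box0"
  shows "(x, y) \<in> S \<Longrightarrow> ((\<lambda>x. v (x, y)) has_real_derivative mo n f (x, y)) (at x)"
    "(x, y) \<in> S \<Longrightarrow> ((\<lambda>y. v (x, y)) has_real_derivative mo n g (x, y)) (at y)"
  using assms by (auto simp: is_pot_def)

end

section \<open>The radial field and the cutoff\<close>

lemma DERIV_radial_field:
  fixes a c :: "real \<Rightarrow> real"
  assumes "(a has_real_derivative a') (at x)" "(c has_real_derivative c') (at x)" "0 < h"
  shows "((\<lambda>x. a x / ((a x)\<^sup>2 + (c x)\<^sup>2 + h\<^sup>2)) has_real_derivative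
    (a' * ((a x)\<^sup>2 + (c x)\<^sup>2 + h\<^sup>2) - a x * (2 * a x * a' + 2 * c x * c')) / ((a x)\<^sup>2 + (c x)\<^sup>2 + h\<^sup>2)\<^sup>2) (at x)"
proof -
  have D: "(a x)\<^sup>2 + (c x)\<^sup>2 + h\<^sup>2 \<noteq> 0" using assms(3) by (smt (verit) zero_less_power zero_le_power2)
  show ?thesis using D
    by (auto intro!: derivative_eq_intros assms(1,2) simp: power2_eq_square)
qed

text \<open>The outer square matters. Differentiating \<open>(h\<^sup>2 / rad)\<^sup>2\<close>
  leaves a factor \<open>h\<^sup>2 / rad\<close> to spare, and this absorbs the size of
  \<open>v\<close> because \<open>h * |v| \<le> rad\<close>. So the gradient is controlled by
  \<open>h * psi\<close> times the gradient of \<open>v\<close>.\<close>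

lemma DERIV_radial_cutoff:
  fixes a c :: "real \<Rightarrow> real"
  assumes "(a has_real_derivative a') (at x)" "(c has_real_derivative c') (at x)" "0 < h"
  shows "((\<lambda>x. h ^ 4 / ((a x)\<^sup>2 + (c x)\<^sup>2 + h\<^sup>2)\<^sup>2) has_real_derivative
    - (4 * h ^ 4 * (a x * a' + c x * c')) / ((a x)\<^sup>2 + (c x)\<^sup>2 + h\<^sup>2) ^ 3) (at x)"
proof -
  define D where "D = (a x)\<^sup>2 + (c x)\<^sup>2 + h\<^sup>2"
  have D: "D \<noteq> 0" unfolding D_def using assms(3) by (smt (verit) zero_less_power zero_le_power2)
  have "((\<lambda>x. (a x)\<^sup>2 + (c x)\<^sup>2 + h\<^sup>2) has_real_derivative 2 * (a x * a' + c x * c')) (at x)"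
    by (auto intro!: derivative_eq_intros assms(1,2))
  from DERIV_divide[OF DERIV_const DERIV_power[OF this, of 2], of "h ^ 4"] D
  show ?thesis unfolding D_def[symmetric]
    by (rule_tac DERIV_cong) (auto simp: D_def[symmetric] divide_simps eval_nat_numeral)
qed

text \<open>With \<open>v = (a, c)\<close>: \<open>psi\<close> is the divergence of the radial field \<open>v / rad\<close>, and \<open>chi\<close> bounds its length.\<close>
definition rad where "rad h a c = a\<^sup>2 + c\<^sup>2 + h\<^sup>2" for h a c :: real

lemma rad_props:
  assumes "0 < h"
  shows "0 < rad h a c" "h\<^sup>2 \<le> rad h a c" "h * \<bar>a\<bar> \<le> rad h a c" "h * \<bar>c\<bar> \<le> rad h a c"
    "h * (\<bar>a\<bar> + \<bar>c\<bar>) \<le> rad h a c"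
proof -
  show 1: "h\<^sup>2 \<le> rad h a c" by (simp add: rad_def)
  show "0 < rad h a c" using assms 1 by (meson less_le_trans zero_less_power)
  have sq: "0 \<le> (h / 2 - \<bar>a\<bar>)\<^sup>2" "0 \<le> (h / 2 - \<bar>c\<bar>)\<^sup>2" by simp_all
  have 2: "h * \<bar>a\<bar> \<le> a\<^sup>2 + h\<^sup>2 / 4" "h * \<bar>c\<bar> \<le> c\<^sup>2 + h\<^sup>2 / 4"
    using sq by (simp_all add: power2_diff power_divide)
  note nn = zero_le_power2[of a] zero_le_power2[of c] zero_le_power2[of h]
  show "h * \<bar>a\<bar> \<le> rad h a c" "h * \<bar>c\<bar> \<le> rad h a c" "h * (\<bar>a\<bar> + \<bar>c\<bar>) \<le> rad h a c"
    unfolding rad_def distrib_left using 2 nn by linarith+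
qed

definition psi where "psi h a c = 2 * h\<^sup>2 / (rad h a c)\<^sup>2" for h a c :: real
definition chi where "chi h a c = (\<bar>a\<bar> + \<bar>c\<bar>) / rad h a c" for h a c :: real

lemma psi_chi_bounds:
  assumes "0 < h"
  shows "0 \<le> psi h a c" "psi h a c \<le> 2 / h\<^sup>2" "0 \<le> chi h a c" "chi h a c \<le> 1 / h"
proof -
  note r = rad_props[OF assms, of a c]
  show "0 \<le> psi h a c" by (simp add: psi_def)
  show "0 \<le> chi h a c" using r by (simp add: chi_def)
  show "chi h a c \<le> 1 / h" using r assms by (simp add: chi_def divide_simps mult.commute)
  have "(h\<^sup>2)\<^sup>2 \<le> (rad h a c)\<^sup>2" using r by (intro power_mono) auto
  then have "h\<^sup>2 * h\<^sup>2 \<le> (rad h a c)\<^sup>2" by (simp add: power2_eq_square)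
  then show "psi h a c \<le> 2 / h\<^sup>2" using r assms by (simp add: psi_def divide_simps mult.commute mult.left_commute)
qed

lemma psi_chi_continuous:
  assumes "0 < h" "continuous_on S a" "continuous_on S c"
  shows "continuous_on S (\<lambda>x. psi h (a x) (c x))" "continuous_on S (\<lambda>x. chi h (a x) (c x))"
    "continuous_on S (\<lambda>x. rad h (a x) (c x))"
proof -
  have r: "rad h s t \<noteq> 0" for s t using rad_props(1)[OF assms(1), of s t] by simp
  show 1: "continuous_on S (\<lambda>x. rad h (a x) (c x))" unfolding rad_def by (intro continuous_intros assms)
  show "continuous_on S (\<lambda>x. psi h (a x) (c x))" "continuous_on S (\<lambda>x. chi h (a x) (c x))"
    unfolding psi_def chi_def using r by (intro continuous_intros assms 1; simp)+
qed

context qr_gradient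
begin

text \<open>The mean value theorem along a horizontal and a vertical segment. \<open>B\<close> is a
  parameter because it is used with \<open>M\<close> on \<open>box0\<close>, and with
  \<open>0\<close> on a square where the mollified gradient vanishes.\<close>

lemma pot_lipschitz:
  assumes "is_pot n v f g" "I \<times> J \<subseteq> box0" "convex I" "convex J"
    and B: "\<And>x. x \<in> I \<times> J \<Longrightarrow> \<bar>mo n f x\<bar> \<le> B" "\<And>x. x \<in> I \<times> J \<Longrightarrow> \<bar>mo n g x\<bar> \<le> B"
    and xy: "x \<in> I \<times> J" "y \<in> I \<times> J"
  shows "\<bar>v x - v y\<bar> \<le> B * (\<bar>fst x - fst y\<bar> + \<bar>snd x - snd y\<bar>)"
proof -
  obtain x1 x2 y1 y2 where x: "x = (x1, x2)" and y: "y = (y1, y2)" by fastforce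
  note D = is_potD[OF assms(1,2)]
  have "norm (v (x1, x2) - v (y1, x2)) \<le> B * norm (x1 - y1)"
    by (rule field_differentiable_bound[OF assms(3), of "\<lambda>t. v (t, x2)" "\<lambda>t. mo n f (t, x2)"])
      (use xy B x y in \<open>auto intro!: has_field_derivative_at_within[OF D(1)] simp del: of_nat_Suc\<close>)
  moreover have "norm (v (y1, x2) - v (y1, y2)) \<le> B * norm (x2 - y2)"
    by (rule field_differentiable_bound[OF assms(4), of "\<lambda>t. v (y1, t)" "\<lambda>t. mo n g (y1, t)"])
      (use xy B x y in \<open>auto intro!: has_field_derivative_at_within[OF D(2)] simp del: of_nat_Suc\<close>)
  ultimately show ?thesis unfolding x y by (simp add: distrib_left)
qed

lemma pot_lipschitz_box0:
  assumes "is_pot n v f g" "f \<in> comp" "g \<in> comp" "x \<in> box0" "y \<in> box0"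
  shows "\<bar>v x - v y\<bar> \<le> M * (\<bar>fst x - fst y\<bar> + \<bar>snd x - snd y\<bar>)"
  by (rule pot_lipschitz[OF assms(1), of "{fst z0 - s0<..<fst z0 + s0}" "{snd z0 - s0<..<snd z0 + s0}"])
    (use assms mo_props(2) in \<open>auto simp: box0_def\<close>)

lemma pot_continuous:
  assumes "is_pot n v f g" "f \<in> comp" "g \<in> comp" "S \<subseteq> box0"
  shows "continuous_on S v"
proof (rule lipschitz_on_continuous_on[of "2 * M"])
  show "(2 * M)-lipschitz_on S v"
  proof (rule lipschitz_onI)
    fix x y assume "x \<in> S" "y \<in> S"
    then have "\<bar>v x - v y\<bar> \<le> M * (\<bar>fst x - fst y\<bar> + \<bar>snd x - snd y\<bar>)"
      using assms by (intro pot_lipschitz_box0[OF assms(1-3)]) auto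
    also have "\<dots> \<le> M * (dist x y + dist x y)"
      using dist_fst_le[of x y] dist_snd_le[of x y] pos by (intro mult_left_mono add_mono) (auto simp: dist_real_def)
    finally show "dist (v x) (v y) \<le> 2 * M * dist x y" by (simp add: dist_real_def algebra_simps)
  qed (use pos in simp)
qed

lemma curl_box0:
  assumes "n0 \<le> n" "x \<in> box0"
  shows "mollify_dy (real (Suc n)) p x = mollify_dx (real (Suc n)) q x"
    "mollify_dy (real (Suc n)) p' x = mollify_dx (real (Suc n)) q' x"
  using assms curl by (auto simp: box0_def sq_def)

lemma measure_set_integral: "A \<in> sets borel \<Longrightarrow> (LINT x:A|lborel. 1) = measure lborel (A :: (real \<times> real) set)"
  by (simp add: set_lebesgue_integral_def)

text \<open>\<open>isoperimetric_rectangle\<close> for the mollified map, with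
  \<open>jacobian_lower\<close> and \<open>gradient_upper\<close> at weight \<open>1\<close> on its
  two sides. The constant is \<open>4\<close> from the isoperimetric inequality times
  \<open>4 * M\<close> from the four entries.\<close>

lemma area_step:
  assumes sub: "sq z s \<subseteq> box0" and rs: "0 < r" "r < s"
  shows "b * measure lborel (E \<inter> sq z r) \<le> (16 * M / (s - r) * measure lborel (E \<inter> sq z s))\<^sup>2"
proof -
  have *: "b * measure lborel (E \<inter> sq z r)
      \<le> (4 / (s - r) * (4 * M * measure lborel (E \<inter> sq z s) + err n))\<^sup>2 + M * err n" if n: "n0 \<le> n" for n
  proof -
    obtain v v' where v: "is_pot n v p q" "is_pot n v' p' q'" using potentials[OF n] .
    note cs = continuous_on_subset[OF _ subset_UNIV]
    obtain a' b' c' d' where S: "sq z r \<subseteq> {a'..b'} \<times> {c'..d'}" "{a'..b'} \<times> {c'..d'} \<subseteq> sq z s"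
      and le: "integral ({a'..b'} \<times> {c'..d'}) (\<lambda>x. mo n p x * mo n q' x - mo n q x * mo n p' x)
      \<le> (4 / (s - r) * integral (sq z s) (\<lambda>x. \<bar>mo n p x\<bar> + \<bar>mo n q x\<bar> + \<bar>mo n p' x\<bar> + \<bar>mo n q' x\<bar>))\<^sup>2"
    proof (rule isoperimetric_rectangle[OF rs is_potD(1)[OF v(1) sub] is_potD(2)[OF v(1) sub],
          where P'="mo n p'" and Q'="mo n q'" and R="mollify_dy (real (Suc n)) p'"])
      show "((\<lambda>y. mo n p' (x, y)) has_real_derivative mollify_dy (real (Suc n)) p' (x, y)) (at y)" for x y
        by (rule mollify_DERIV(2)[OF comp_props(5)[OF in_comp(3)]])
      show "((\<lambda>x. mo n q' (x, y)) has_real_derivative mollify_dy (real (Suc n)) p' (x, y)) (at x)"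
        if "(x, y) \<in> sq z s" for x y
        unfolding curl_box0(2)[OF n subsetD[OF sub that]]
        by (rule mollify_DERIV(1)[OF comp_props(5)[OF in_comp(4)]])
    qed (use pot_continuous[OF v(1) _ _ sub] in_comp cs[OF mo_props(1)]
        cs[OF mollify_deriv_continuous(2)[OF comp_props(5)[OF in_comp(3)]]] in blast)+
    have ii: "integral (sq z s) (\<lambda>x. 1 * wn n x) \<le> 4 * M * (LINT x:sq z s \<inter> E|lborel. 1) + 1 * err n"
      by (rule gradient_upper) (auto simp: compact_sq)
    have jj: "b * (LINT x:sq z r \<inter> E|lborel. 1) \<le> integral ({a'..b'} \<times> {c'..d'}) (\<lambda>x. 1 * jn n x) + 1 * M * err n"
      by (rule jacobian_lower[OF compact_sq(2) S(1)]) auto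
    have w0: "0 \<le> integral (sq z s) (wn n)"
      using integrable_continuous[of "(fst z - s, snd z - s)" "(fst z + s, snd z + s)" "wn n"] wn_cont
      unfolding sq_cbox by (intro Henstock_Kurzweil_Integration.integral_nonneg) (auto simp: wn_def)
    have "b * measure lborel (E \<inter> sq z r) \<le> integral ({a'..b'} \<times> {c'..d'}) (jn n) + M * err n"
      using jj by (simp add: measure_set_integral Int_commute)
    also have "integral ({a'..b'} \<times> {c'..d'}) (jn n) \<le> (4 / (s - r) * integral (sq z s) (wn n))\<^sup>2"
      using le unfolding jn_def[abs_def] wn_def[abs_def] .
    also have "\<dots> \<le> (4 / (s - r) * (4 * M * measure lborel (E \<inter> sq z s) + err n))\<^sup>2"
      using ii w0 rs by (intro power_mono mult_left_mono) (auto simp: measure_set_integral Int_commute)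
    finally show ?thesis by simp
  qed
  have "(\<lambda>n. (4 / (s - r) * (4 * M * measure lborel (E \<inter> sq z s) + err n))\<^sup>2 + M * err n)
     \<longlonglongrightarrow> (4 / (s - r) * (4 * M * measure lborel (E \<inter> sq z s) + 0))\<^sup>2 + M * 0"
    by (intro tendsto_intros err_tendsto)
  then have "b * measure lborel (E \<inter> sq z r) \<le> (4 / (s - r) * (4 * M * measure lborel (E \<inter> sq z s) + 0))\<^sup>2 + M * 0"
    by (rule LIMSEQ_le_const) (use * in blast)
  then show ?thesis by (simp add: algebra_simps)
qed

lemma fmeasurable_E_sq: "E \<inter> sq z r \<in> fmeasurable lborel"
  using emeasure_bounded_finite[of "E \<inter> sq z r"] compact_imp_bounded[OF compact_sq(1)[of z r]]
  by (intro fmeasurableI) (auto intro: bounded_subset)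

lemma sparse_square_null:
  assumes sub: "sq z \<rho> \<subseteq> box0" and \<rho>: "0 < \<rho>"
    and small: "measure lborel (E \<inter> sq z \<rho>) \<le> b * \<rho>\<^sup>2 / (64 * (16 * M)\<^sup>2)"
  shows "measure lborel (E \<inter> sq z (\<rho> / 2)) = 0"
proof (rule de_giorgi_iteration[OF \<rho> pos(2), of "16 * M" "\<lambda>r. measure lborel (E \<inter> sq z r)"])
  show "measure lborel (E \<inter> sq z r) \<le> measure lborel (E \<inter> sq z s)" if "r \<le> s" for r s
    using sq_mono[OF that, of z] fmeasurable_E_sq by (intro measure_mono_fmeasurable) auto
  show "b * measure lborel (E \<inter> sq z r) \<le> (16 * M / (s - r) * measure lborel (E \<inter> sq z s))\<^sup>2"
    if "0 < r" "r < s" "s \<le> \<rho>" for r s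
    using that sub sq_mono[of s \<rho> z] by (intro area_step) auto
qed (use pos small in auto)

text \<open>From a point of the half square the kernel, of reach at most \<open>\<tau> / 2\<close>,
  sees \<open>E\<close> only inside \<open>sq z \<tau>\<close>, that is, in a null set.\<close>

lemma null_square_mo_zero:
  assumes null: "measure lborel (E \<inter> sq z \<tau>) = 0" and n: "1 / real (Suc n) \<le> \<tau> / 2"
    and f: "f \<in> comp" and x: "x \<in> sq z (\<tau> / 2)"
  shows "mo n f x = 0"
proof -
  have "E \<inter> sq z \<tau> \<in> null_sets lborel"
    using null fmeasurable_E_sq[of z \<tau>] by (simp add: null_sets_def emeasure_eq_measure2 fmeasurableD)
  then have "AE y in lborel. y \<notin> E \<inter> sq z \<tau>" by (rule AE_not_in)
  then have "AE y in lborel. f y * kern (real (Suc n)) x y = 0"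
  proof eventually_elim
    case (elim y)
    show ?case
    proof (cases "y \<in> E")
      case True
      then have "y \<notin> sq z \<tau>" using elim by blast
      then have "1 / real (Suc n) \<le> \<bar>fst x - fst y\<bar> \<or> 1 / real (Suc n) \<le> \<bar>snd x - snd y\<bar>"
        using x n by (cases y, cases x) (auto simp: sq_def abs_le_iff)
      then show ?thesis using kern_zero[of "real (Suc n)" x y] by simp
    next
      case False then show ?thesis using comp_props(4)[OF f, of y] by simp
    qed
  qed
  then show ?thesis unfolding mollify_eq by (subst integral_eq_zero_AE) auto
qed

text \<open>Green's formula for the adjugate of the gradient applied to \<open>X(v)\<close>. The
  columns of the adjugate are divergence free, so the divergence is that of \<open>X\<close>, taken
  at \<open>v\<close>, times the Jacobian; the size of the field is at most \<open>chi\<close> times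
  \<open>wn\<close>.\<close>

lemma flux_bound:
  assumes n: "n0 \<le> n" and v: "is_pot n v p q" "is_pot n v' p' q'"
    and sub: "sq z s \<subseteq> box0" and rs: "0 < r" "r < s" and h: "0 < h"
  shows "b * (LINT x:sq z r \<inter> E|lborel. psi h (v x) (v' x))
    \<le> 4 / (s - r) * (4 * M * (LINT x:sq z s \<inter> E|lborel. chi h (v x) (v' x)) + 1 / h * err n) + 2 / h\<^sup>2 * M * err n"
proof -
  define D where "D x = rad h (v x) (v' x)" for x
  define X1 where "X1 x = v x / D x" for x
  define X2 where "X2 x = v' x / D x" for x
  have D0: "0 < D x" "D x \<noteq> 0" for x using rad_props(1)[OF h] by (auto simp: D_def less_imp_neq[symmetric])
  define P Q P' Q' R R' where defs: "P = mo n p" "Q = mo n q" "P' = mo n p'" "Q' = mo n q'"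
    "R = mollify_dy (real (Suc n)) p" "R' = mollify_dy (real (Suc n)) p'"
  have cv: "continuous_on (sq z s) v" "continuous_on (sq z s) v'"
    using pot_continuous[OF v(1) _ _ sub] pot_continuous[OF v(2) _ _ sub] in_comp by auto
  have cP: "continuous_on (sq z s) P" "continuous_on (sq z s) Q" "continuous_on (sq z s) P'" "continuous_on (sq z s) Q'"
    "continuous_on (sq z s) R" "continuous_on (sq z s) R'"
    unfolding defs using mo_props(1) in_comp mollify_deriv_continuous(2)[OF comp_props(5)]
    by (blast intro: continuous_on_subset)+
  have cD: "continuous_on (sq z s) D" unfolding D_def by (rule psi_chi_continuous(3)[OF h cv])
  have cX: "continuous_on (sq z s) X1" "continuous_on (sq z s) X2"
    unfolding X1_def X2_def using D0 by (intro continuous_intros cv cD; simp)+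
  define X1x where "X1x x = (P x * D x - v x * (2 * v x * P x + 2 * v' x * P' x)) / (D x)\<^sup>2" for x
  define X1y where "X1y x = (Q x * D x - v x * (2 * v x * Q x + 2 * v' x * Q' x)) / (D x)\<^sup>2" for x
  define X2x where "X2x x = (P' x * D x - v' x * (2 * v' x * P' x + 2 * v x * P x)) / (D x)\<^sup>2" for x
  define X2y where "X2y x = (Q' x * D x - v' x * (2 * v' x * Q' x + 2 * v x * Q x)) / (D x)\<^sup>2" for x
  have cXx: "continuous_on (sq z s) X1x" "continuous_on (sq z s) X1y" "continuous_on (sq z s) X2x" "continuous_on (sq z s) X2y"
    unfolding X1x_def X1y_def X2x_def X2y_def using D0 by (intro continuous_intros cv cD cP; simp)+
  note dv = is_potD[OF v(1) sub, folded defs] and dv' = is_potD[OF v(2) sub, folded defs]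
  have D_alt: "D x = (v' x)\<^sup>2 + (v x)\<^sup>2 + h\<^sup>2" for x by (simp add: D_def rad_def)
  have dX: "((\<lambda>x. X1 (x, y)) has_real_derivative X1x (x, y)) (at x)"
    "((\<lambda>y. X1 (x, y)) has_real_derivative X1y (x, y)) (at y)"
    "((\<lambda>x. X2 (x, y)) has_real_derivative X2x (x, y)) (at x)"
    "((\<lambda>y. X2 (x, y)) has_real_derivative X2y (x, y)) (at y)" if xy: "(x, y) \<in> sq z s" for x y
    using DERIV_radial_field[OF dv(1)[OF xy] dv'(1)[OF xy] h] DERIV_radial_field[OF dv(2)[OF xy] dv'(2)[OF xy] h]
      DERIV_radial_field[OF dv'(1)[OF xy] dv(1)[OF xy] h] DERIV_radial_field[OF dv'(2)[OF xy] dv(2)[OF xy] h]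
    unfolding X1_def X2_def X1x_def X1y_def X2x_def X2y_def D_alt by (simp_all add: add.commute)
  have dP: "((\<lambda>y. P (x, y)) has_real_derivative R (x, y)) (at y)" "((\<lambda>y. P' (x, y)) has_real_derivative R' (x, y)) (at y)"
    for x y unfolding defs by (rule mollify_DERIV(2), rule comp_props(5), rule in_comp)+
  have dQ: "((\<lambda>x. Q (x, y)) has_real_derivative R (x, y)) (at x)" "((\<lambda>x. Q' (x, y)) has_real_derivative R' (x, y)) (at x)"
    if "(x, y) \<in> sq z s" for x y
    using curl_box0[OF n subsetD[OF sub that]] mollify_DERIV(1)[OF comp_props(5)[OF in_comp(2)], of "real (Suc n)" y x]
      mollify_DERIV(1)[OF comp_props(5)[OF in_comp(4)], of "real (Suc n)" y x]
    unfolding defs by simp_all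
  define A where "A x = X1 x * Q' x - X2 x * Q x" for x
  define B where "B x = X2 x * P x - X1 x * P' x" for x
  \<comment> \<open>\<open>R\<close> and \<open>R'\<close> are the common mixed derivatives of the
    two rows; their contributions to \<open>A1\<close> and \<open>B2\<close> cancel in the
    sum.\<close>
  define A1 where "A1 x = (X1x x * Q' x + X1 x * R' x) - (X2x x * Q x + X2 x * R x)" for x
  define B2 where "B2 x = (X2y x * P x + X2 x * R x) - (X1y x * P' x + X1 x * R' x)" for x
  have frac: "a1 / d * b1 - a2 / d * b2 + a3 / d * b3 - a4 / d * b4 = (a1 * b1 - a2 * b2 + a3 * b3 - a4 * b4) / d"
    for a1 a2 a3 a4 b1 b2 b3 b4 d :: real by (simp add: add_divide_distrib diff_divide_distrib)
  have AB: "A1 x + B2 x = psi h (v x) (v' x) * jn n x" for x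
  proof -
    have "A1 x + B2 x = X1x x * Q' x - X2x x * Q x + X2y x * P x - X1y x * P' x"
      unfolding A1_def B2_def by simp
    also have "\<dots> = ((P x * D x - v x * (2 * v x * P x + 2 * v' x * P' x)) * Q' x
        - (P' x * D x - v' x * (2 * v' x * P' x + 2 * v x * P x)) * Q x
        + (Q' x * D x - v' x * (2 * v' x * Q' x + 2 * v x * Q x)) * P x
        - (Q x * D x - v x * (2 * v x * Q x + 2 * v' x * Q' x)) * P' x) / (D x)\<^sup>2"
      unfolding X1x_def X1y_def X2x_def X2y_def by (rule frac)
    also have "\<dots> = (2 * h\<^sup>2 * (P x * Q' x - Q x * P' x)) / (D x)\<^sup>2"
      unfolding D_alt by (rule arg_cong[where f="\<lambda>t. t / _"]) (simp add: power2_eq_square algebra_simps)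
    finally show ?thesis by (simp add: psi_def jn_def defs D_def)
  qed
  obtain a' b' c' d' where S: "sq z r \<subseteq> {a'..b'} \<times> {c'..d'}" "{a'..b'} \<times> {c'..d'} \<subseteq> sq z s"
    and le: "integral ({a'..b'} \<times> {c'..d'}) (\<lambda>x. A1 x + B2 x) \<le> 4 / (s - r) * integral (sq z s) (\<lambda>x. \<bar>A x\<bar> + \<bar>B x\<bar>)"
  proof (rule flux_rectangle[OF rs])
    fix x y assume xy: "(x, y) \<in> sq z s"
    show "((\<lambda>x. A (x, y)) has_real_derivative A1 (x, y)) (at x)"
      unfolding A_def A1_def using dX(1,3)[OF xy] dQ[OF xy]
      by (auto intro!: derivative_eq_intros)
    show "((\<lambda>y. B (x, y)) has_real_derivative B2 (x, y)) (at y)"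
      unfolding B_def B2_def using dX(2,4)[OF xy] dP
      by (auto intro!: derivative_eq_intros)
  next
    show "continuous_on (sq z s) A" "continuous_on (sq z s) B" "continuous_on (sq z s) A1" "continuous_on (sq z s) B2"
      unfolding A_def B_def A1_def B2_def by (intro continuous_intros cX cP cXx)+
  qed
  have cps: "continuous_on (sq z s) (\<lambda>x. psi h (v x) (v' x))" "continuous_on (sq z s) (\<lambda>x. chi h (v x) (v' x))"
    by (rule psi_chi_continuous[OF h cv])+
  have "integral (sq z s) (\<lambda>x. \<bar>A x\<bar> + \<bar>B x\<bar>) \<le> integral (sq z s) (\<lambda>x. chi h (v x) (v' x) * wn n x)"
  proof (rule integral_le)
    show "(\<lambda>x. \<bar>A x\<bar> + \<bar>B x\<bar>) integrable_on sq z s" "(\<lambda>x. chi h (v x) (v' x) * wn n x) integrable_on sq z s"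
      unfolding sq_cbox A_def B_def using cX cP cps wn_cont
      by (auto intro!: integrable_continuous continuous_intros simp: sq_cbox)
    fix x
    have chi: "chi h (v x) (v' x) = \<bar>X1 x\<bar> + \<bar>X2 x\<bar>"
      using D0(1)[of x] by (simp add: chi_def X1_def X2_def D_def add_divide_distrib)
    have "\<bar>A x\<bar> \<le> \<bar>X1 x\<bar> * \<bar>Q' x\<bar> + \<bar>X2 x\<bar> * \<bar>Q x\<bar>" "\<bar>B x\<bar> \<le> \<bar>X2 x\<bar> * \<bar>P x\<bar> + \<bar>X1 x\<bar> * \<bar>P' x\<bar>"
      unfolding A_def B_def abs_mult[symmetric] by linarith+
    moreover have "\<bar>X1 x\<bar> * \<bar>Q' x\<bar> + \<bar>X2 x\<bar> * \<bar>Q x\<bar> + (\<bar>X2 x\<bar> * \<bar>P x\<bar> + \<bar>X1 x\<bar> * \<bar>P' x\<bar>) \<le> (\<bar>X1 x\<bar> + \<bar>X2 x\<bar>) * wn n x"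
      unfolding wn_def defs[symmetric] by (simp add: distrib_left distrib_right)
    ultimately show "\<bar>A x\<bar> + \<bar>B x\<bar> \<le> chi h (v x) (v' x) * wn n x" unfolding chi by linarith
  qed
  also have "\<dots> \<le> 4 * M * (LINT x:sq z s \<inter> E|lborel. chi h (v x) (v' x)) + 1 / h * err n"
    using psi_chi_bounds[OF h] h by (intro gradient_upper compact_sq cps) auto
  finally have 1: "integral (sq z s) (\<lambda>x. \<bar>A x\<bar> + \<bar>B x\<bar>) \<le> 4 * M * (LINT x:sq z s \<inter> E|lborel. chi h (v x) (v' x)) + 1 / h * err n" .
  have "b * (LINT x:sq z r \<inter> E|lborel. psi h (v x) (v' x))
      \<le> integral ({a'..b'} \<times> {c'..d'}) (\<lambda>x. psi h (v x) (v' x) * jn n x) + 2 / h\<^sup>2 * M * err n"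
    using psi_chi_bounds[OF h] by (intro jacobian_lower S(1) compact_sq continuous_on_subset[OF cps(1) S(2)]) auto
  also have "integral ({a'..b'} \<times> {c'..d'}) (\<lambda>x. psi h (v x) (v' x) * jn n x)
      \<le> 4 / (s - r) * integral (sq z s) (\<lambda>x. \<bar>A x\<bar> + \<bar>B x\<bar>)"
    using le unfolding AB .
  also have "\<dots> \<le> 4 / (s - r) * (4 * M * (LINT x:sq z s \<inter> E|lborel. chi h (v x) (v' x)) + 1 / h * err n)"
    using 1 rs by (intro mult_left_mono) auto
  finally show ?thesis by simp
qed

text \<open>\<open>poincare_square\<close> for \<open>T = h ^ 4 / rad\<^sup>2\<close>, which is
  \<open>1\<close> where \<open>v\<close> vanishes and has gradient at most
  \<open>2 * h * psi * wn\<close>; hence the factor \<open>4 * r\<^sup>2 * (2 * h)\<close>. The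
  integral of \<open>1 - T\<close> measures how far \<open>v\<close> is from vanishing.\<close>

lemma cutoff_bound:
  assumes v: "is_pot n v p q" "is_pot n v' p' q'"
    and sub: "sq z r \<subseteq> box0" and \<tau>: "0 < \<tau>" "\<tau> \<le> r" and h: "0 < h"
    and zero: "\<And>x. x \<in> sq z \<tau> \<Longrightarrow> v x = 0 \<and> v' x = 0"
  shows "2 * \<tau> * (LINT x:sq z r|lborel. 1 - h ^ 4 / (rad h (v x) (v' x))\<^sup>2)
    \<le> 8 * r\<^sup>2 * h * (4 * M * (LINT x:sq z r \<inter> E|lborel. psi h (v x) (v' x)) + 2 / h\<^sup>2 * err n)"
proof -
  define D where "D x = rad h (v x) (v' x)" for x
  have D0: "0 < D x" "D x \<noteq> 0" for x using rad_props(1)[OF h] by (auto simp: D_def less_imp_neq[symmetric])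
  define P Q P' Q' where defs: "P = mo n p" "Q = mo n q" "P' = mo n p'" "Q' = mo n q'"
  have cv: "continuous_on (sq z r) v" "continuous_on (sq z r) v'"
    using pot_continuous[OF v(1) _ _ sub] pot_continuous[OF v(2) _ _ sub] in_comp by auto
  have cP: "continuous_on (sq z r) P" "continuous_on (sq z r) Q" "continuous_on (sq z r) P'" "continuous_on (sq z r) Q'"
    unfolding defs using mo_props(1) in_comp by (blast intro: continuous_on_subset)+
  have cD: "continuous_on (sq z r) D" unfolding D_def by (rule psi_chi_continuous(3)[OF h cv])
  have cps: "continuous_on (sq z r) (\<lambda>x. psi h (v x) (v' x))" by (rule psi_chi_continuous[OF h cv])
  define T where "T x = h ^ 4 / (D x)\<^sup>2" for x
  define T1 where "T1 x = - (4 * h ^ 4 * (v x * P x + v' x * P' x)) / (D x) ^ 3" for x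
  define T2 where "T2 x = - (4 * h ^ 4 * (v x * Q x + v' x * Q' x)) / (D x) ^ 3" for x
  note dv = is_potD[OF v(1) sub, folded defs] and dv' = is_potD[OF v(2) sub, folded defs]
  have cT: "continuous_on (sq z r) T" "continuous_on (sq z r) T1" "continuous_on (sq z r) T2"
    unfolding T_def T1_def T2_def using D0 by (intro continuous_intros cv cD cP; simp)+
  have "2 * \<tau> * integral (sq z r) (\<lambda>x. \<bar>1 - T x\<bar>) \<le> 4 * r\<^sup>2 * integral (sq z r) (\<lambda>x. \<bar>T1 x\<bar> + \<bar>T2 x\<bar>)"
  proof (rule poincare_square[OF \<tau>])
    fix x y assume xy: "(x, y) \<in> sq z r"
    show "((\<lambda>x. T (x, y)) has_real_derivative T1 (x, y)) (at x)"
      using DERIV_radial_cutoff[OF dv(1)[OF xy] dv'(1)[OF xy] h] by (simp add: T_def T1_def D_def rad_def)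
    show "((\<lambda>y. T (x, y)) has_real_derivative T2 (x, y)) (at y)"
      using DERIV_radial_cutoff[OF dv(2)[OF xy] dv'(2)[OF xy] h] by (simp add: T_def T2_def D_def rad_def)
  next
    show "T x = 1" if "x \<in> sq z \<tau>" for x using zero[OF that] h by (simp add: T_def D_def rad_def power_mult[symmetric])
  qed (rule cT)+
  also have "4 * r\<^sup>2 * integral (sq z r) (\<lambda>x. \<bar>T1 x\<bar> + \<bar>T2 x\<bar>) \<le> 4 * r\<^sup>2 * (2 * h * integral (sq z r) (\<lambda>x. psi h (v x) (v' x) * wn n x))"
  proof (rule mult_left_mono)
    have "integral (sq z r) (\<lambda>x. \<bar>T1 x\<bar> + \<bar>T2 x\<bar>) \<le> integral (sq z r) (\<lambda>x. 2 * h * (psi h (v x) (v' x) * wn n x))"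
    proof (rule integral_le)
      show "(\<lambda>x. \<bar>T1 x\<bar> + \<bar>T2 x\<bar>) integrable_on sq z r" "(\<lambda>x. 2 * h * (psi h (v x) (v' x) * wn n x)) integrable_on sq z r"
        using cT cps wn_cont by (auto intro!: integrable_continuous continuous_intros simp: sq_cbox)
      fix x
      have psi: "psi h (v x) (v' x) = 2 * h\<^sup>2 / (D x)\<^sup>2" by (simp add: psi_def D_def)
      have hv: "h * \<bar>v x\<bar> \<le> D x" "h * \<bar>v' x\<bar> \<le> D x" using rad_props[OF h] by (auto simp: D_def)
      \<comment> \<open>One of the four factors \<open>h\<close> is spent on
        \<open>h * \<bar>v x\<bar> \<le> D x\<close>, which cancels one power of
        \<open>D x\<close>.\<close>
      have *: "\<bar>- (4 * h ^ 4 * (v x * s + v' x * t)) / (D x) ^ 3\<bar> \<le> 4 * h ^ 3 / (D x)\<^sup>2 * (\<bar>s\<bar> + \<bar>t\<bar>)" for s t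
      proof -
        have "\<bar>v x * s + v' x * t\<bar> \<le> \<bar>v x\<bar> * \<bar>s\<bar> + \<bar>v' x\<bar> * \<bar>t\<bar>" using abs_triangle_ineq[of "v x * s" "v' x * t"] by (simp add: abs_mult)
        then have "h * \<bar>v x * s + v' x * t\<bar> \<le> h * (\<bar>v x\<bar> * \<bar>s\<bar> + \<bar>v' x\<bar> * \<bar>t\<bar>)" using h by simp
        also have "\<dots> = (h * \<bar>v x\<bar>) * \<bar>s\<bar> + (h * \<bar>v' x\<bar>) * \<bar>t\<bar>" by (simp add: algebra_simps)
        also have "\<dots> \<le> D x * \<bar>s\<bar> + D x * \<bar>t\<bar>" by (intro add_mono mult_right_mono hv) auto
        finally have "h * \<bar>v x * s + v' x * t\<bar> \<le> D x * (\<bar>s\<bar> + \<bar>t\<bar>)" by (simp add: distrib_left)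
        then have "(4 * h ^ 3) * (h * \<bar>v x * s + v' x * t\<bar>) \<le> (4 * h ^ 3) * (D x * (\<bar>s\<bar> + \<bar>t\<bar>))"
          using h by (intro mult_left_mono) auto
        then have "4 * h ^ 4 * \<bar>v x * s + v' x * t\<bar> / (D x) ^ 3 \<le> (4 * h ^ 3) * (D x * (\<bar>s\<bar> + \<bar>t\<bar>)) / (D x) ^ 3"
          using D0(1)[of x] by (intro divide_right_mono) (auto simp: eval_nat_numeral)
        also have "\<dots> = 4 * h ^ 3 / (D x)\<^sup>2 * (\<bar>s\<bar> + \<bar>t\<bar>)" using D0[of x] by (simp add: eval_nat_numeral)
        finally show ?thesis using D0(1)[of x] h by (simp add: abs_mult)
      qed
      have "\<bar>T1 x\<bar> + \<bar>T2 x\<bar> \<le> 4 * h ^ 3 / (D x)\<^sup>2 * (\<bar>P x\<bar> + \<bar>P' x\<bar>) + 4 * h ^ 3 / (D x)\<^sup>2 * (\<bar>Q x\<bar> + \<bar>Q' x\<bar>)"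
        unfolding T1_def T2_def by (intro add_mono *)
      also have "\<dots> = 2 * h * (psi h (v x) (v' x) * wn n x)"
        unfolding psi wn_def defs[symmetric] by (simp add: eval_nat_numeral algebra_simps add_divide_distrib)
      finally show "\<bar>T1 x\<bar> + \<bar>T2 x\<bar> \<le> 2 * h * (psi h (v x) (v' x) * wn n x)" .
    qed
    then show "integral (sq z r) (\<lambda>x. \<bar>T1 x\<bar> + \<bar>T2 x\<bar>) \<le> 2 * h * integral (sq z r) (\<lambda>x. psi h (v x) (v' x) * wn n x)"
      by simp
  qed simp
  also have "\<dots> \<le> 4 * r\<^sup>2 * (2 * h * (4 * M * (LINT x:sq z r \<inter> E|lborel. psi h (v x) (v' x)) + 2 / h\<^sup>2 * err n))"
    using psi_chi_bounds[OF h] h by (intro mult_left_mono gradient_upper compact_sq cps) auto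
  also have "integral (sq z r) (\<lambda>x. \<bar>1 - T x\<bar>) = integral (sq z r) (\<lambda>x. 1 - h ^ 4 / (rad h (v x) (v' x))\<^sup>2)"
  proof (rule integral_cong)
    fix x
    have "(h\<^sup>2)\<^sup>2 \<le> (D x)\<^sup>2" using rad_props(2)[OF h] by (intro power_mono) (auto simp: D_def)
    then have "T x \<le> 1" using D0(1)[of x] by (simp add: T_def power_mult[symmetric])
    then show "\<bar>1 - T x\<bar> = 1 - h ^ 4 / (rad h (v x) (v' x))\<^sup>2" by (simp add: T_def D_def)
  qed
  also have "\<dots> = (LINT x:sq z r|lborel. 1 - h ^ 4 / (rad h (v x) (v' x))\<^sup>2)"
    using D0 cD unfolding D_def by (intro compact_LINT(2) compact_sq continuous_intros) auto
  finally show ?thesis by (simp add: mult.assoc)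
qed

end

section \<open>Limits of the potentials and propagation of null squares\<close>

lemma tendsto_psi_chi:
  assumes h: "0 < h" and uv: "(u \<longlongrightarrow> a) F" "(v \<longlongrightarrow> c) F"
  shows "((\<lambda>x. psi h (u x) (v x)) \<longlongrightarrow> psi h a c) F" "((\<lambda>x. chi h (u x) (v x)) \<longlongrightarrow> chi h a c) F"
    "((\<lambda>x. rad h (u x) (v x)) \<longlongrightarrow> rad h a c) F"
proof -
  have r: "rad h a c \<noteq> 0" using rad_props(1)[OF h, of a c] by simp
  show 1: "((\<lambda>x. rad h (u x) (v x)) \<longlongrightarrow> rad h a c) F" unfolding rad_def by (intro tendsto_intros uv)
  show "((\<lambda>x. psi h (u x) (v x)) \<longlongrightarrow> psi h a c) F" "((\<lambda>x. chi h (u x) (v x)) \<longlongrightarrow> chi h a c) F"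
    unfolding psi_def chi_def using r by (intro tendsto_intros uv 1; simp)+
qed

lemma cutoff_range:
  assumes "0 < h" shows "0 \<le> 1 - h ^ 4 / (rad h a c)\<^sup>2" "1 - h ^ 4 / (rad h a c)\<^sup>2 \<le> 1"
proof -
  have "(h\<^sup>2)\<^sup>2 \<le> (rad h a c)\<^sup>2" using rad_props(2)[OF assms, of a c] by (intro power_mono) auto
  then show "0 \<le> 1 - h ^ 4 / (rad h a c)\<^sup>2" using rad_props(1)[OF assms, of a c] by (simp add: power_mult[symmetric])
qed simp

context qr_gradient
begin

text \<open>The potentials of the mollified gradients are equi-Lipschitz and, normalised at
  \<open>z\<close>, bounded, so a subsequence converges uniformly. Only the values of the limit are
  used, never its derivatives: \<open>flux_bound\<close> and \<open>cutoff_bound\<close> contain no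
  derivatives of the potentials and pass to the limit.\<close>

lemma spread_null:
  assumes sub: "sq z s \<subseteq> box0" and \<tau>: "0 < \<tau>" "\<tau> < s" and null: "measure lborel (E \<inter> sq z \<tau>) = 0"
    and r: "r < s"
  shows "measure lborel (E \<inter> sq z r) = 0"
proof -
  \<comment> \<open>Room for two uses of \<open>flux\<close>: from \<open>s\<close> to
    \<open>r1\<close> to see that \<open>E\<close> meets \<open>Z0\<close> in a null set, then from
    \<open>r1\<close> to \<open>r2\<close>. The maximum keeps the small square inside the one on
    which the cutoff is estimated.\<close>
  define r2 where "r2 = max r \<tau>"
  define r1 where "r1 = (r2 + s) / 2"
  have rs: "0 < r2" "r2 < r1" "r1 < s" "\<tau> \<le> r2" "r \<le> r2" using \<tau> r by (auto simp: r2_def r1_def)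
  \<comment> \<open>Mollification costs half of the null square.\<close>
  define \<sigma> where "\<sigma> = \<tau> / 2"
  have \<sigma>: "0 < \<sigma>" "\<sigma> \<le> r2" "\<sigma> \<le> s" using \<tau> rs by (auto simp: \<sigma>_def)
  have zin: "z \<in> sq z \<sigma>" using \<sigma> by (cases z) (simp add: sq_def)
  obtain n1' where n1': "1 / real (Suc n1') < \<sigma>" using nat_approx_posE[OF \<sigma>(1)] by auto
  define n1 where "n1 = max n0 n1'"
  have n1: "n0 \<le> n1 + n" "1 / real (Suc (n1 + n)) \<le> \<sigma>" for n
  proof -
    have "1 / real (Suc (n1 + n)) \<le> 1 / real (Suc n1')" unfolding n1_def by (intro divide_left_mono) auto
    then show "1 / real (Suc (n1 + n)) \<le> \<sigma>" using n1' by simp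
  qed (simp add: n1_def)
  \<comment> \<open>Potentials are unique only up to constants; without a common value at
    \<open>z\<close> the sequence need not be bounded.\<close>
  have "\<exists>v v'. is_pot (n1 + n) v p q \<and> is_pot (n1 + n) v' p' q' \<and> v z = 0 \<and> v' z = 0" for n
  proof -
    obtain v v' where v: "is_pot (n1 + n) v p q" "is_pot (n1 + n) v' p' q'" using potentials[OF n1(1)] .
    have "is_pot m (\<lambda>x. v x - c) f g" if "is_pot m v f g" for m v f g c
      using that unfolding is_pot_def by (auto intro!: derivative_eq_intros)
    then have "is_pot (n1 + n) (\<lambda>x. v x - v z) p q" "is_pot (n1 + n) (\<lambda>x. v' x - v' z) p' q'" using v by blast+
    then show ?thesis by (intro exI[of _ "\<lambda>x. v x - v z"] exI[of _ "\<lambda>x. v' x - v' z"]) simp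
  qed
  then obtain u u' where u: "\<And>n. is_pot (n1 + n) (u n) p q" "\<And>n. is_pot (n1 + n) (u' n) p' q'"
    and uz: "\<And>n. u n z = 0" "\<And>n. u' n z = 0" by metis
  have zs: "z \<in> sq z s" using zin sq_mono[OF \<sigma>(3), of z] by blast
  \<comment> \<open>The mollified gradient vanishes on \<open>sq z \<sigma>\<close>, so the
    Lipschitz constant there is \<open>0\<close>.\<close>
  have zero: "u n x = 0 \<and> u' n x = 0" if x: "x \<in> sq z \<sigma>" for n x
  proof -
    have mo0: "mo (n1 + n) f y = 0" if "f \<in> comp" "y \<in> sq z \<sigma>" for f y
      using null_square_mo_zero[OF null _ that(1), of "n1 + n" y] n1(2)[of n] that(2) unfolding \<sigma>_def by simp
    have sub\<sigma>: "sq z \<sigma> \<subseteq> box0" using sq_mono[OF \<sigma>(3), of z] sub by blast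
    have "\<bar>u n x - u n z\<bar> \<le> 0 * (\<bar>fst x - fst z\<bar> + \<bar>snd x - snd z\<bar>)"
      by (rule pot_lipschitz[OF u(1) sub\<sigma>[unfolded sq_def] _ _ _ _ x[unfolded sq_def] zin[unfolded sq_def]])
        (simp_all add: mo0[OF in_comp(1)] mo0[OF in_comp(2)] sq_def[symmetric] del: of_nat_Suc mem_Times_iff)
    moreover have "\<bar>u' n x - u' n z\<bar> \<le> 0 * (\<bar>fst x - fst z\<bar> + \<bar>snd x - snd z\<bar>)"
      by (rule pot_lipschitz[OF u(2) sub\<sigma>[unfolded sq_def] _ _ _ _ x[unfolded sq_def] zin[unfolded sq_def]])
        (simp_all add: mo0[OF in_comp(3)] mo0[OF in_comp(4)] sq_def[symmetric] del: of_nat_Suc mem_Times_iff)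
    ultimately show ?thesis using uz by simp
  qed
  have lip: "\<bar>u n x - u n y\<bar> \<le> M * (\<bar>fst x - fst y\<bar> + \<bar>snd x - snd y\<bar>)"
    "\<bar>u' n x - u' n y\<bar> \<le> M * (\<bar>fst x - fst y\<bar> + \<bar>snd x - snd y\<bar>)" if "x \<in> sq z s" "y \<in> sq z s" for n x y
    using that sub by (auto intro!: pot_lipschitz_box0[OF u(1)] pot_lipschitz_box0[OF u(2)] in_comp)
  have lip2: "norm ((u n x, u' n x) - (u n y, u' n y)) \<le> 4 * M * norm (x - y)" if "x \<in> sq z s" "y \<in> sq z s" for n x y
  proof -
    have "norm ((u n x, u' n x) - (u n y, u' n y)) \<le> \<bar>u n x - u n y\<bar> + \<bar>u' n x - u' n y\<bar>"
      by (simp add: norm_Pair sqrt_sum_squares_le_sum_abs)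
    also have "\<dots> \<le> 2 * M * (\<bar>fst x - fst y\<bar> + \<bar>snd x - snd y\<bar>)" using lip[OF that, of n] by simp
    also have "\<dots> \<le> 2 * M * (norm (x - y) + norm (x - y))"
      using norm_fst_le[of "fst x - fst y" "snd x - snd y"] norm_snd_le[of "snd x - snd y" "fst x - fst y"] pos
      by (intro mult_left_mono add_mono) (auto simp: minus_prod_def)
    finally show ?thesis by (simp add: algebra_simps)
  qed
  \<comment> \<open>Arzela-Ascoli for the pair of potentials; \<open>4 * M * (4 * s)\<close> bounds
    it since it vanishes at \<open>z\<close>.\<close>
  obtain g k where gc: "continuous_on (sq z s) g" and k: "strict_mono (k :: nat \<Rightarrow> nat)"
    and glim: "\<And>e. 0 < e \<Longrightarrow> \<exists>N. \<forall>n x. n \<ge> N \<and> x \<in> sq z s \<longrightarrow> norm ((u (k n) x, u' (k n) x) - g x) < e"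
  proof (rule Arzela_Ascoli[of "sq z s" "\<lambda>n x. (u n x, u' n x)" "4 * M * (4 * s)"])
    fix n x assume x: "x \<in> sq z s"
    have "norm (x - z) \<le> \<bar>fst x - fst z\<bar> + \<bar>snd x - snd z\<bar>"
      by (cases x, cases z) (simp add: norm_Pair sqrt_sum_squares_le_sum_abs)
    also have "\<dots> \<le> 4 * s" using x by (auto simp: sq_def abs_if)
    finally have "4 * M * norm (x - z) \<le> 4 * M * (4 * s)" using pos by (intro mult_left_mono) auto
    then show "norm (u n x, u' n x) \<le> 4 * M * (4 * s)" using lip2[OF x zs, of n] uz by simp
  next
    fix x and e :: real assume x: "x \<in> sq z s" and e: "0 < e"
    show "\<exists>d>0. \<forall>n y. y \<in> sq z s \<and> norm (x - y) < d \<longrightarrow> norm ((u n x, u' n x) - (u n y, u' n y)) < e"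
    proof (intro exI conjI allI impI)
      show "0 < e / (4 * M)" using e pos by simp
      fix n y assume y: "y \<in> sq z s \<and> norm (x - y) < e / (4 * M)"
      then have "4 * M * norm (x - y) < e" using pos by (simp add: field_simps)
      with lip2[OF x, of y n] y show "norm ((u n x, u' n x) - (u n y, u' n y)) < e" by simp
    qed
  qed (use compact_sq in blast)+
  define w w' where "w x = fst (g x)" and "w' x = snd (g x)" for x
  have cw: "continuous_on (sq z s) w" "continuous_on (sq z s) w'" unfolding w_def w'_def by (intro continuous_intros gc)+
  have wlim: "(\<lambda>n. u (k n) x) \<longlonglongrightarrow> w x" "(\<lambda>n. u' (k n) x) \<longlonglongrightarrow> w' x" if x: "x \<in> sq z s" for x
  proof -
    have "(\<lambda>n. (u (k n) x, u' (k n) x)) \<longlonglongrightarrow> g x"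
      unfolding LIMSEQ_iff using glim x by blast
    from tendsto_fst[OF this] tendsto_snd[OF this]
    show "(\<lambda>n. u (k n) x) \<longlonglongrightarrow> w x" "(\<lambda>n. u' (k n) x) \<longlonglongrightarrow> w' x" by (simp_all add: w_def w'_def)
  qed
  have cu: "continuous_on (sq z s) (u n)" "continuous_on (sq z s) (u' n)" for n
    using pot_continuous[OF u(1) _ _ sub] pot_continuous[OF u(2) _ _ sub] in_comp by auto
  have errk: "(\<lambda>n. err (n1 + k n)) \<longlonglongrightarrow> 0"
  proof -
    have "filterlim (\<lambda>n. n1 + k n) sequentially sequentially"
      using filterlim_subseq[OF k] by (rule filterlim_at_top_mono) simp
    from filterlim_compose[OF err_tendsto this] show ?thesis by simp
  qed
  define I where "I a f = (LINT x:sq z a \<inter> E|lborel. f x)" for a and f :: "real \<times> real \<Rightarrow> real"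
  have subs: "sq z a \<inter> E \<subseteq> sq z s" if "a \<le> s" for a using sq_mono[OF that, of z] by blast
  note cpsi = psi_chi_continuous
  have lpsi: "(\<lambda>n. I a (\<lambda>x. psi h (u (k n) x) (u' (k n) x))) \<longlonglongrightarrow> I a (\<lambda>x. psi h (w x) (w' x))"
    and lchi: "(\<lambda>n. I a (\<lambda>x. chi h (u (k n) x) (u' (k n) x))) \<longlonglongrightarrow> I a (\<lambda>x. chi h (w x) (w' x))"
    if a: "a \<le> s" and h: "0 < h" for a h
  proof -
    have A: "sq z a \<inter> E \<in> sets borel" by simp
    have lim: "(\<lambda>n. psi h (u (k n) x) (u' (k n) x)) \<longlonglongrightarrow> psi h (w x) (w' x)"
      "(\<lambda>n. chi h (u (k n) x) (u' (k n) x)) \<longlonglongrightarrow> chi h (w x) (w' x)" if "x \<in> sq z a \<inter> E" for x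
      using subsetD[OF subs[OF a] that] by (auto intro!: tendsto_psi_chi[OF h] wlim)
    have B: "\<bar>psi h (u (k n) x) (u' (k n) x)\<bar> \<le> 2 / h\<^sup>2" "\<bar>chi h (u (k n) x) (u' (k n) x)\<bar> \<le> 1 / h" for n x
      using psi_chi_bounds[OF h, of "u (k n) x" "u' (k n) x"] by simp_all
    show "(\<lambda>n. I a (\<lambda>x. psi h (u (k n) x) (u' (k n) x))) \<longlonglongrightarrow> I a (\<lambda>x. psi h (w x) (w' x))"
      unfolding I_def
      by (rule set_integral_tendsto[OF compact_sq(1) A subs[OF a] cpsi(1)[OF h cu] cpsi(1)[OF h cw] B(1) lim(1)])
    show "(\<lambda>n. I a (\<lambda>x. chi h (u (k n) x) (u' (k n) x))) \<longlonglongrightarrow> I a (\<lambda>x. chi h (w x) (w' x))"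
      unfolding I_def
      by (rule set_integral_tendsto[OF compact_sq(1) A subs[OF a] cpsi(2)[OF h cu] cpsi(2)[OF h cw] B(2) lim(2)])
  qed
  \<comment> \<open>For fixed \<open>h\<close> the coefficients of \<open>err\<close> are fixed, so
    these terms disappear as \<open>n\<close> grows, although they blow up as \<open>h\<close> tends
    to \<open>0\<close>.\<close>
  have flux: "b * I a (\<lambda>x. psi h (w x) (w' x)) \<le> 4 / (c - a) * (4 * M * I c (\<lambda>x. chi h (w x) (w' x)))"
    if ac: "0 < a" "a < c" "c \<le> s" and h: "0 < h" for a c h
  proof -
    have subc: "sq z c \<subseteq> box0" using sq_mono[OF ac(3), of z] sub by blast
    have as: "a \<le> s" using ac by simp
    note l1 = lpsi[OF as h] and l2 = lchi[OF ac(3) h]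
    have le: "b * I a (\<lambda>x. psi h (u (k n) x) (u' (k n) x))
      \<le> 4 / (c - a) * (4 * M * I c (\<lambda>x. chi h (u (k n) x) (u' (k n) x)) + 1 / h * err (n1 + k n)) + 2 / h\<^sup>2 * M * err (n1 + k n)" for n
      unfolding I_def by (rule flux_bound[OF n1(1) u subc ac(1,2) h])
    have "b * I a (\<lambda>x. psi h (w x) (w' x)) \<le> 4 / (c - a) * (4 * M * I c (\<lambda>x. chi h (w x) (w' x)) + 1 / h * 0) + 2 / h\<^sup>2 * M * 0"
      by (rule LIMSEQ_le[OF tendsto_mult[OF tendsto_const l1]
          tendsto_add[OF tendsto_mult[OF tendsto_const tendsto_add[OF tendsto_mult[OF tendsto_const l2] tendsto_mult[OF tendsto_const errk]]]
            tendsto_mult[OF tendsto_const errk]]]) (use le in blast)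
    then show ?thesis by simp
  qed
  have cut: "2 * \<sigma> * (LINT x:sq z r2|lborel. 1 - h ^ 4 / (rad h (w x) (w' x))\<^sup>2)
    \<le> 8 * r2\<^sup>2 * h * (4 * M * I r2 (\<lambda>x. psi h (w x) (w' x)))" if h: "0 < h" for h
  proof -
    have r2s: "r2 \<le> s" using rs by simp
    have sub2: "sq z r2 \<subseteq> box0" using sq_mono[OF r2s, of z] sub by blast
    have rne: "rad h x y \<noteq> 0" for x y using rad_props(1)[OF h, of x y] by simp
    note l1 = lpsi[OF r2s h]
    have l2: "(\<lambda>n. LINT x:sq z r2|lborel. 1 - h ^ 4 / (rad h (u (k n) x) (u' (k n) x))\<^sup>2)
       \<longlonglongrightarrow> (LINT x:sq z r2|lborel. 1 - h ^ 4 / (rad h (w x) (w' x))\<^sup>2)"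
    proof (rule set_integral_tendsto[OF compact_sq(1)[of z s], where K=1])
      show "\<bar>1 - h ^ 4 / (rad h (u (k n) x) (u' (k n) x))\<^sup>2\<bar> \<le> 1" for n x
        using cutoff_range[OF h] by (metis abs_of_nonneg)
      show "continuous_on (sq z s) (\<lambda>x. 1 - h ^ 4 / (rad h (u (k n) x) (u' (k n) x))\<^sup>2)"
        "continuous_on (sq z s) (\<lambda>x. 1 - h ^ 4 / (rad h (w x) (w' x))\<^sup>2)" for n
        using rne by (intro continuous_intros cpsi(3)[OF h] cu cw; simp)+
      fix x assume "x \<in> sq z r2"
      then have x: "x \<in> sq z s" using sq_mono[OF r2s, of z] by blast
      show "(\<lambda>n. 1 - h ^ 4 / (rad h (u (k n) x) (u' (k n) x))\<^sup>2) \<longlonglongrightarrow> 1 - h ^ 4 / (rad h (w x) (w' x))\<^sup>2"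
        using rne by (intro tendsto_intros tendsto_psi_chi(3)[OF h] wlim x) simp
    qed (use sq_mono[OF r2s, of z] in auto)
    have le: "2 * \<sigma> * (LINT x:sq z r2|lborel. 1 - h ^ 4 / (rad h (u (k n) x) (u' (k n) x))\<^sup>2)
      \<le> 8 * r2\<^sup>2 * h * (4 * M * I r2 (\<lambda>x. psi h (u (k n) x) (u' (k n) x)) + 2 / h\<^sup>2 * err (n1 + k n))" for n
      unfolding I_def by (rule cutoff_bound[OF u sub2 \<sigma>(1,2) h zero])
    have "2 * \<sigma> * (LINT x:sq z r2|lborel. 1 - h ^ 4 / (rad h (w x) (w' x))\<^sup>2)
      \<le> 8 * r2\<^sup>2 * h * (4 * M * I r2 (\<lambda>x. psi h (w x) (w' x)) + 2 / h\<^sup>2 * 0)"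
      by (rule LIMSEQ_le[OF tendsto_mult[OF tendsto_const l2]
          tendsto_mult[OF tendsto_const tendsto_add[OF tendsto_mult[OF tendsto_const l1] tendsto_mult[OF tendsto_const errk]]]])
        (use le in blast)
    then show ?thesis by simp
  qed
  define Z0 where "Z0 = {x \<in> sq z s. w x = 0 \<and> w' x = 0}"
  have Z0[measurable]: "Z0 \<in> sets borel"
  proof -
    have "Z0 = {x \<in> sq z s. w x = 0} \<inter> {x \<in> sq z s. w' x = 0}" by (auto simp: Z0_def)
    moreover have "closed {x \<in> sq z s. w x = 0}" "closed {x \<in> sq z s. w' x = 0}"
      using continuous_closed_preimage_constant[OF cw(1)] continuous_closed_preimage_constant[OF cw(2)]
        compact_imp_closed[OF compact_sq(1)] by auto
    ultimately show ?thesis by (simp add: borel_closed closed_Int)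
  qed
  have sint: "set_integrable lborel A f" if "A \<in> sets borel" "A \<subseteq> sq z s" "continuous_on (sq z s) f" for A and f :: "real \<times> real \<Rightarrow> real"
    by (rule set_integrable_subset[OF compact_LINT(1)[OF compact_sq(1) that(3)]]) (use that in auto)
  have smono: "(LINT x:A|lborel. f x) \<le> (LINT x:B|lborel. f x)"
    if "A \<in> sets borel" "B \<in> sets borel" "A \<subseteq> B" "B \<subseteq> sq z s" "continuous_on (sq z s) f" "\<And>x. x \<in> sq z s \<Longrightarrow> 0 \<le> f x" for A B
    and f :: "real \<times> real \<Rightarrow> real"
  proof -
    have "set_integrable lborel A f" "set_integrable lborel B f" using that by (auto intro!: sint)
    then show ?thesis unfolding set_lebesgue_integral_def set_integrable_def
      by (rule integral_mono) (use that in \<open>auto simp: indicator_def\<close>)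
  qed
  have nullZ: "measure lborel (sq z r1 \<inter> E \<inter> Z0) = 0"
  proof -
    define m where "m = measure lborel (sq z r1 \<inter> E \<inter> Z0)"
    \<comment> \<open>The constant \<open>4 * (4 * M) / (s - r1)\<close> of \<open>flux\<close>,
      halved because \<open>psi\<close> equals \<open>2 / h\<^sup>2\<close> on
      \<open>Z0\<close>.\<close>
    define C where "C = 8 * M / (s - r1) * measure lborel (sq z s \<inter> E) / b"
    have mC: "m \<le> C * h" if h: "0 < h" for h
    proof -
      have "2 / h\<^sup>2 * m = (LINT x:sq z r1 \<inter> E \<inter> Z0|lborel. 2 / h\<^sup>2 * 1)"
        unfolding m_def by (subst set_integral_mult_right) (simp add: measure_set_integral)
      also have "\<dots> = (LINT x:sq z r1 \<inter> E \<inter> Z0|lborel. psi h (w x) (w' x))"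
      proof (rule set_lebesgue_integral_cong)
        show "\<forall>x. x \<in> sq z r1 \<inter> E \<inter> Z0 \<longrightarrow> 2 / h\<^sup>2 * 1 = psi h (w x) (w' x)"
          using h by (auto simp: Z0_def psi_def rad_def eval_nat_numeral)
      qed simp
      also have "\<dots> \<le> I r1 (\<lambda>x. psi h (w x) (w' x))"
        unfolding I_def using subs[of r1] rs psi_chi_bounds[OF h]
        by (intro smono cpsi[OF h] cw) auto
      finally have "b * (2 / h\<^sup>2 * m) \<le> b * I r1 (\<lambda>x. psi h (w x) (w' x))" using pos by (intro mult_left_mono) auto
      also have "\<dots> \<le> 4 / (s - r1) * (4 * M * I s (\<lambda>x. chi h (w x) (w' x)))"
        using rs h by (intro flux) auto
      also have "\<dots> \<le> 4 / (s - r1) * (4 * M * (1 / h * measure lborel (sq z s \<inter> E)))"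
      proof (intro mult_left_mono)
        have "I s (\<lambda>x. chi h (w x) (w' x)) \<le> (LINT x:sq z s \<inter> E|lborel. 1 / h * 1)"
          unfolding I_def using psi_chi_bounds[OF h]
          by (intro set_integral_mono sint cpsi[OF h] cw) (auto intro!: continuous_intros)
        also have "\<dots> = 1 / h * measure lborel (sq z s \<inter> E)"
          by (subst set_integral_mult_right) (simp add: measure_set_integral)
        finally show "I s (\<lambda>x. chi h (w x) (w' x)) \<le> 1 / h * measure lborel (sq z s \<inter> E)" .
      qed (use pos rs in auto)
      finally have "b * (2 / h\<^sup>2 * m) \<le> 4 / (s - r1) * (4 * M * (1 / h * measure lborel (sq z s \<inter> E)))" .
      then have "(b * (2 / h\<^sup>2 * m)) * (h\<^sup>2 / (2 * b)) \<le> (4 / (s - r1) * (4 * M * (1 / h * measure lborel (sq z s \<inter> E)))) * (h\<^sup>2 / (2 * b))"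
        using pos by (intro mult_right_mono) auto
      moreover have "(b * (2 / h\<^sup>2 * m)) * (h\<^sup>2 / (2 * b)) = m" using h pos by simp
      moreover have "(4 / (s - r1) * (4 * M * (1 / h * measure lborel (sq z s \<inter> E)))) * (h\<^sup>2 / (2 * b)) = C * h"
        using h pos by (simp add: C_def power2_eq_square mult.commute mult.left_commute)
      ultimately show ?thesis by simp
    qed
    have "m \<le> C * (1 / real (Suc n))" for n by (rule mC) simp
    moreover have "(\<lambda>n. C * (1 / real (Suc n))) \<longlonglongrightarrow> C * 0" by (intro tendsto_intros LIMSEQ_Suc lim_1_over_n)
    ultimately have "m \<le> C * 0" by (intro LIMSEQ_le_const) auto
    then show ?thesis unfolding m_def using measure_nonneg[of lborel "sq z r1 \<inter> E \<inter> Z0"] by simp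
  qed
  define h where "h n = 1 / real (Suc n)" for n
  have h: "0 < h n" for n by (simp add: h_def)
  have h0: "h \<longlonglongrightarrow> 0" unfolding h_def by (intro LIMSEQ_Suc lim_1_over_n)
  have fmE: "sq z r1 \<inter> E \<inter> Z0 \<in> null_sets lborel"
  proof -
    have "sq z r1 \<inter> E \<inter> Z0 \<in> fmeasurable lborel"
      by (rule fmeasurableI2[OF fmeasurable_E_sq[of z r1]]) auto
    then show ?thesis using nullZ by (simp add: null_sets_def emeasure_eq_measure2 fmeasurableD)
  qed
  have radpos: "0 < (w x)\<^sup>2 + (w' x)\<^sup>2" if "x \<in> sq z s" "x \<notin> Z0" for x
    using that by (auto simp: Z0_def sum_power2_gt_zero_iff)
  have radlim: "(\<lambda>n. rad (h n) (w x) (w' x)) \<longlonglongrightarrow> (w x)\<^sup>2 + (w' x)\<^sup>2" for x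
    unfolding rad_def using tendsto_add[OF tendsto_const[of "(w x)\<^sup>2 + (w' x)\<^sup>2"] tendsto_power[OF h0, of 2]] by simp
  \<comment> \<open>\<open>h * chi\<close> is at most \<open>1\<close> and tends to \<open>0\<close>
    wherever \<open>(w, w')\<close> is nonzero; the part of \<open>E\<close> where it is zero is
    null by \<open>nullZ\<close>.\<close>
  have chi0: "(\<lambda>n. h n * I r1 (\<lambda>x. chi (h n) (w x) (w' x))) \<longlonglongrightarrow> 0"
  proof -
    have eq: "h n * I r1 (\<lambda>x. chi (h n) (w x) (w' x)) = (LINT x:sq z r1 \<inter> E - Z0|lborel. h n * chi (h n) (w x) (w' x))" for n
    proof -
      have "I r1 (\<lambda>x. chi (h n) (w x) (w' x)) = (LINT x:sq z r1 \<inter> E - Z0|lborel. chi (h n) (w x) (w' x))"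
        unfolding I_def
      proof (rule set_integral_cong_set[symmetric])
        have c: "continuous_on (sq z s) (\<lambda>x. chi (h n) (w x) (w' x))" by (rule cpsi(2)[OF h cw])
        have "set_integrable lborel (sq z r1 \<inter> E) (\<lambda>x. chi (h n) (w x) (w' x))"
          "set_integrable lborel (sq z r1 \<inter> E - Z0) (\<lambda>x. chi (h n) (w x) (w' x))"
          using subs[of r1] rs by (auto intro!: sint c)
        then show "set_borel_measurable lborel (sq z r1 \<inter> E) (\<lambda>x. chi (h n) (w x) (w' x))"
          "set_borel_measurable lborel (sq z r1 \<inter> E - Z0) (\<lambda>x. chi (h n) (w x) (w' x))"
          unfolding set_integrable_def set_borel_measurable_def by (auto dest: borel_measurable_integrable)
        show "AE x in lborel. (x \<in> sq z r1 \<inter> E) = (x \<in> sq z r1 \<inter> E - Z0)"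
          using AE_not_in[OF fmE] by eventually_elim auto
      qed
      then show ?thesis by simp
    qed
    have "(\<lambda>n. LINT x:sq z r1 \<inter> E - Z0|lborel. h n * chi (h n) (w x) (w' x)) \<longlonglongrightarrow> (LINT x:sq z r1 \<inter> E - Z0|lborel. 0)"
    proof (rule set_integral_tendsto[OF compact_sq(1)[of z s], where K=1])
      show "\<bar>h n * chi (h n) (w x) (w' x)\<bar> \<le> 1" for n x
        using psi_chi_bounds(3,4)[OF h[of n], of "w x" "w' x"] h[of n] by (simp add: abs_mult field_simps)
      show "continuous_on (sq z s) (\<lambda>x. h n * chi (h n) (w x) (w' x))" for n
        by (intro continuous_intros cpsi[OF h] cw)
      fix x assume "x \<in> sq z r1 \<inter> E - Z0"
      then have x: "x \<in> sq z s" "x \<notin> Z0" using subs[of r1] rs by auto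
      have "(\<lambda>n. h n * ((\<bar>w x\<bar> + \<bar>w' x\<bar>) / rad (h n) (w x) (w' x))) \<longlonglongrightarrow> 0 * ((\<bar>w x\<bar> + \<bar>w' x\<bar>) / ((w x)\<^sup>2 + (w' x)\<^sup>2))"
        using radpos[OF x] by (intro tendsto_intros h0 radlim) (auto simp: sum_power2_gt_zero_iff)
      then show "(\<lambda>n. h n * chi (h n) (w x) (w' x)) \<longlonglongrightarrow> 0" by (simp add: chi_def)
    qed (use subs[of r1] rs in auto)
    then show ?thesis unfolding eq by (simp add: set_lebesgue_integral_def)
  qed
  \<comment> \<open>\<open>cut\<close> and \<open>flux\<close> bound the integral of
    \<open>1 - T\<close> by a multiple of \<open>h\<close> times the integral of \<open>chi\<close>,
    which tends to \<open>0\<close>. Off \<open>Z0\<close> the integrand tends to \<open>1\<close>,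
    so the limit of the integrals is the measure of the set itself.\<close>
  have nullW: "measure lborel (sq z r2 - Z0) = 0"
  proof -
    let ?f = "\<lambda>n x. 1 - h n ^ 4 / (rad (h n) (w x) (w' x))\<^sup>2"
    have rne: "rad (h n) x y \<noteq> 0" for n x y using rad_props(1)[OF h[of n], of x y] by simp
    have cf: "continuous_on (sq z s) (?f n)" for n
      using rne by (intro continuous_intros cpsi(3)[OF h] cw) simp
    have r2s: "sq z r2 \<subseteq> sq z s" using rs by (intro sq_mono) auto
    have divs: "X \<le> Y / (2 * \<sigma>)" if "2 * \<sigma> * X \<le> Y" for X Y
      using that \<sigma> by (simp add: pos_le_divide_eq mult.commute)
    define K where "K = 8 * r2\<^sup>2 * 4 * M * (16 * M / (r1 - r2)) / b / (2 * \<sigma>)"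
    have "(LINT x:sq z r2 - Z0|lborel. ?f n x) \<le> K * (h n * I r1 (\<lambda>x. chi (h n) (w x) (w' x)))" for n
    proof -
      let ?i = "I r2 (\<lambda>x. psi (h n) (w x) (w' x))" and ?j = "I r1 (\<lambda>x. chi (h n) (w x) (w' x))"
      have "?i \<le> (16 * M / (r1 - r2)) / b * ?j"
        using flux[of r2 r1 "h n"] rs h[of n] pos by (simp add: field_simps)
      then have "8 * r2\<^sup>2 * h n * (4 * M * ?i) \<le> 8 * r2\<^sup>2 * h n * (4 * M * ((16 * M / (r1 - r2)) / b * ?j))"
        using pos h[of n] by (intro mult_left_mono) auto
      with cut[OF h[of n]] have "2 * \<sigma> * (LINT x:sq z r2|lborel. ?f n x) \<le> 8 * r2\<^sup>2 * h n * (4 * M * ((16 * M / (r1 - r2)) / b * ?j))" by linarith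
      then have "(LINT x:sq z r2|lborel. ?f n x) \<le> 8 * r2\<^sup>2 * h n * (4 * M * ((16 * M / (r1 - r2)) / b * ?j)) / (2 * \<sigma>)"
        by (rule divs)
      also have "\<dots> = K * (h n * ?j)" by (simp add: K_def)
      finally have "(LINT x:sq z r2|lborel. ?f n x) \<le> K * (h n * ?j)" .
      moreover have "(LINT x:sq z r2 - Z0|lborel. ?f n x) \<le> (LINT x:sq z r2|lborel. ?f n x)"
        using r2s cf cutoff_range[OF h] by (intro smono) auto
      ultimately show ?thesis by linarith
    qed
    moreover have "(\<lambda>n. K * (h n * I r1 (\<lambda>x. chi (h n) (w x) (w' x)))) \<longlonglongrightarrow> K * 0"
      by (intro tendsto_intros chi0)
    moreover have "(\<lambda>n. LINT x:sq z r2 - Z0|lborel. ?f n x) \<longlonglongrightarrow> (LINT x:sq z r2 - Z0|lborel. 1)"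
    proof (rule set_integral_tendsto[OF compact_sq(1)[of z s], where K=1])
      show "\<bar>?f n x\<bar> \<le> 1" for n x using cutoff_range[OF h] by (metis abs_of_nonneg)
      fix x assume "x \<in> sq z r2 - Z0"
      then have x: "x \<in> sq z s" "x \<notin> Z0" using r2s by auto
      have "(\<lambda>n. 1 - h n ^ 4 / (rad (h n) (w x) (w' x))\<^sup>2) \<longlonglongrightarrow> 1 - 0 ^ 4 / ((w x)\<^sup>2 + (w' x)\<^sup>2)\<^sup>2"
        using radpos[OF x] by (intro tendsto_intros h0 radlim) (auto simp: sum_power2_gt_zero_iff)
      then show "(\<lambda>n. ?f n x) \<longlonglongrightarrow> 1" by simp
    qed (use r2s cf in auto)
    ultimately have "(LINT x:sq z r2 - Z0|lborel. 1) \<le> K * 0" by (intro LIMSEQ_le) auto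
    then show ?thesis using measure_nonneg[of lborel "sq z r2 - Z0"] by (simp add: measure_set_integral)
  qed
  have "sq z r2 - Z0 \<in> null_sets lborel"
  proof -
    have "sq z r2 \<in> fmeasurable lborel" by (rule fmeasurable_compact[OF compact_sq(1)])
    then have "sq z r2 - Z0 \<in> fmeasurable lborel" by (rule fmeasurableI2) auto
    then show ?thesis using nullW by (simp add: null_sets_def emeasure_eq_measure2 fmeasurableD)
  qed
  then have U1: "(sq z r1 \<inter> E \<inter> Z0) \<union> (sq z r2 - Z0) \<in> null_sets lborel" using fmE by (rule null_sets.Un[rotated])
  \<comment> \<open>Almost no point of \<open>E\<close> lies in \<open>Z0\<close>, and almost no
    point of the square lies outside \<open>Z0\<close>.\<close>
  have U2: "E \<inter> sq z r \<subseteq> (sq z r1 \<inter> E \<inter> Z0) \<union> (sq z r2 - Z0)"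
    using sq_mono[of r r2 z] sq_mono[of r2 r1 z] rs by auto
  have "E \<inter> sq z r \<in> null_sets lborel"
    by (rule null_sets_subset[OF U1 _ U2]) simp
  then show ?thesis by (simp add: null_sets_def measure_def)
qed

text \<open>The factor \<open>8\<close> is room for moving the centre, with
  \<open>s0 = 8 * t\<close>. The sparse square at a density point in \<open>sq z0 t\<close> has its
  centre \<open>z\<close> within \<open>3 / 2 * t\<close> of \<open>z0\<close> in each coordinate;
  \<open>sq z (3 * t)\<close> then covers \<open>sq z0 t\<close>, while \<open>sq z (4 * t)\<close>
  stays in \<open>box0\<close>.\<close>

theorem null_or_full:
  assumes s0: "0 < s0"
  shows "E \<inter> sq z0 (s0 / 8) \<in> null_sets lborel \<or> sq z0 (s0 / 8) - E \<in> null_sets lborel"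
proof (rule disjCI)
  define t where "t = s0 / 8"
  assume "sq z0 (s0 / 8) - E \<notin> null_sets lborel"
  then have full: "sq z0 t - E \<notin> null_sets lborel" by (simp add: t_def)
  have t: "0 < t" using s0 by (simp add: t_def)
  have Eleb: "E \<in> sets lebesgue" using E by simp
  obtain N where N: "negligible N"
    "\<And>x e. x \<notin> N \<Longrightarrow> x \<notin> E \<Longrightarrow> 0 < e \<Longrightarrow> \<exists>d>0. \<forall>h. 0 < h \<and> h < d \<longrightarrow>
       measure lebesgue (E \<inter> cbox x (x + h *\<^sub>R (1, 1))) < e * h\<^sup>2"
    by (rule box_density_complement[OF Eleb]) (rule that)
  have "\<not> sq z0 t - E \<subseteq> N"
  proof
    assume "sq z0 t - E \<subseteq> N"
    with N(1) have "negligible (sq z0 t - E)" by (rule negligible_subset)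
    then have "sq z0 t - E \<in> null_sets (completion lborel)" by (simp add: negligible_iff_null_sets)
    then have "sq z0 t - E \<in> null_sets lborel" by (subst (asm) null_sets_completion_iff) auto
    with full show False by simp
  qed
  then obtain x where x: "x \<in> sq z0 t" "x \<notin> E" "x \<notin> N" by blast
  \<comment> \<open>For a square of side \<open>h\<close>, hence of half side \<open>h / 2\<close>,
    density below \<open>e\<close> is the smallness condition of
    \<open>sparse_square_null\<close>.\<close>
  define e where "e = b / (4 * (64 * (16 * M)\<^sup>2))"
  have e: "0 < e" using pos by (simp add: e_def)
  obtain d where d: "d > 0" "\<And>h. 0 < h \<Longrightarrow> h < d \<Longrightarrow> measure lebesgue (E \<inter> cbox x (x + h *\<^sub>R (1, 1))) < e * h\<^sup>2"
    using N(2)[OF x(3,2) e] by blast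
  define h where "h = min d t / 2"
  have h: "0 < h" "h < d" "h < t" using d(1) t by (auto simp: h_def)
  define z where "z = (fst x + h / 2, snd x + h / 2)"
  have zz: "fst z \<le> fst z0 + 3 / 2 * t" "fst z0 - 3 / 2 * t \<le> fst z"
    "snd z \<le> snd z0 + 3 / 2 * t" "snd z0 - 3 / 2 * t \<le> snd z"
    using x(1) h by (auto simp: z_def sq_def)
  have box: "sq z c \<subseteq> box0" if "c \<le> 4 * t" for c
    using that zz t by (auto simp: sq_def box0_def t_def)
  have sqz: "sq z (h / 2) = cbox x (x + h *\<^sub>R (1, 1))" by (cases x) (simp add: sq_cbox z_def add.commute)
  have "measure lborel (E \<inter> sq z (h / 2)) = measure lebesgue (E \<inter> cbox x (x + h *\<^sub>R (1, 1)))"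
    unfolding sqz by simp
  also have "\<dots> \<le> e * h\<^sup>2" using d(2)[OF h(1,2)] by simp
  also have "\<dots> = b * (h / 2)\<^sup>2 / (64 * (16 * M)\<^sup>2)" by (simp add: e_def power_divide)
  finally have "measure lborel (E \<inter> sq z (h / 2)) \<le> b * (h / 2)\<^sup>2 / (64 * (16 * M)\<^sup>2)" .
  then have null: "measure lborel (E \<inter> sq z (h / 2 / 2)) = 0"
    using h t by (intro sparse_square_null box) auto
  have "measure lborel (E \<inter> sq z (3 * t)) = 0"
    using h t by (intro spread_null[OF box[of "4 * t"] _ _ null]) auto
  then have U1: "E \<inter> sq z (3 * t) \<in> null_sets lborel"
    using fmeasurable_E_sq[of z "3 * t"] by (simp add: null_sets_def emeasure_eq_measure2 fmeasurableD)
  have U2: "E \<inter> sq z0 t \<subseteq> E \<inter> sq z (3 * t)" using zz t by (auto simp: sq_def)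
  have "E \<inter> sq z0 t \<in> null_sets lborel" by (rule null_sets_subset[OF U1 _ U2]) simp
  then show "E \<inter> sq z0 (s0 / 8) \<in> null_sets lborel" by (simp add: t_def)
qed

end

section \<open>Weak derivatives of Lipschitz functions\<close>

text \<open>The analysis is carried out on \<open>real \<times> real\<close>, where Fubini's theorem
  is at hand; the theorem speaks of \<open>real^2\<close>. The two maps are isometric and preserve
  Lebesgue measure.\<close>

definition to_vec :: "real \<times> real \<Rightarrow> real^2" where "to_vec z = fst z *\<^sub>R axis 1 1 + snd z *\<^sub>R axis 2 1"
definition of_vec :: "real^2 \<Rightarrow> real \<times> real" where "of_vec x = (x $ 1, x $ 2)"

lemma to_vec_nth [simp]: "to_vec z $ 1 = fst z" "to_vec z $ 2 = snd z"
  by (simp_all add: to_vec_def axis_def)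

lemma of_to_vec [simp]: "of_vec (to_vec z) = z" by (simp add: of_vec_def)
lemma to_of_vec [simp]: "to_vec (of_vec x) = x" by (simp add: of_vec_def vec_eq_iff forall_2)

lemma bounded_linear_to_vec: "bounded_linear to_vec" and bounded_linear_of_vec: "bounded_linear of_vec"
proof -
  have "linear to_vec" by (rule linearI) (simp_all add: to_vec_def algebra_simps)
  then show "bounded_linear to_vec" by (simp add: linear_linear)
  have "linear of_vec" by (rule linearI) (simp_all add: of_vec_def)
  then show "bounded_linear of_vec" by (simp add: linear_linear)
qed

lemma continuous_to_vec: "continuous_on S to_vec" and continuous_of_vec: "continuous_on T of_vec"
  by (auto intro: linear_continuous_on bounded_linear_to_vec bounded_linear_of_vec)

lemma measurable_to_vec [measurable]: "to_vec \<in> borel_measurable borel" "of_vec \<in> borel_measurable borel"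
  by (auto intro: borel_measurable_continuous_onI continuous_to_vec continuous_of_vec)

lemma dist_to_vec: "dist (to_vec x) (to_vec y) = dist x y"
  by (simp add: dist_vec_def L2_set_def sum_2 dist_prod_def)

lemma lborel_to_vec: "(lborel :: (real^2) measure) = distr lborel borel to_vec"
proof (rule lborel_eqI)
  fix l u :: "real^2" assume lu: "\<And>b. b \<in> Basis \<Longrightarrow> l \<bullet> b \<le> u \<bullet> b"
  have B: "(Basis :: (real^2) set) = {axis 1 1, axis 2 1}"
    by (auto simp: Basis_vec_def UNIV_2)
  have ne: "axis 1 1 \<noteq> (axis 2 1 :: real^2)" by (simp add: axis_eq_axis)
  have le: "l $ 1 \<le> u $ 1" "l $ 2 \<le> u $ 2" using lu[of "axis 1 1"] lu[of "axis 2 1"] by (auto simp: B inner_axis)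
  have pre: "to_vec -` box l u = box (l $ 1) (u $ 1) \<times> box (l $ 2) (u $ 2)"
    by (auto simp: mem_box B inner_axis)
  have "emeasure (distr lborel borel to_vec) (box l u) = emeasure lborel (box (l $ 1) (u $ 1) \<times> box (l $ 2) (u $ 2))"
    by (subst emeasure_distr) (auto simp: pre)
  also have "\<dots> = emeasure (lborel \<Otimes>\<^sub>M lborel) (box (l $ 1) (u $ 1) \<times> box (l $ 2) (u $ 2))"
    by (simp only: lborel_prod)
  also have "\<dots> = emeasure lborel (box (l $ 1) (u $ 1)) * emeasure lborel (box (l $ 2) (u $ 2))"
    by (rule lborel.emeasure_pair_measure_Times) auto
  also have "\<dots> = ennreal ((u $ 1 - l $ 1) * (u $ 2 - l $ 2))"
    using le by (simp add: ennreal_mult)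
  also have "(u $ 1 - l $ 1) * (u $ 2 - l $ 2) = (\<Prod>b\<in>Basis. (u - l) \<bullet> b)"
    by (simp add: B ne inner_axis)
  finally show "emeasure (distr lborel borel to_vec) (box l u) = ennreal (\<Prod>b\<in>Basis. (u - l) \<bullet> b)" .
qed simp

lemma AE_to_vecI:
  assumes "AE z in lborel. P (to_vec z)" shows "AE x in lebesgue. P x"
proof -
  from assms obtain N where N: "{z. \<not> P (to_vec z)} \<subseteq> N" "N \<in> null_sets lborel"
    by (auto simp: eventually_ae_filter)
  have "of_vec -` N \<in> sets borel" using N(2) measurable_sets[OF measurable_to_vec(2), of N] by auto
  moreover have "emeasure lborel (of_vec -` N) = emeasure lborel (to_vec -` of_vec -` N)"
    using calculation by (subst lborel_to_vec, subst emeasure_distr) auto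
  moreover have "to_vec -` of_vec -` N = N" by auto
  ultimately have "of_vec -` N \<in> null_sets lborel" using N(2) by (auto simp: null_sets_def)
  then have "AE x in lborel. x \<notin> of_vec -` N" by (rule AE_not_in)
  then have "AE x in lborel. P x"
  proof eventually_elim
    case (elim x)
    then show ?case using N(1) by (metis (mono_tags, lifting) mem_Collect_eq subsetD to_of_vec vimageI)
  qed
  then show ?thesis by (rule AE_completion)
qed

text \<open>McShane's extension: the infimum of the cones \<open>f y + L * dist y x\<close> over
  \<open>y\<close> in \<open>S\<close>.\<close>

lemma lipschitz_real_extension:
  fixes f :: "'a::metric_space \<Rightarrow> real"
  assumes L: "L-lipschitz_on S f" and S: "S \<noteq> {}"
  obtains g where "L-lipschitz_on UNIV g" "\<And>x. x \<in> S \<Longrightarrow> g x = f x"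
proof -
  have L0: "0 \<le> L" and fL: "\<And>x y. x \<in> S \<Longrightarrow> y \<in> S \<Longrightarrow> f x \<le> f y + L * dist x y"
    using L by (auto simp: lipschitz_on_def dist_real_def abs_le_iff) (smt (verit))
  obtain y0 where y0: "y0 \<in> S" using S by blast
  define g where "g x = (INF y\<in>S. f y + L * dist y x)" for x
  have bd: "bdd_below ((\<lambda>y. f y + L * dist y x) ` S)" for x
  proof (rule bdd_belowI2)
    fix y assume y: "y \<in> S"
    have "f y0 \<le> f y + L * dist y0 y" by (rule fL[OF y0 y])
    also have "L * dist y0 y \<le> L * (dist y x + dist y0 x)"
      using dist_triangle2[of y0 y x] L0 by (intro mult_left_mono) auto
    finally show "f y0 - L * dist y0 x \<le> f y + L * dist y x" by (simp add: algebra_simps)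
  qed
  have gle: "g x \<le> g x' + L * dist x x'" for x x'
  proof -
    have "g x - L * dist x x' \<le> f y + L * dist y x'" if "y \<in> S" for y
    proof -
      have "g x \<le> f y + L * dist y x" unfolding g_def by (rule cINF_lower[OF bd that])
      also have "L * dist y x \<le> L * (dist y x' + dist x x')"
        using dist_triangle2[of y x x'] L0 by (intro mult_left_mono) auto
      finally show ?thesis by (simp add: algebra_simps)
    qed
    then have "g x - L * dist x x' \<le> g x'" unfolding g_def[of x'] by (intro cINF_greatest S)
    then show ?thesis by simp
  qed
  show ?thesis
  proof (rule that)
    show "L-lipschitz_on UNIV g"
    proof (rule lipschitz_onI[OF _ L0])
      fix x y show "dist (g x) (g y) \<le> L * dist x y"
        using gle[of x y] gle[of y x] by (auto simp: dist_real_def abs_le_iff dist_commute)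
    qed
    fix x assume x: "x \<in> S"
    have "g x \<le> f x + L * dist x x" unfolding g_def by (rule cINF_lower[OF bd x])
    moreover have "f x \<le> g x" unfolding g_def using fL[OF x] by (intro cINF_greatest S) (simp add: dist_commute)
    ultimately show "g x = f x" by simp
  qed
qed

text \<open>\<open>f\<close> on the ball and \<open>0\<close> outside the doubled ball form a
  Lipschitz function, because the gap of width \<open>\<rho>\<close> pays for the jump; McShane's
  extension fills the gap. Compact support makes the result integrable, as mollification
  requires.\<close>

lemma lipschitz_compact_extension:
  fixes f :: "real \<times> real \<Rightarrow> real"
  assumes L: "L-lipschitz_on (cball z \<rho>) f" and \<rho>: "0 < \<rho>"
  obtains g C R where "C-lipschitz_on UNIV g" "\<And>x. x \<in> cball z \<rho> \<Longrightarrow> g x = f x"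
    "0 < R" "\<And>x. R < norm x \<Longrightarrow> g x = 0"
proof -
  have L0: "0 \<le> L" and fL: "\<And>x y. x \<in> cball z \<rho> \<Longrightarrow> y \<in> cball z \<rho> \<Longrightarrow> \<bar>f x - f y\<bar> \<le> L * dist x y"
    using L unfolding lipschitz_on_def dist_real_def by blast+
  define K where "K = \<bar>f z\<bar> + L * \<rho>"
  have K0: "0 \<le> K" using L0 \<rho> by (simp add: K_def)
  have K: "\<bar>f x\<bar> \<le> K" if "x \<in> cball z \<rho>" for x
  proof -
    have "\<bar>f x - f z\<bar> \<le> L * dist x z" using that \<rho> by (intro fL) auto
    also have "\<dots> \<le> L * \<rho>" using that L0 by (intro mult_left_mono) (auto simp: dist_commute)
    finally show ?thesis unfolding K_def by linarith
  qed
  define F where "F x = (if x \<in> cball z \<rho> then f x else 0)" for x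
  define S where "S = cball z \<rho> \<union> {x. 2 * \<rho> \<le> dist z x}"
  \<comment> \<open>The jump is at most \<open>K\<close> over a distance of at least
    \<open>\<rho>\<close>.\<close>
  define C where "C = L + K / \<rho>"
  have C0: "0 \<le> C" using L0 K0 \<rho> by (simp add: C_def)
  have mixed: "\<bar>F x - F y\<bar> \<le> C * dist x y" if "x \<in> cball z \<rho>" "2 * \<rho> \<le> dist z y" for x y
  proof -
    have "\<rho> \<le> dist x y" using that dist_triangle[of z y x] by simp
    then have "K / \<rho> * \<rho> \<le> K / \<rho> * dist x y" using K0 \<rho> by (intro mult_left_mono) auto
    moreover have "0 \<le> L * dist x y" using L0 by simp
    ultimately have "K \<le> C * dist x y" using \<rho> by (simp add: C_def distrib_right)
    moreover have "F y = 0" using that \<rho> by (simp add: F_def)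
    ultimately show ?thesis using K[OF that(1)] that(1) by (simp add: F_def)
  qed
  have "C-lipschitz_on S F"
  proof (rule lipschitz_onI[OF _ C0])
    fix x y assume xy: "x \<in> S" "y \<in> S"
    consider "x \<in> cball z \<rho>" "y \<in> cball z \<rho>" | "x \<in> cball z \<rho>" "2 * \<rho> \<le> dist z y"
      | "2 * \<rho> \<le> dist z x" "y \<in> cball z \<rho>" | "2 * \<rho> \<le> dist z x" "2 * \<rho> \<le> dist z y"
      using xy unfolding S_def by blast
    then have "\<bar>F x - F y\<bar> \<le> C * dist x y"
    proof cases
      case 1
      then have "\<bar>F x - F y\<bar> \<le> L * dist x y" using fL by (simp add: F_def)
      also have "\<dots> \<le> C * dist x y" using K0 \<rho> by (intro mult_right_mono) (auto simp: C_def)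
      finally show ?thesis .
    next
      case 2 then show ?thesis by (rule mixed)
    next
      case 3 then show ?thesis using mixed[of y x] by (simp add: dist_commute abs_minus_commute)
    next
      case 4 then show ?thesis using \<rho> C0 by (simp add: F_def)
    qed
    then show "dist (F x) (F y) \<le> C * dist x y" by (simp add: dist_real_def)
  qed
  moreover have "S \<noteq> {}" using \<rho> by (auto simp: S_def)
  ultimately obtain g where g: "C-lipschitz_on UNIV g" "\<And>x. x \<in> S \<Longrightarrow> g x = F x"
    by (rule lipschitz_real_extension) (rule that)
  show ?thesis
  proof (rule that[OF g(1)])
    show "g x = f x" if "x \<in> cball z \<rho>" for x using g(2)[of x] that by (simp add: S_def F_def)
    show "0 < norm z + 2 * \<rho>" using \<rho> by (simp add: add_nonneg_pos)
    show "g x = 0" if "norm z + 2 * \<rho> < norm x" for x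
    proof -
      have "2 * \<rho> \<le> dist z x" using that norm_triangle_sub[of x z] by (simp add: dist_norm norm_minus_commute)
      then show ?thesis using g(2)[of x] \<rho> by (simp add: S_def F_def)
    qed
  qed
qed

definition dquot :: "(real \<times> real \<Rightarrow> real) \<Rightarrow> real \<times> real \<Rightarrow> nat \<Rightarrow> real \<times> real \<Rightarrow> real" where
  "dquot f v n z = (f (z + (1 / real (Suc n)) *\<^sub>R v) - f z) / (1 / real (Suc n))"

text \<open>Clipping makes the value harmless where the difference quotients diverge and \<open>lim\<close> is arbitrary.\<close>
definition pderiv_lim :: "real \<Rightarrow> (real \<times> real \<Rightarrow> real) \<Rightarrow> real \<times> real \<Rightarrow> real \<times> real \<Rightarrow> real" where
  "pderiv_lim C f v z = max (- C) (min C (lim (\<lambda>n. dquot f v n z)))"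

locale lipschitz_compact =
  fixes f :: "real \<times> real \<Rightarrow> real" and C R :: real
  assumes lip: "C-lipschitz_on UNIV f" and supp: "R < norm x \<Longrightarrow> f x = 0" and R: "0 < R"
begin

lemma C0: "0 \<le> C" and fC: "\<bar>f x - f y\<bar> \<le> C * dist x y"
  using lip unfolding lipschitz_on_def dist_real_def by blast+

lemma cont: "continuous_on UNIV f" using lip by (rule lipschitz_on_continuous_on)

lemma bounded_f: "\<exists>B. \<forall>x. \<bar>f x\<bar> \<le> B"
proof -
  have "compact (f ` cball 0 R)" by (intro compact_continuous_image continuous_on_subset[OF cont]) auto
  then obtain B where B: "\<forall>y\<in>f ` cball 0 R. norm y \<le> B" using compact_imp_bounded bounded_iff by blast
  have "\<bar>f x\<bar> \<le> max B 0" for x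
  proof (cases "R < norm x")
    case False then have "\<bar>f x\<bar> \<le> B" using B by auto then show ?thesis by simp
  qed (use supp in simp)
  then show ?thesis by blast
qed

lemma meas [measurable]: "f \<in> borel_measurable borel"
  by (rule borel_measurable_continuous_onI[OF cont])

lemma integrable_f: "integrable lborel f"
proof -
  obtain B where "\<And>x. \<bar>f x\<bar> \<le> B" using bounded_f by blast
  then show ?thesis by (intro integrable_bounded_support[OF meas _ supp])
qed

lemma dquot_bound: "norm v \<le> 1 \<Longrightarrow> \<bar>dquot f v n z\<bar> \<le> C"
proof -
  assume v: "norm v \<le> 1"
  let ?h = "1 / real (Suc n)"
  have "\<bar>f (z + ?h *\<^sub>R v) - f z\<bar> \<le> C * dist (z + ?h *\<^sub>R v) z" by (rule fC)
  also have "\<dots> \<le> C * ?h" using C0 v by (intro mult_left_mono) (auto simp: dist_norm divide_simps)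
  finally show ?thesis by (simp add: dquot_def abs_mult divide_simps mult.commute)
qed

lemma dquot_supp: "norm v \<le> 1 \<Longrightarrow> R + 1 < norm z \<Longrightarrow> dquot f v n z = 0"
proof -
  assume v: "norm v \<le> 1" and z: "R + 1 < norm z"
  let ?h = "1 / real (Suc n)"
  have "norm (?h *\<^sub>R v) \<le> 1" using v by (simp add: divide_simps)
  then have "R < norm (z + ?h *\<^sub>R v)" using z norm_diff_ineq[of z "?h *\<^sub>R v"] by linarith
  then show ?thesis using supp z by (simp add: dquot_def)
qed

lemma dquot_meas [measurable]: "dquot f v n \<in> borel_measurable borel"
proof -
  have "continuous_on UNIV (dquot f v n)"
    unfolding dquot_def[abs_def] by (intro continuous_intros continuous_on_compose2[OF cont]) auto
  then show ?thesis by (rule borel_measurable_continuous_onI)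
qed

lemma pderiv_lim_meas [measurable]: "pderiv_lim C f v \<in> borel_measurable borel"
  unfolding pderiv_lim_def[abs_def] by measurable

lemma pderiv_lim_bound: "\<bar>pderiv_lim C f v z\<bar> \<le> C"
  using C0 by (auto simp: pderiv_lim_def)

lemma pderiv_lim_supp:
  assumes "norm v \<le> 1" "R + 1 < norm z" shows "pderiv_lim C f v z = 0"
  using dquot_supp[OF assms] C0 by (simp add: pderiv_lim_def lim_def tendsto_const_iff[OF sequentially_bot])

lemma dquot_tendsto:
  assumes d: "(f has_derivative f') (at z)" and v: "norm v \<le> 1"
  shows "(\<lambda>n. dquot f v n z) \<longlonglongrightarrow> f' v" "pderiv_lim C f v z = f' v"
proof -
  have "((\<lambda>t. f (z + t *\<^sub>R v)) has_derivative (\<lambda>t. f' (t *\<^sub>R v))) (at 0)"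
    by (rule has_derivative_compose[of "\<lambda>t. z + t *\<^sub>R v" "\<lambda>t. t *\<^sub>R v" 0 UNIV f f'])
      (use d in \<open>auto intro!: derivative_eq_intros\<close>)
  moreover have "f' (t *\<^sub>R v) = f' v * t" for t
    using linear_scale[OF has_derivative_linear[OF d], of t v] by (simp add: mult.commute)
  ultimately have "((\<lambda>t. f (z + t *\<^sub>R v)) has_real_derivative f' v) (at 0)"
    by (simp add: has_field_derivative_def mult_commute_abs)
  then have "((\<lambda>t. (f (z + t *\<^sub>R v) - f z) / t) \<longlongrightarrow> f' v) (at 0)" by (simp add: DERIV_def)
  then have "(\<lambda>n. (f (z + (1 / real (Suc n)) *\<^sub>R v) - f z) / (1 / real (Suc n))) \<longlonglongrightarrow> f' v"
    unfolding tendsto_at_iff_sequentially o_def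
    by (elim allE[of _ "\<lambda>n. 1 / real (Suc n)"]) (use LIMSEQ_Suc[OF lim_1_over_n] in auto)
  then show lim: "(\<lambda>n. dquot f v n z) \<longlonglongrightarrow> f' v" by (simp add: dquot_def)
  have "\<bar>f' v\<bar> \<le> C"
    by (rule LIMSEQ_le_const2[OF tendsto_rabs[OF lim]]) (use dquot_bound[OF v] in blast)
  then show "pderiv_lim C f v z = f' v" unfolding pderiv_lim_def limI[OF lim] by (auto simp: abs_le_iff)
qed

lemma smear_shift:
  assumes "cont_bdd \<alpha>" "cont_bdd \<gamma>"
  shows "smear \<alpha> \<gamma> k (\<lambda>y. f (y + c)) z = smear \<alpha> \<gamma> k f (z + c)"
proof -
  have "smear \<alpha> \<gamma> k f (z + c) = (LINT y|lborel. f (c + y) * (\<alpha> (k * (fst (z + c) - fst (c + y))) * \<gamma> (k * (snd (z + c) - snd (c + y)))))"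
    unfolding smear_def by (subst (1) lborel_distr_plus[of c, symmetric], subst integral_distr)
      (use smear_integrand_measurable[OF assms meas, of k "z + c"] in auto)
  also have "\<dots> = smear \<alpha> \<gamma> k (\<lambda>y. f (y + c)) z" unfolding smear_def by (simp add: add.commute)
  finally show ?thesis by simp
qed

text \<open>Translation invariance moves the difference quotient from \<open>f\<close> to its
  convolution. The quotients of \<open>f\<close> converge almost everywhere by Rademacher's theorem
  and are bounded by \<open>C\<close> with bounded support, so the limit passes under the
  integral.\<close>

lemma smear_pderiv:
  assumes \<alpha>: "cont_bdd \<alpha>" and \<gamma>: "cont_bdd \<gamma>" and v: "norm v \<le> 1"
    and D: "((\<lambda>t. smear \<alpha> \<gamma> k f (z + t *\<^sub>R v)) has_real_derivative d) (at 0)"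
  shows "smear \<alpha> \<gamma> k (pderiv_lim C f v) z = d"
proof -
  obtain B where B: "0 \<le> B" "\<And>s t. \<bar>\<alpha> s * \<gamma> t\<bar> \<le> B" using smear_bound[OF \<alpha> \<gamma>] by blast
  have shift_int: "integrable lborel (\<lambda>y. f (y + c))" for c
  proof -
    obtain K where K: "\<And>x. \<bar>f x\<bar> \<le> K" using bounded_f by blast
    show ?thesis
    proof (rule integrable_bounded_support[of _ K "R + norm c"])
      show "(\<lambda>y. f (y + c)) \<in> borel_measurable borel" by measurable
      show "f (x + c) = 0" if "R + norm c < norm x" for x
        using that norm_diff_ineq[of x c] by (intro supp) linarith
    qed (rule K)
  qed
  have dq: "smear \<alpha> \<gamma> k (dquot f v n) z = (smear \<alpha> \<gamma> k f (z + (1 / real (Suc n)) *\<^sub>R v) - smear \<alpha> \<gamma> k f z) / (1 / real (Suc n))" for n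
  proof -
    let ?h = "1 / real (Suc n)"
    define ker where "ker y = \<alpha> (k * (fst z - fst y)) * \<gamma> (k * (snd z - snd y))" for y :: "real \<times> real"
    have i: "integrable lborel (\<lambda>y. f (y + ?h *\<^sub>R v) * ker y)" "integrable lborel (\<lambda>y. f y * ker y)"
      unfolding ker_def by (rule smear_integrable[OF \<alpha> \<gamma> shift_int], rule smear_integrable[OF \<alpha> \<gamma> integrable_f])
    have "smear \<alpha> \<gamma> k (dquot f v n) z = (LINT y|lborel. (f (y + ?h *\<^sub>R v) * ker y - f y * ker y) / ?h)"
      unfolding smear_def dquot_def ker_def
      by (rule Bochner_Integration.integral_cong) (simp_all add: left_diff_distrib diff_divide_distrib del: of_nat_Suc)
    also have "\<dots> = (LINT y|lborel. f (y + ?h *\<^sub>R v) * ker y - f y * ker y) / ?h" by (rule integral_divide_zero)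
    also have "(LINT y|lborel. f (y + ?h *\<^sub>R v) * ker y - f y * ker y)
        = (LINT y|lborel. f (y + ?h *\<^sub>R v) * ker y) - (LINT y|lborel. f y * ker y)"
      by (rule Bochner_Integration.integral_diff[OF i])
    finally have "smear \<alpha> \<gamma> k (dquot f v n) z = (smear \<alpha> \<gamma> k (\<lambda>y. f (y + ?h *\<^sub>R v)) z - smear \<alpha> \<gamma> k f z) / ?h"
      unfolding smear_def ker_def .
    then show ?thesis by (simp add: smear_shift[OF \<alpha> \<gamma>])
  qed
  have "(\<lambda>n. smear \<alpha> \<gamma> k (dquot f v n) z) \<longlonglongrightarrow> d"
    unfolding dq using D unfolding DERIV_def tendsto_at_iff_sequentially o_def
    by (elim allE[of _ "\<lambda>n. 1 / real (Suc n)"]) (use LIMSEQ_Suc[OF lim_1_over_n] in auto)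
  moreover have "(\<lambda>n. smear \<alpha> \<gamma> k (dquot f v n) z) \<longlonglongrightarrow> smear \<alpha> \<gamma> k (pderiv_lim C f v) z"
    unfolding smear_def
  proof (rule integral_dominated_convergence[where w="\<lambda>y. (C * B) * indicator (cball 0 (R + 1)) y"])
    show "integrable lborel (\<lambda>y. (C * B) * indicator (cball (0 :: real \<times> real) (R + 1)) y)"
      by (intro integrable_mult_right integrable_real_indicator emeasure_bounded_finite) auto
    show "AE y in lborel. (\<lambda>n. dquot f v n y * (\<alpha> (k * (fst z - fst y)) * \<gamma> (k * (snd z - snd y))))
       \<longlonglongrightarrow> pderiv_lim C f v y * (\<alpha> (k * (fst z - fst y)) * \<gamma> (k * (snd z - snd y)))"
      using rademacher_plane[OF lip]
    proof eventually_elim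
      case (elim y)
      then obtain f' where "(f has_derivative f') (at y)" by (auto simp: differentiable_def)
      from dquot_tendsto[OF this v] show ?case by (auto intro!: tendsto_intros)
    qed
    show "AE y in lborel. norm (dquot f v n y * (\<alpha> (k * (fst z - fst y)) * \<gamma> (k * (snd z - snd y))))
        \<le> (C * B) * indicator (cball 0 (R + 1)) y" for n
    proof (rule AE_I2)
      fix y :: "real \<times> real"
      have "\<bar>dquot f v n y\<bar> * \<bar>\<alpha> (k * (fst z - fst y)) * \<gamma> (k * (snd z - snd y))\<bar> \<le> C * B"
        using dquot_bound[OF v] B C0 by (intro mult_mono) auto
      then show "norm (dquot f v n y * (\<alpha> (k * (fst z - fst y)) * \<gamma> (k * (snd z - snd y)))) \<le> (C * B) * indicator (cball 0 (R + 1)) y"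
        using dquot_supp[OF v, of y n] by (cases "R + 1 < norm y") (auto simp: abs_mult)
    qed
  qed (use smear_integrand_measurable[OF \<alpha> \<gamma> pderiv_lim_meas] smear_integrand_measurable[OF \<alpha> \<gamma> dquot_meas] in auto)
  ultimately show ?thesis using LIMSEQ_unique by blast
qed

text \<open>By \<open>smear_pderiv\<close> both sides put the missing derivative on the kernel and
  become \<open>k\<close> times the convolution of \<open>f\<close> with \<open>deriv bump\<close>
  in both slots.\<close>

lemma weak_curl_free:
  "smear bump (deriv bump) k (pderiv_lim C f (1, 0)) z = smear (deriv bump) bump k (pderiv_lim C f (0, 1)) z"
proof -
  have d: "(bump has_real_derivative deriv bump x) (at x)" for x
    by (rule C_k_real_deriv(1)[OF C_k_bump[of "Suc 0"]])
  have sh: "((\<lambda>t. F (c + t)) has_real_derivative D) (at 0)" if "(F has_real_derivative D) (at c)" for F D and c :: real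
    using that DERIV_shift[of F D 0 c] by (simp add: add.commute)
  have "smear bump (deriv bump) k (pderiv_lim C f (1, 0)) z = k * smear (deriv bump) (deriv bump) k f z"
    by (rule smear_pderiv[OF cont_bdd_bump(1,2)])
      (use sh[OF smear_DERIV(1)[OF cont_bdd_bump(1,2) d cont_bdd_bump(2) integrable_f, of k "snd z" "fst z"]] in
        \<open>simp_all add: norm_Pair plus_prod_def\<close>)
  moreover have "smear (deriv bump) bump k (pderiv_lim C f (0, 1)) z = k * smear (deriv bump) (deriv bump) k f z"
    by (rule smear_pderiv[OF cont_bdd_bump(2,1)])
      (use sh[OF smear_DERIV(2)[OF cont_bdd_bump(1,2) d cont_bdd_bump(2) integrable_f, of k "fst z" "snd z"]] in
        \<open>simp_all add: norm_Pair plus_prod_def\<close>)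
  ultimately show ?thesis by simp
qed

end

section \<open>Stationary points\<close>

lemma smear_kernel_zero:
  fixes \<alpha> \<gamma> :: "real \<Rightarrow> real"
  assumes "0 < k" "y \<notin> sq z (1 / k)" "\<And>x. 1 < \<bar>x\<bar> \<Longrightarrow> \<alpha> x = 0" "\<And>x. 1 < \<bar>x\<bar> \<Longrightarrow> \<gamma> x = 0"
  shows "\<alpha> (k * (fst z - fst y)) * \<gamma> (k * (snd z - snd y)) = 0"
proof -
  have "1 / k < \<bar>fst z - fst y\<bar> \<or> 1 / k < \<bar>snd z - snd y\<bar>"
    using assms(2) by (cases y) (auto simp: sq_def abs_if)
  moreover have "1 < \<bar>k * t\<bar>" if "1 / k < \<bar>t\<bar>" for t
    using that assms(1) by (simp add: abs_mult field_simps)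
  ultimately show ?thesis using assms(3,4) by auto
qed

lemma bump_vanish: "1 < \<bar>x\<bar> \<Longrightarrow> bump x = 0" by (simp add: bump_zero)

lemma smear_cong_AE:
  assumes k: "0 < k" and ker: "cont_bdd \<alpha>" "cont_bdd \<gamma>" "\<And>x. 1 < \<bar>x\<bar> \<Longrightarrow> \<alpha> x = 0" "\<And>x. 1 < \<bar>x\<bar> \<Longrightarrow> \<gamma> x = 0"
    and pq: "p \<in> borel_measurable borel" "q \<in> borel_measurable borel"
    and eq: "AE y in lborel. y \<in> sq z (1 / k) \<longrightarrow> p y = q y"
  shows "smear \<alpha> \<gamma> k p z = smear \<alpha> \<gamma> k q z"
  unfolding smear_def
proof (rule integral_cong_AE)
  show "AE y in lborel. p y * (\<alpha> (k * (fst z - fst y)) * \<gamma> (k * (snd z - snd y)))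
      = q y * (\<alpha> (k * (fst z - fst y)) * \<gamma> (k * (snd z - snd y)))"
    using eq
  proof eventually_elim
    case (elim y)
    then show ?case using smear_kernel_zero[where \<alpha>=\<alpha> and \<gamma>=\<gamma>, OF k _ ker(3,4), of y z]
      by (cases "y \<in> sq z (1 / k)") auto
  qed
qed (use smear_integrand_measurable[OF ker(1,2) pq(1)] smear_integrand_measurable[OF ker(1,2) pq(2)] in auto)

text \<open>The kernel centred at \<open>z\<close>, placed in row \<open>i\<close>, is admissible
  once its support lies in \<open>\<Omega>\<close>. Testing with it turns the weak equations into
  pointwise equations for mollifications.\<close>

lemma mollifier_test_field:
  fixes z :: "real \<times> real" and i :: 2
  assumes k: "0 < k" and sub: "to_vec ` sq z (1 / k) \<subseteq> \<Omega>"
  defines "\<eta> \<equiv> \<lambda>x. bump (k * (fst z - x $ 1)) *\<^sub>R (bump (k * (snd z - x $ 2)) *\<^sub>R axis i (1 :: real))"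
  shows "\<eta> \<in> test_fields \<Omega>"
    and "D \<eta> x $ i' $ 1 = - k * (deriv bump (k * (fst z - x $ 1)) * bump (k * (snd z - x $ 2))) * (axis i 1 :: real^2) $ i'"
    and "D \<eta> x $ i' $ 2 = - k * (bump (k * (fst z - x $ 1)) * deriv bump (k * (snd z - x $ 2))) * (axis i 1 :: real^2) $ i'"
proof -
  have smooth: "C_k m \<eta>" for m
  proof -
    have l: "bounded_linear (\<lambda>x :: real^2. - k * x $ j)" for j
      by (intro bounded_linear_const_mult bounded_linear_vec_nth)
    have "C_k m (\<lambda>x :: real^2. bump (k * fst z + (- k * x $ 1)) *\<^sub>R (bump (k * snd z + (- k * x $ 2)) *\<^sub>R axis i (1 :: real)))"
      by (intro C_k_scaleR C_k_const C_k_compose_affine[OF C_k_bump l])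
    then show ?thesis unfolding \<eta>_def by (simp add: algebra_simps)
  qed
  have "{x. \<eta> x \<noteq> 0} \<subseteq> to_vec ` sq z (1 / k)"
  proof
    fix x assume x: "x \<in> {x. \<eta> x \<noteq> 0}"
    have "of_vec x \<in> sq z (1 / k)"
    proof (rule ccontr)
      assume "of_vec x \<notin> sq z (1 / k)"
      from smear_kernel_zero[where \<alpha>=bump and \<gamma>=bump, OF k this bump_vanish bump_vanish] x show False
        by (auto simp: \<eta>_def of_vec_def)
    qed
    then have "to_vec (of_vec x) \<in> to_vec ` sq z (1 / k)" by (rule imageI)
    then show "x \<in> to_vec ` sq z (1 / k)" by simp
  qed
  moreover have cpt: "compact (to_vec ` sq z (1 / k))"
    by (intro compact_continuous_image continuous_to_vec compact_sq)
  ultimately have cl: "closure {x. \<eta> x \<noteq> 0} \<subseteq> to_vec ` sq z (1 / k)"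
    by (intro closure_minimal compact_imp_closed)
  have "compact (closure {x. \<eta> x \<noteq> 0})"
    using cl bounded_subset[OF compact_imp_bounded[OF cpt]] by (simp add: compact_eq_bounded_closed)
  then show "\<eta> \<in> test_fields \<Omega>" unfolding test_fields_def using smooth cl sub by blast
  have d: "(bump has_real_derivative deriv bump s) (at s)" for s
    by (rule C_k_real_deriv(1)[OF C_k_bump[of "Suc 0"]])
  have lin: "((\<lambda>x :: real^2. k * (c - x $ j)) has_derivative (\<lambda>v. - k * v $ j)) (at x)" for c j x
    by (auto intro!: derivative_eq_intros bounded_linear_imp_has_derivative[OF bounded_linear_vec_nth] simp: algebra_simps)
  have comp: "((\<lambda>x :: real^2. bump (k * (c - x $ j))) has_derivative (\<lambda>v. deriv bump (k * (c - x $ j)) * (- k * v $ j))) (at x)" for c j x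
    using has_derivative_compose[OF lin d[unfolded has_field_derivative_def]] .
  have "(\<eta> has_derivative (\<lambda>v. bump (k * (fst z - x $ 1)) *\<^sub>R ((deriv bump (k * (snd z - x $ 2)) * (- k * v $ 2)) *\<^sub>R axis i 1)
     + (deriv bump (k * (fst z - x $ 1)) * (- k * v $ 1)) *\<^sub>R (bump (k * (snd z - x $ 2)) *\<^sub>R axis i 1))) (at x)"
    unfolding \<eta>_def by (intro has_derivative_scaleR comp has_derivative_scaleR_left)
  note fd = frechet_derivative_at[OF this]
  show "D \<eta> x $ i' $ 1 = - k * (deriv bump (k * (fst z - x $ 1)) * bump (k * (snd z - x $ 2))) * (axis i 1 :: real^2) $ i'"
    "D \<eta> x $ i' $ 2 = - k * (bump (k * (fst z - x $ 1)) * deriv bump (k * (snd z - x $ 2))) * (axis i 1 :: real^2) $ i'"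
    unfolding jacobian_def matrix_def fd[symmetric] by (simp_all add: axis_def)
qed

text \<open>Tested with the kernel at \<open>z\<close>, row \<open>i\<close> of the equation says
  that the mollified row has divergence zero at \<open>z\<close>. The row enters through integrable
  representatives \<open>a1\<close>, \<open>a2\<close>, since \<open>A\<close> is controlled only
  almost everywhere near \<open>z\<close>.\<close>

lemma weakly_div_free_smear:
  assumes div: "weakly_div_free \<Omega> A" and k: "0 < k" and sub: "to_vec ` sq z (1 / k) \<subseteq> \<Omega>"
    and a: "integrable lborel a1" "integrable lborel a2"
    and A: "AE y in lborel. y \<in> sq z (1 / k) \<longrightarrow> A (to_vec y) $ i $ 1 = a1 y \<and> A (to_vec y) $ i $ 2 = a2 y"
  shows "smear (deriv bump) bump k a1 z + smear bump (deriv bump) k a2 z = 0"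
proof -
  define \<eta> where "\<eta> x = bump (k * (fst z - x $ 1)) *\<^sub>R (bump (k * (snd z - x $ 2)) *\<^sub>R axis i (1 :: real))" for x :: "real^2"
  note \<eta> = mollifier_test_field[OF k sub, where i=i, folded \<eta>_def[abs_def]]
  define G where "G y = - k * (a1 y * (deriv bump (k * (fst z - fst y)) * bump (k * (snd z - snd y)))
    + a2 y * (bump (k * (fst z - fst y)) * deriv bump (k * (snd z - snd y))))" for y
  have i1: "integrable lborel (\<lambda>y. a1 y * (deriv bump (k * (fst z - fst y)) * bump (k * (snd z - snd y))))"
    by (rule smear_integrable[OF cont_bdd_bump(2,1) a(1)])
  have i2: "integrable lborel (\<lambda>y. a2 y * (bump (k * (fst z - fst y)) * deriv bump (k * (snd z - snd y))))"
    by (rule smear_integrable[OF cont_bdd_bump(1,2) a(2)])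
  have Gi: "integrable lborel G" unfolding G_def[abs_def] using i1 i2 by (intro integrable_mult_right Bochner_Integration.integrable_add)
  then have Gm[measurable]: "G \<in> borel_measurable borel" using borel_measurable_integrable by force
  have inner: "A x \<bullet> D \<eta> x = A x $ i $ 1 * (- k * (deriv bump (k * (fst z - x $ 1)) * bump (k * (snd z - x $ 2))))
     + A x $ i $ 2 * (- k * (bump (k * (fst z - x $ 1)) * deriv bump (k * (snd z - x $ 2))))" for x
  proof -
    have "A x \<bullet> D \<eta> x = (\<Sum>i'\<in>UNIV. A x $ i' $ 1 * (D \<eta> x $ i' $ 1) + A x $ i' $ 2 * (D \<eta> x $ i' $ 2))"
      by (simp add: inner_vec_def sum_2)
    also have "\<dots> = (\<Sum>i'\<in>UNIV. if i' = i then A x $ i $ 1 * (- k * (deriv bump (k * (fst z - x $ 1)) * bump (k * (snd z - x $ 2))))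
     + A x $ i $ 2 * (- k * (bump (k * (fst z - x $ 1)) * deriv bump (k * (snd z - x $ 2)))) else 0)"
      unfolding \<eta>(2,3) by (rule sum.cong) (auto simp: axis_def)
    finally show ?thesis by (simp add: sum.delta)
  qed
  have ae: "AE x in lebesgue. G (of_vec x) = indicat_real \<Omega> x *\<^sub>R (A x \<bullet> D \<eta> x)"
  proof (rule AE_to_vecI)
    show "AE y in lborel. G (of_vec (to_vec y)) = indicat_real \<Omega> (to_vec y) *\<^sub>R (A (to_vec y) \<bullet> D \<eta> (to_vec y))"
      using A
    proof eventually_elim
      case (elim y)
      show ?case
      proof (cases "y \<in> sq z (1 / k)")
        case True
        then have "to_vec y \<in> \<Omega>" using sub by blast
        then show ?thesis using elim True unfolding inner G_def by (simp add: algebra_simps)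
      next
        case False
        have 0: "deriv bump (k * (fst z - fst y)) * bump (k * (snd z - snd y)) = 0"
          "bump (k * (fst z - fst y)) * deriv bump (k * (snd z - snd y)) = 0"
          by (rule smear_kernel_zero[OF k False]; simp add: deriv_bump_zero bump_vanish)+
        show ?thesis unfolding inner G_def of_to_vec to_vec_nth 0 by simp
      qed
    qed
  qed
  \<comment> \<open>Measurability of the integrand with \<open>A\<close> is not given; it is
    inherited from the Borel function \<open>G\<close>, with which it agrees almost
    everywhere.\<close>
  have Gv: "(\<lambda>x. G (of_vec x)) \<in> borel_measurable borel" by measurable
  then have Gl: "(\<lambda>x. G (of_vec x)) \<in> borel_measurable lebesgue" by (simp add: measurable_completion)
  have "(LINT x|lebesgue. G (of_vec x)) = (LINT x|lebesgue. indicat_real \<Omega> x *\<^sub>R (A x \<bullet> D \<eta> x))"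
    by (rule integral_cong_AE[OF Gl borel_measurable_AE[OF Gl ae] ae])
  also have "\<dots> = 0" using div \<eta>(1) unfolding weakly_div_free_def set_lebesgue_integral_def by blast
  also have "(LINT x|lebesgue. G (of_vec x)) = (LINT x|lborel. G (of_vec x))"
    using Gv by (intro integral_completion) simp
  also have "\<dots> = (LINT y|lborel. G (of_vec (to_vec y)))"
    using Gv by (subst lborel_to_vec, subst integral_distr) auto
  also have "\<dots> = - k * (smear (deriv bump) bump k a1 z + smear bump (deriv bump) k a2 z)"
    unfolding of_to_vec G_def smear_def using i1 i2 by simp
  finally show ?thesis using k by simp
qed

text \<open>The mollifications converge to \<open>p\<close> in \<open>L\<^sup>1\<close>, and a limit
  of constants on a set of finite measure is constant.\<close>

lemma AE_constant_of_mollify: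
  fixes p :: "real \<times> real \<Rightarrow> real"
  assumes p: "p \<in> borel_measurable borel" "\<And>z. \<bar>p z\<bar> \<le> M" "\<And>z. R < norm z \<Longrightarrow> p z = 0" and R: "0 < R"
    and S: "compact S" and c: "\<And>n z. n0 \<le> n \<Longrightarrow> z \<in> S \<Longrightarrow> mollify (real (Suc n)) p z = m n"
  shows "\<exists>\<kappa>. AE z in lborel. z \<in> S \<longrightarrow> p z = \<kappa>"
proof (cases "S = {}")
  case False
  then obtain s where s: "s \<in> S" by blast
  have pi: "integrable lborel p" by (rule integrable_bounded_support[OF p])
  have Sb[measurable]: "S \<in> sets borel" using S by (rule borel_compact)
  have Sfin: "emeasure lborel S < \<infinity>" using S by (intro emeasure_bounded_finite compact_imp_bounded)
  define m' where "m' n = m (n0 + n)" for n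
  \<comment> \<open>The constants are not known to converge, but they are bounded, and a subsequence
    suffices.\<close>
  have "m' n \<in> cball 0 M" for n
    using mollify_bound[OF _ pi p(2), of "real (Suc (n0 + n))" s] c[of "n0 + n" s] s by (simp add: m'_def)
  then obtain \<kappa> r where r: "strict_mono (r :: nat \<Rightarrow> nat)" and lim: "(m' \<circ> r) \<longlonglongrightarrow> \<kappa>"
    using compact_cball[of "0 :: real" M] unfolding compact_def by meson
  have fin: "set_integrable lborel S (\<lambda>z. c)" for c :: real
    unfolding set_integrable_def using Sfin by (auto intro!: integrable_mult_left integrable_real_indicator)
  have pS: "set_integrable lborel S p" unfolding set_integrable_def using pi by (intro integrable_mult_indicator) auto
  have i0: "set_integrable lborel S (\<lambda>z. \<bar>\<kappa> - p z\<bar>)" by (intro set_integrable_abs set_integral_diff fin pS)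
  have i1: "integrable lborel (\<lambda>z. \<bar>mollify (real (Suc n)) p z - p z\<bar>)" for n
    by (intro integrable_abs Bochner_Integration.integrable_diff pi mollify_L1(2)[OF p R])
  have le: "(LINT z:S|lborel. \<bar>\<kappa> - p z\<bar>) \<le> \<bar>\<kappa> - m' (r n)\<bar> * measure lborel S
      + (LINT z|lborel. \<bar>mollify (real (Suc (n0 + r n))) p z - p z\<bar>)" for n
  proof -
    have iS: "set_integrable lborel S (\<lambda>z. \<bar>mollify (real (Suc (n0 + r n))) p z - p z\<bar>)"
      unfolding set_integrable_def by (intro integrable_mult_indicator i1) simp
    have "(LINT z:S|lborel. \<bar>\<kappa> - p z\<bar>) \<le> (LINT z:S|lborel. \<bar>\<kappa> - m' (r n)\<bar> + \<bar>mollify (real (Suc (n0 + r n))) p z - p z\<bar>)"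
    proof (rule set_integral_mono[OF i0 set_integral_add(1)[OF fin iS]])
      fix z assume "z \<in> S"
      then have "mollify (real (Suc (n0 + r n))) p z = m' (r n)" unfolding m'_def by (intro c) auto
      then show "\<bar>\<kappa> - p z\<bar> \<le> \<bar>\<kappa> - m' (r n)\<bar> + \<bar>mollify (real (Suc (n0 + r n))) p z - p z\<bar>" by linarith
    qed
    also have "\<dots> = (LINT z:S|lborel. \<bar>\<kappa> - m' (r n)\<bar>) + (LINT z:S|lborel. \<bar>mollify (real (Suc (n0 + r n))) p z - p z\<bar>)"
      by (rule set_integral_add(2)[OF fin iS])
    also have "(LINT z:S|lborel. \<bar>\<kappa> - m' (r n)\<bar>) = \<bar>\<kappa> - m' (r n)\<bar> * measure lborel S"
      by (simp add: set_lebesgue_integral_def mult.commute)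
    also have "(LINT z:S|lborel. \<bar>mollify (real (Suc (n0 + r n))) p z - p z\<bar>) \<le> (LINT z|lborel. \<bar>mollify (real (Suc (n0 + r n))) p z - p z\<bar>)"
      unfolding set_lebesgue_integral_def
      by (intro integral_mono integrable_mult_indicator i1) (auto simp: indicator_def)
    finally show ?thesis by simp
  qed
  have "filterlim (\<lambda>n. n0 + r n) sequentially sequentially"
    using filterlim_subseq[OF r] by (rule filterlim_at_top_mono) simp
  from filterlim_compose[OF mollify_L1(1)[OF p R] this]
  have e0: "(\<lambda>n. LINT z|lborel. \<bar>mollify (real (Suc (n0 + r n))) p z - p z\<bar>) \<longlonglongrightarrow> 0" .
  have "(\<lambda>n. \<bar>\<kappa> - m' (r n)\<bar> * measure lborel S + (LINT z|lborel. \<bar>mollify (real (Suc (n0 + r n))) p z - p z\<bar>))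
      \<longlonglongrightarrow> \<bar>\<kappa> - \<kappa>\<bar> * measure lborel S + 0"
    by (intro tendsto_intros e0 lim[unfolded o_def])
  then have "(LINT z:S|lborel. \<bar>\<kappa> - p z\<bar>) \<le> \<bar>\<kappa> - \<kappa>\<bar> * measure lborel S + 0"
    by (rule LIMSEQ_le_const) (use le in blast)
  then have "(LINT z|lborel. indicat_real S z *\<^sub>R \<bar>\<kappa> - p z\<bar>) \<le> 0" by (simp add: set_lebesgue_integral_def)
  moreover have "0 \<le> (LINT z|lborel. indicat_real S z *\<^sub>R \<bar>\<kappa> - p z\<bar>)"
    by (rule Bochner_Integration.integral_nonneg) simp
  ultimately have "(LINT z|lborel. indicat_real S z *\<^sub>R \<bar>\<kappa> - p z\<bar>) = 0" by (rule antisym)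
  then have "AE z in lborel. indicat_real S z *\<^sub>R \<bar>\<kappa> - p z\<bar> = 0"
    using i0 unfolding set_integrable_def by (subst (asm) integral_nonneg_eq_0_iff_AE) auto
  then have "AE z in lborel. z \<in> S \<longrightarrow> p z = \<kappa>" by eventually_elim auto
  then show ?thesis by blast
qed simp

text \<open>The determinant is affine in each single entry, with the cofactor as its slope.\<close>

lemma matrix_gradient_det:
  fixes f :: "real^2^2 \<Rightarrow> real"
  assumes f: "\<And>X. f X = g (det X)" and g: "\<And>t. g differentiable (at t)"
  shows "matrix_gradient f X $ 1 $ 1 = deriv g (det X) * X $ 2 $ 2" "matrix_gradient f X $ 1 $ 2 = - (deriv g (det X) * X $ 2 $ 1)"
    "matrix_gradient f X $ 2 $ 1 = - (deriv g (det X) * X $ 1 $ 2)" "matrix_gradient f X $ 2 $ 2 = deriv g (det X) * X $ 1 $ 1"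
proof -
  have dg: "(g has_real_derivative deriv g t) (at t)" for t
    using g[of t] by (simp add: DERIV_deriv_iff_real_differentiable)
  have *: "matrix_gradient f X $ i $ j = deriv g (det X) * c"
    if "\<And>t. det (X + t *\<^sub>R axis i (axis j 1)) = det X + t * c" for i j c
  proof -
    have "((\<lambda>t. g (det X + t * c)) has_real_derivative deriv g (det X + 0 * c) * c) (at 0)"
      by (rule DERIV_chain2[OF dg]) (auto intro!: derivative_eq_intros)
    then have "deriv (\<lambda>t. f (X + t *\<^sub>R axis i (axis j 1))) 0 = deriv g (det X) * c"
      unfolding f that by (intro DERIV_imp_deriv) simp
    then show ?thesis by (simp add: matrix_gradient_def)
  qed
  have "matrix_gradient f X $ 1 $ 2 = deriv g (det X) * - X $ 2 $ 1" "matrix_gradient f X $ 2 $ 1 = deriv g (det X) * - X $ 1 $ 2"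
    by (rule *, simp add: det_2 axis_def algebra_simps)+
  then show "matrix_gradient f X $ 1 $ 2 = - (deriv g (det X) * X $ 2 $ 1)"
    "matrix_gradient f X $ 2 $ 1 = - (deriv g (det X) * X $ 1 $ 2)" by simp_all
  show "matrix_gradient f X $ 1 $ 1 = deriv g (det X) * X $ 2 $ 2" "matrix_gradient f X $ 2 $ 2 = deriv g (det X) * X $ 1 $ 1"
    by (rule *, simp add: det_2 axis_def algebra_simps)+
qed

lemma energy_momentum_tensor:
  fixes f :: "real^2^2 \<Rightarrow> real"
  assumes f: "\<And>X. f X = g (det X)" and g: "\<And>t. g differentiable (at t)"
  defines "T \<equiv> \<lambda>X. transpose X ** matrix_gradient f X - f X *\<^sub>R mat 1"
  shows "T X $ 1 $ 1 = deriv g (det X) * det X - g (det X)" "T X $ 1 $ 2 = 0"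
    "T X $ 2 $ 1 = 0" "T X $ 2 $ 2 = deriv g (det X) * det X - g (det X)"
  unfolding T_def
  by (simp_all add: f[of X] matrix_matrix_mult_def transpose_def sum_2 matrix_gradient_det[OF f g] mat_def det_2 algebra_simps)

text \<open>\<open>h s\<close> is the Legendre transform of \<open>g\<close> at
  \<open>deriv g s\<close>. It decreases and then increases, which is what leaves two candidates for
  the determinant; the last claim separates them in the first equation.\<close>

lemma legendre_injective:
  fixes g :: "real \<Rightarrow> real"
  assumes g: "\<And>t. g differentiable (at t)" "\<And>t. deriv g differentiable (at t)" and conv: "\<And>t. deriv (deriv g) t > 0"
  defines "h \<equiv> \<lambda>s. deriv g s * s - g s"
  shows "0 \<le> s \<Longrightarrow> 0 \<le> t \<Longrightarrow> h s = h t \<Longrightarrow> s = t" "s \<le> 0 \<Longrightarrow> t \<le> 0 \<Longrightarrow> h s = h t \<Longrightarrow> s = t"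
    "s < t \<Longrightarrow> deriv g s < deriv g t"
proof -
  have d1: "(g has_real_derivative deriv g t) (at t)" for t
    using g(1)[of t] by (simp add: DERIV_deriv_iff_real_differentiable)
  have d2: "(deriv g has_real_derivative deriv (deriv g) t) (at t)" for t
    using g(2)[of t] by (simp add: DERIV_deriv_iff_real_differentiable)
  have dh: "(h has_real_derivative deriv (deriv g) t * t) (at t)" for t
    unfolding h_def by (auto intro!: derivative_eq_intros d1 d2)
  have ch: "continuous_on A h" for A by (meson DERIV_isCont dh continuous_at_imp_continuous_on)
  have inc: "h s < h t" if "0 \<le> s" "s < t" for s t
    by (rule DERIV_pos_imp_increasing_open[OF that(2) _ ch]) (use dh conv that in \<open>meson mult_pos_pos less_le_trans order_le_less_trans\<close>)
  have dec: "h t < h s" if "t \<le> 0" "s < t" for s t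
    by (rule DERIV_neg_imp_decreasing_open[OF that(2) _ ch]) (use dh conv that in \<open>meson mult_pos_neg less_le_trans\<close>)
  show "0 \<le> s \<Longrightarrow> 0 \<le> t \<Longrightarrow> h s = h t \<Longrightarrow> s = t" using inc[of s t] inc[of t s] by linarith
  show "s \<le> 0 \<Longrightarrow> t \<le> 0 \<Longrightarrow> h s = h t \<Longrightarrow> s = t" using dec[of s t] dec[of t s] by linarith
  show "s < t \<Longrightarrow> deriv g s < deriv g t"
    by (rule DERIV_pos_imp_increasing[of s t]) (use d2 conv in blast)+
qed

lemma jacobian_of_components:
  fixes u :: "real^2 \<Rightarrow> real^2"
  assumes w: "(w1 has_derivative A1) (at y)" "(w2 has_derivative A2) (at y)"
    and U: "open U" "y \<in> U" "\<And>z. z \<in> U \<Longrightarrow> u (to_vec z) $ 1 = w1 z" "\<And>z. z \<in> U \<Longrightarrow> u (to_vec z) $ 2 = w2 z"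
  shows "D u (to_vec y) $ 1 $ 1 = A1 (1, 0)" "D u (to_vec y) $ 1 $ 2 = A1 (0, 1)"
    "D u (to_vec y) $ 2 $ 1 = A2 (1, 0)" "D u (to_vec y) $ 2 $ 2 = A2 (0, 1)"
proof -
  have o: "(of_vec has_derivative of_vec) (at (to_vec y))" by (rule bounded_linear_imp_has_derivative[OF bounded_linear_of_vec])
  have "((\<lambda>x. w1 (of_vec x) *\<^sub>R axis 1 1 + w2 (of_vec x) *\<^sub>R axis 2 1 :: real^2) has_derivative
      (\<lambda>v. A1 (of_vec v) *\<^sub>R axis 1 1 + A2 (of_vec v) *\<^sub>R axis 2 1)) (at (to_vec y))"
    using w by (intro has_derivative_add has_derivative_scaleR_left has_derivative_compose[OF o]) auto
  then have "(u has_derivative (\<lambda>v. A1 (of_vec v) *\<^sub>R axis 1 1 + A2 (of_vec v) *\<^sub>R axis 2 1)) (at (to_vec y))"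
  proof (rule has_derivative_transform_within_open)
    show "open (of_vec -` U)" using U(1) by (intro open_vimage continuous_of_vec)
    show "to_vec y \<in> of_vec -` U" using U(2) by simp
    fix x assume "x \<in> of_vec -` U"
    then have "u (to_vec (of_vec x)) $ 1 = w1 (of_vec x)" "u (to_vec (of_vec x)) $ 2 = w2 (of_vec x)" using U(3,4)[of "of_vec x"] by auto
    then show "w1 (of_vec x) *\<^sub>R axis 1 1 + w2 (of_vec x) *\<^sub>R axis 2 1 = u x"
      by (simp add: vec_eq_iff forall_2 axis_def)
  qed
  note fd = frechet_derivative_at[OF this]
  show "D u (to_vec y) $ 1 $ 1 = A1 (1, 0)" "D u (to_vec y) $ 1 $ 2 = A1 (0, 1)"
    "D u (to_vec y) $ 2 $ 1 = A2 (1, 0)" "D u (to_vec y) $ 2 $ 2 = A2 (0, 1)"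
    unfolding jacobian_def matrix_def fd[symmetric] by (simp_all add: axis_def of_vec_def)
qed

lemma smear_linear_combination:
  assumes "cont_bdd \<alpha>" "cont_bdd \<gamma>" "integrable lborel p" "integrable lborel q"
  shows "smear \<alpha> \<gamma> k (\<lambda>y. (p y - c * q y) / e) z = (smear \<alpha> \<gamma> k p z - c * smear \<alpha> \<gamma> k q z) / e"
proof -
  define ker where "ker y = \<alpha> (k * (fst z - fst y)) * \<gamma> (k * (snd z - snd y))" for y :: "real \<times> real"
  have i: "integrable lborel (\<lambda>y. p y * ker y)" "integrable lborel (\<lambda>y. q y * ker y)"
    unfolding ker_def by (rule smear_integrable[OF assms(1,2,3)], rule smear_integrable[OF assms(1,2,4)])
  have "smear \<alpha> \<gamma> k (\<lambda>y. (p y - c * q y) / e) z = (LINT y|lborel. (p y * ker y - c * (q y * ker y)) / e)"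
    unfolding smear_def ker_def by (rule Bochner_Integration.integral_cong) (simp_all add: left_diff_distrib)
  also have "\<dots> = ((LINT y|lborel. p y * ker y) - c * (LINT y|lborel. q y * ker y)) / e"
    using i by simp
  finally show ?thesis unfolding smear_def ker_def .
qed

text \<open>All analysis takes place in a ball around \<open>x0\<close>, where the components of
  \<open>u\<close> are replaced by compactly supported Lipschitz functions.\<close>

lemma det_locally_constant:
  fixes g :: "real \<Rightarrow> real" and f :: "real^2^2 \<Rightarrow> real"
    and \<Omega> :: "(real^2) set" and u :: "real^2 \<Rightarrow> real^2" and L :: real
  assumes g_C2: "\<And>t. g differentiable (at t)" "\<And>t. deriv g differentiable (at t)"
    and g_convex: "\<And>t. deriv (deriv g) t > 0"
    and g_zero: "g 0 = 0" "deriv g 0 = 0"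
    and f_def: "\<And>X. f X = g (det X)"
    and \<Omega>: "open \<Omega>"
    and u_lipschitz: "L-lipschitz_on \<Omega> u"
    and u_stationary: "stationary_point f \<Omega> u"
    and x0: "x0 \<in> \<Omega>"
  shows "\<exists>V c. open V \<and> x0 \<in> V \<and> (AE x in lebesgue. x \<in> V \<longrightarrow> det (D u x) = c)"
proof -
  obtain \<rho> where \<rho>: "0 < \<rho>" "cball x0 \<rho> \<subseteq> \<Omega>" using \<Omega> x0 open_contains_cball by blast
  define z0 where "z0 = of_vec x0"
  have x0z: "x0 = to_vec z0" by (simp add: z0_def)
  have in\<Omega>: "to_vec z \<in> \<Omega>" if "z \<in> cball z0 \<rho>" for z
    using that \<rho>(2) by (auto simp: x0z dist_to_vec)
  have lipi: "L-lipschitz_on (cball z0 \<rho>) (\<lambda>z. u (to_vec z) $ i)" for i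
  proof (rule lipschitz_onI)
    fix x y assume "x \<in> cball z0 \<rho>" "y \<in> cball z0 \<rho>"
    then have "dist (u (to_vec x)) (u (to_vec y)) \<le> L * dist x y"
      using lipschitz_onD[OF u_lipschitz in\<Omega> in\<Omega>] by (simp add: dist_to_vec)
    then show "dist (u (to_vec x) $ i) (u (to_vec y) $ i) \<le> L * dist x y"
      using dist_vec_nth_le[of "u (to_vec x)" i] order_trans by blast
  qed (use lipschitz_on_nonneg[OF u_lipschitz] in blast)
  obtain w1 C1 R1 where w1: "C1-lipschitz_on UNIV w1" "\<And>x. x \<in> cball z0 \<rho> \<Longrightarrow> w1 x = u (to_vec x) $ 1"
    "0 < R1" "\<And>x. R1 < norm x \<Longrightarrow> w1 x = 0"
    by (rule lipschitz_compact_extension[OF lipi[of 1] \<rho>(1)]) (rule that)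
  obtain w2 C2 R2 where w2: "C2-lipschitz_on UNIV w2" "\<And>x. x \<in> cball z0 \<rho> \<Longrightarrow> w2 x = u (to_vec x) $ 2"
    "0 < R2" "\<And>x. R2 < norm x \<Longrightarrow> w2 x = 0"
    by (rule lipschitz_compact_extension[OF lipi[of 2] \<rho>(1)]) (rule that)
  interpret W1: lipschitz_compact w1 C1 R1 using w1 by unfold_locales auto
  interpret W2: lipschitz_compact w2 C2 R2 using w2 by unfold_locales auto
  \<comment> \<open>Borel representatives of the entries of \<open>D u\<close>, defined everywhere;
    \<open>Du\<close> shows that they agree almost everywhere on the ball.\<close>
  define p1 q1 p2 q2 where pq: "p1 = pderiv_lim C1 w1 (1, 0)" "q1 = pderiv_lim C1 w1 (0, 1)"
    "p2 = pderiv_lim C2 w2 (1, 0)" "q2 = pderiv_lim C2 w2 (0, 1)"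
  have n1: "norm (1 :: real, 0 :: real) \<le> 1" "norm (0 :: real, 1 :: real) \<le> 1" by (simp_all add: norm_Pair)
  \<comment> \<open>One bound for all entries; the \<open>1\<close> keeps it positive when both
    Lipschitz constants are \<open>0\<close>.\<close>
  define K where "K = C1 + C2 + 1"
  define R where "R = R1 + R2 + 1"
  have K: "0 < K" and R: "0 < R" using W1.C0 W2.C0 w1(3) w2(3) by (auto simp: K_def R_def)
  have m[measurable]: "p1 \<in> borel_measurable borel" "q1 \<in> borel_measurable borel" "p2 \<in> borel_measurable borel" "q2 \<in> borel_measurable borel"
    unfolding pq by measurable
  have bd: "\<bar>p1 y\<bar> \<le> K" "\<bar>q1 y\<bar> \<le> K" "\<bar>p2 y\<bar> \<le> K" "\<bar>q2 y\<bar> \<le> K" for y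
    using W1.pderiv_lim_bound[of "(1,0)" y] W1.pderiv_lim_bound[of "(0,1)" y] W2.pderiv_lim_bound[of "(1,0)" y]
      W2.pderiv_lim_bound[of "(0,1)" y] W1.C0 W2.C0 unfolding pq K_def by linarith+
  have sp: "p1 y = 0" "q1 y = 0" "p2 y = 0" "q2 y = 0" if "R < norm y" for y
    using that w1(3) w2(3) W1.pderiv_lim_supp[OF n1(1), of y] W1.pderiv_lim_supp[OF n1(2), of y]
      W2.pderiv_lim_supp[OF n1(1), of y] W2.pderiv_lim_supp[OF n1(2), of y] unfolding pq R_def by auto
  have pqi: "integrable lborel p1" "integrable lborel q1" "integrable lborel p2" "integrable lborel q2"
    by (rule integrable_bounded_support[OF m(1) bd(1) sp(1)], assumption, rule integrable_bounded_support[OF m(2) bd(2) sp(2)], assumption,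
      rule integrable_bounded_support[OF m(3) bd(3) sp(3)], assumption, rule integrable_bounded_support[OF m(4) bd(4) sp(4)], assumption)
  have Du: "AE y in lborel. y \<in> ball z0 \<rho> \<longrightarrow> D u (to_vec y) $ 1 $ 1 = p1 y \<and> D u (to_vec y) $ 1 $ 2 = q1 y
     \<and> D u (to_vec y) $ 2 $ 1 = p2 y \<and> D u (to_vec y) $ 2 $ 2 = q2 y"
    using rademacher_plane[OF w1(1)] rademacher_plane[OF w2(1)]
  proof eventually_elim
    case (elim y)
    then obtain A1 A2 where A: "(w1 has_derivative A1) (at y)" "(w2 has_derivative A2) (at y)"
      by (auto simp: differentiable_def)
    show ?case
    proof (intro impI)
      assume y: "y \<in> ball z0 \<rho>"
      have e: "u (to_vec z) $ 1 = w1 z" "u (to_vec z) $ 2 = w2 z" if "z \<in> ball z0 \<rho>" for z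
        using w1(2)[of z] w2(2)[of z] that by auto
      note J = jacobian_of_components[OF A open_ball y e]
      show "D u (to_vec y) $ 1 $ 1 = p1 y \<and> D u (to_vec y) $ 1 $ 2 = q1 y
         \<and> D u (to_vec y) $ 2 $ 1 = p2 y \<and> D u (to_vec y) $ 2 $ 2 = q2 y"
        unfolding pq using J W1.dquot_tendsto(2)[OF A(1) n1(1)] W1.dquot_tendsto(2)[OF A(1) n1(2)]
          W2.dquot_tendsto(2)[OF A(2) n1(1)] W2.dquot_tendsto(2)[OF A(2) n1(2)] by simp
    qed
  qed
  \<comment> \<open>Nested squares: the test kernels live in radius \<open>3 * t\<close>,
    \<open>hd\<close> is constant in radius \<open>2 * t\<close>, the mollified fields are curl free
    in radius \<open>t\<close>, and the conclusion holds in radius \<open>t / 8\<close>. The largest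
    square lies in the ball because \<open>6 * t < \<rho>\<close>.\<close>
  define t where "t = \<rho> / 8"
  have t: "0 < t" using \<rho> by (simp add: t_def)
  have sqball: "sq z0 r \<subseteq> ball z0 \<rho>" if "r \<le> 3 * t" for r
  proof
    fix y assume y: "y \<in> sq z0 r"
    have "dist z0 y \<le> \<bar>fst z0 - fst y\<bar> + \<bar>snd z0 - snd y\<bar>"
      unfolding dist_prod_def dist_real_def by (simp add: sqrt_sum_squares_le_sum_abs)
    also have "\<dots> \<le> 6 * t" using y that by (cases y) (auto simp: sq_def abs_if)
    finally show "y \<in> ball z0 \<rho>" using \<rho> by (simp add: t_def)
  qed
  define d where "d y = p1 y * q2 y - q1 y * p2 y" for y
  have dm[measurable]: "d \<in> borel_measurable borel" unfolding d_def[abs_def] by measurable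
  have dbd: "\<bar>d y\<bar> \<le> 2 * K\<^sup>2" for y
  proof -
    have "\<bar>p1 y * q2 y\<bar> \<le> K * K" "\<bar>q1 y * p2 y\<bar> \<le> K * K"
      unfolding abs_mult using bd[of y] K by (auto intro!: mult_mono)
    then show ?thesis unfolding d_def power2_eq_square by linarith
  qed
  have dsp: "d y = 0" if "R < norm y" for y using sp[OF that] by (simp add: d_def)
  have detd: "AE y in lborel. y \<in> ball z0 \<rho> \<longrightarrow> det (D u (to_vec y)) = d y"
    using Du by eventually_elim (auto simp: det_2 d_def)
  define dg where "dg = deriv g"
  define h where "h s = dg s * s - g s" for s
  have cg: "continuous_on A g" "continuous_on A dg" for A
    using g_C2 unfolding dg_def by (auto intro!: continuous_at_imp_continuous_on differentiable_imp_continuous_within)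
  have ch: "continuous_on A h" for A unfolding h_def by (intro continuous_intros cg)
  have h0: "h 0 = 0" using g_zero by (simp add: h_def)
  obtain B where B: "\<And>y. \<bar>dg (d y)\<bar> \<le> B" and H: "\<And>y. \<bar>h (d y)\<bar> \<le> B"
  proof -
    have "bounded (dg ` {- (2 * K\<^sup>2)..2 * K\<^sup>2})" "bounded (h ` {- (2 * K\<^sup>2)..2 * K\<^sup>2})"
      using cg(2) ch by (auto intro!: compact_imp_bounded compact_continuous_image)
    then obtain b1 b2 where b: "\<forall>y\<in>dg ` {- (2 * K\<^sup>2)..2 * K\<^sup>2}. norm y \<le> b1" "\<forall>y\<in>h ` {- (2 * K\<^sup>2)..2 * K\<^sup>2}. norm y \<le> b2"
      unfolding bounded_iff by blast
    have "d y \<in> {- (2 * K\<^sup>2)..2 * K\<^sup>2}" for y using dbd[of y] by (auto simp: abs_le_iff)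
    then have "\<bar>dg (d y)\<bar> \<le> b1" "\<bar>h (d y)\<bar> \<le> b2" for y using b by auto
    then show ?thesis by (intro that[of "max b1 b2"]) (auto simp: le_max_iff_disj)
  qed
  have B0: "0 \<le> B" using B[of 0] by simp
  have dgm[measurable]: "dg \<in> borel_measurable borel" "h \<in> borel_measurable borel"
    by (auto intro: borel_measurable_continuous_onI cg ch)
  have dgi: "integrable lborel (\<lambda>y. dg (d y) * w y)" if "w \<in> borel_measurable borel" "\<And>y. \<bar>w y\<bar> \<le> K" "\<And>y. R < norm y \<Longrightarrow> w y = 0" for w
  proof (rule integrable_bounded_support[of _ "B * K" R])
    show "(\<lambda>y. dg (d y) * w y) \<in> borel_measurable borel" using that(1) by measurable
    show "\<bar>dg (d y) * w y\<bar> \<le> B * K" for y unfolding abs_mult using B that(2) B0 by (intro mult_mono) auto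
  qed (use that(3) in simp)
  have dgi4: "integrable lborel (\<lambda>y. dg (d y) * p1 y)" "integrable lborel (\<lambda>y. dg (d y) * q1 y)"
    "integrable lborel (\<lambda>y. dg (d y) * p2 y)" "integrable lborel (\<lambda>y. dg (d y) * q2 y)"
    by (rule dgi[OF m(1) bd(1) sp(1)], assumption, rule dgi[OF m(2) bd(2) sp(2)], assumption,
      rule dgi[OF m(3) bd(3) sp(3)], assumption, rule dgi[OF m(4) bd(4) sp(4)], assumption)
  define hd where "hd y = h (d y)" for y
  have hdm[measurable]: "hd \<in> borel_measurable borel" unfolding hd_def[abs_def] by measurable
  have hdb: "\<bar>hd y\<bar> \<le> B" for y unfolding hd_def by (rule H)
  have hds: "hd y = 0" if "R < norm y" for y unfolding hd_def dsp[OF that] by (rule h0)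
  have hdi: "integrable lborel hd" by (rule integrable_bounded_support[OF hdm hdb hds])
  define A1 where "A1 x = matrix_gradient f (D u x)" for x
  define A2 where "A2 x = transpose (D u x) ** matrix_gradient f (D u x) - f (D u x) *\<^sub>R mat 1" for x
  have div: "weakly_div_free \<Omega> A1" "weakly_div_free \<Omega> A2"
    using u_stationary unfolding stationary_point_def A1_def[abs_def] A2_def[abs_def] by auto
  \<comment> \<open>The rows of the first equation, after a rotation, say that \<open>dg (d)\<close>
    times the second and the first row of \<open>D u\<close> are curl free. The other two equations
    say that the mollified \<open>hd\<close> has zero gradient, since the energy-momentum tensor is
    \<open>hd\<close> times the identity.\<close>
  have eqs: "smear (deriv bump) bump k (\<lambda>y. dg (d y) * q2 y) z = smear bump (deriv bump) k (\<lambda>y. dg (d y) * p2 y) z"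
      "smear (deriv bump) bump k (\<lambda>y. dg (d y) * q1 y) z = smear bump (deriv bump) k (\<lambda>y. dg (d y) * p1 y) z"
      "smear (deriv bump) bump k hd z = 0" "smear bump (deriv bump) k hd z = 0"
    if k: "0 < k" and sub: "sq z (1 / k) \<subseteq> sq z0 (3 * t)" for k z
  proof -
    have sub': "sq z (1 / k) \<subseteq> ball z0 \<rho>" using sub sqball[of "3 * t"] by auto
    have sub\<Omega>: "to_vec ` sq z (1 / k) \<subseteq> \<Omega>" using sub' ball_subset_cball in\<Omega> by blast
    have neg: "smear \<alpha> \<gamma> k (\<lambda>y. - w y) z = - smear \<alpha> \<gamma> k w z" for \<alpha> \<gamma> w
      by (simp add: smear_def)
    have zero: "smear \<alpha> \<gamma> k (\<lambda>y. 0) z = 0" for \<alpha> \<gamma> by (simp add: smear_def)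
    have a: "AE y in lborel. y \<in> sq z (1 / k) \<longrightarrow>
       A1 (to_vec y) $ 1 $ 1 = dg (d y) * q2 y \<and> A1 (to_vec y) $ 1 $ 2 = - (dg (d y) * p2 y)
       \<and> A1 (to_vec y) $ 2 $ 1 = - (dg (d y) * q1 y) \<and> A1 (to_vec y) $ 2 $ 2 = dg (d y) * p1 y
       \<and> A2 (to_vec y) $ 1 $ 1 = hd y \<and> A2 (to_vec y) $ 1 $ 2 = 0 \<and> A2 (to_vec y) $ 2 $ 1 = 0 \<and> A2 (to_vec y) $ 2 $ 2 = hd y"
      using Du detd
    proof eventually_elim
      case (elim y)
      show ?case
      proof (intro impI)
        assume "y \<in> sq z (1 / k)"
        then have "y \<in> ball z0 \<rho>" using sub' by blast
        then have e: "D u (to_vec y) $ 1 $ 1 = p1 y" "D u (to_vec y) $ 1 $ 2 = q1 y"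
          "D u (to_vec y) $ 2 $ 1 = p2 y" "D u (to_vec y) $ 2 $ 2 = q2 y" "det (D u (to_vec y)) = d y" using elim by auto
        show "A1 (to_vec y) $ 1 $ 1 = dg (d y) * q2 y \<and> A1 (to_vec y) $ 1 $ 2 = - (dg (d y) * p2 y)
           \<and> A1 (to_vec y) $ 2 $ 1 = - (dg (d y) * q1 y) \<and> A1 (to_vec y) $ 2 $ 2 = dg (d y) * p1 y
           \<and> A2 (to_vec y) $ 1 $ 1 = hd y \<and> A2 (to_vec y) $ 1 $ 2 = 0 \<and> A2 (to_vec y) $ 2 $ 1 = 0 \<and> A2 (to_vec y) $ 2 $ 2 = hd y"
          unfolding A1_def A2_def matrix_gradient_det[OF f_def g_C2(1)] energy_momentum_tensor[OF f_def g_C2(1)] e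
          by (simp add: dg_def hd_def h_def)
      qed
    qed
    have "AE y in lborel. y \<in> sq z (1 / k) \<longrightarrow> A1 (to_vec y) $ 1 $ 1 = dg (d y) * q2 y \<and> A1 (to_vec y) $ 1 $ 2 = - (dg (d y) * p2 y)"
      using a by eventually_elim blast
    from weakly_div_free_smear[OF div(1) k sub\<Omega> dgi4(4) integrable_minus[OF dgi4(3)] this]
    show "smear (deriv bump) bump k (\<lambda>y. dg (d y) * q2 y) z = smear bump (deriv bump) k (\<lambda>y. dg (d y) * p2 y) z"
      unfolding neg by simp
    have "AE y in lborel. y \<in> sq z (1 / k) \<longrightarrow> A1 (to_vec y) $ 2 $ 1 = - (dg (d y) * q1 y) \<and> A1 (to_vec y) $ 2 $ 2 = dg (d y) * p1 y"
      using a by eventually_elim blast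
    from weakly_div_free_smear[OF div(1) k sub\<Omega> integrable_minus[OF dgi4(2)] dgi4(1) this]
    show "smear (deriv bump) bump k (\<lambda>y. dg (d y) * q1 y) z = smear bump (deriv bump) k (\<lambda>y. dg (d y) * p1 y) z"
      unfolding neg by simp
    have z: "integrable lborel (\<lambda>y :: real \<times> real. 0 :: real)" by simp
    have "AE y in lborel. y \<in> sq z (1 / k) \<longrightarrow> A2 (to_vec y) $ 1 $ 1 = hd y \<and> A2 (to_vec y) $ 1 $ 2 = 0"
      using a by eventually_elim blast
    from weakly_div_free_smear[OF div(2) k sub\<Omega> hdi z this]
    show "smear (deriv bump) bump k hd z = 0" unfolding zero by simp
    have "AE y in lborel. y \<in> sq z (1 / k) \<longrightarrow> A2 (to_vec y) $ 2 $ 1 = 0 \<and> A2 (to_vec y) $ 2 $ 2 = hd y"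
      using a by eventually_elim blast
    from weakly_div_free_smear[OF div(2) k sub\<Omega> z hdi this]
    show "smear bump (deriv bump) k hd z = 0" unfolding zero by simp
  qed
  obtain n0 where n0: "1 / real (Suc n0) < t" using nat_approx_posE[OF t] by auto
  have nn: "1 / real (Suc n) \<le> t" if "n0 \<le> n" for n
  proof -
    have "1 / real (Suc n) \<le> 1 / real (Suc n0)" using that by (intro divide_left_mono) auto
    then show ?thesis using n0 by simp
  qed
  have sqsub: "sq z r \<subseteq> sq z0 (r + r')" if "z \<in> sq z0 r'" for z r r'
    using that by (cases z) (auto simp: sq_def)
  obtain \<kappa> where \<kappa>: "AE y in lborel. y \<in> sq z0 (2 * t) \<longrightarrow> hd y = \<kappa>"
  proof -
    have "mollify (real (Suc n)) hd z = mollify (real (Suc n)) hd z0" if n: "n0 \<le> n" and z: "z \<in> sq z0 (2 * t)" for n z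
    proof -
      let ?k = "real (Suc n)"
      have dz: "mollify_dx ?k hd y = 0" "mollify_dy ?k hd y = 0" if "y \<in> sq z0 (2 * t)" for y
      proof -
        have "sq y (1 / ?k) \<subseteq> sq z0 (1 / ?k + 2 * t)" by (rule sqsub[OF that])
        also have "\<dots> \<subseteq> sq z0 (3 * t)" using nn[OF n] by (intro sq_mono) simp
        finally show "mollify_dx ?k hd y = 0" "mollify_dy ?k hd y = 0"
          unfolding mollify_dx_def mollify_dy_def using eqs(3,4)[of ?k y] by simp_all
      qed
      let ?X = "{fst z0 - 2 * t..fst z0 + 2 * t}" and ?Y = "{snd z0 - 2 * t..snd z0 + 2 * t}"
      obtain z1 z2 where zz: "z = (z1, z2)" "z1 \<in> ?X" "z2 \<in> ?Y" using z by (cases z) (auto simp: sq_def)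
      have dx: "((\<lambda>x. mollify ?k hd (x, z2)) has_real_derivative 0) (at x within ?X)" if "x \<in> ?X" for x
        using has_field_derivative_at_within[OF mollify_DERIV(1)[OF hdi, of ?k z2 x], of ?X] dz(1)[of "(x, z2)"] that zz(3)
        by (simp add: sq_def del: of_nat_Suc)
      have dy: "((\<lambda>y. mollify ?k hd (fst z0, y)) has_real_derivative 0) (at y within ?Y)" if "y \<in> ?Y" for y
        using has_field_derivative_at_within[OF mollify_DERIV(2)[OF hdi, of ?k "fst z0" y], of ?Y] dz(2)[of "(fst z0, y)"] that t
        by (simp add: sq_def del: of_nat_Suc)
      have "norm (mollify ?k hd (z1, z2) - mollify ?k hd (fst z0, z2)) \<le> 0 * norm (z1 - fst z0)"
        by (rule field_differentiable_bound[of ?X "\<lambda>x. mollify ?k hd (x, z2)" "\<lambda>_. 0"]) (use zz t dx in auto)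
      moreover have "norm (mollify ?k hd (fst z0, z2) - mollify ?k hd (fst z0, snd z0)) \<le> 0 * norm (z2 - snd z0)"
        by (rule field_differentiable_bound[of ?Y "\<lambda>x. mollify ?k hd (fst z0, x)" "\<lambda>_. 0"]) (use zz t dy in auto)
      ultimately show ?thesis unfolding zz by (simp del: of_nat_Suc)
    qed
    from AE_constant_of_mollify[OF hdm hdb hds R compact_sq(1) this] that show ?thesis by blast
  qed
  note inj = legendre_injective[OF g_C2 g_convex, folded dg_def, folded h_def]
  define Q where "Q = sq z0 (2 * t)"
  \<comment> \<open>\<open>0\<close> is a dummy: then \<open>d \<le> 0\<close> occurs only on a null set, and \<open>a \<le> 0 < b\<close> still gives \<open>g' a < g' b\<close>.\<close>
  define a where "a = (if \<exists>s\<le>0. h s = \<kappa> then SOME s. s \<le> 0 \<and> h s = \<kappa> else 0)"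
  have a0: "a \<le> 0"
  proof (cases "\<exists>s\<le>0. h s = \<kappa>")
    case True
    then show ?thesis using someI_ex[of "\<lambda>s. s \<le> 0 \<and> h s = \<kappa>"] by (simp add: a_def)
  next
    case False
    then show ?thesis by (simp only: a_def if_False order_refl)
  qed
  have a: "s = a" if "s \<le> 0" "h s = \<kappa>" for s
  proof -
    have ex: "\<exists>s. s \<le> 0 \<and> h s = \<kappa>" using that by blast
    have "a \<le> 0 \<and> h a = \<kappa>" using someI_ex[OF ex] ex by (simp add: a_def)
    then show ?thesis using inj(2)[of s a] that by simp
  qed
  \<comment> \<open>The condition \<open>hd y = \<kappa>\<close> makes \<open>d\<close> equal to
    \<open>b\<close> at every point of \<open>E\<close> and not just almost everywhere:
    \<open>qr_gradient\<close> asks for the Jacobian pointwise.\<close>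
  define E where "E = {y \<in> Q. 0 < d y \<and> hd y = \<kappa>}"
  have E_meas[measurable]: "E \<in> sets borel"
  proof -
    have "E = Q \<inter> (d -` {0<..} \<inter> space borel) \<inter> (hd -` {\<kappa>} \<inter> space borel)" by (auto simp: E_def)
    then show ?thesis unfolding Q_def using measurable_sets[OF dm, of "{0<..}"] measurable_sets[OF hdm, of "{\<kappa>}"] by auto
  qed
  \<comment> \<open>Almost everywhere in \<open>Q\<close> the value of \<open>hd\<close> is
    \<open>\<kappa>\<close>, so a point outside \<open>E\<close> has \<open>d \<le> 0\<close>, where
    \<open>a\<close> is the only solution.\<close>
  have notE: "AE y in lborel. y \<in> Q \<longrightarrow> y \<notin> E \<longrightarrow> d y = a"
    using \<kappa> by eventually_elim (use a in \<open>auto simp: E_def Q_def hd_def not_less\<close>)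
  have "\<exists>c. AE y in lborel. y \<in> sq z0 (t / 8) \<longrightarrow> d y = c"
  proof (cases "E = {}")
    case True
    have "AE y in lborel. y \<in> sq z0 (t / 8) \<longrightarrow> d y = a"
      using notE by eventually_elim (use sq_mono[of "t / 8" "2 * t" z0] t True in \<open>auto simp: Q_def\<close>)
    then show ?thesis by blast
  next
    case False
    then obtain y0 where y0: "y0 \<in> E" by blast
    define b where "b = d y0"
    have b: "0 < b" "h b = \<kappa>" using y0 by (auto simp: E_def b_def hd_def)
    have db: "d y = b" if "y \<in> E" for y using inj(1)[of "d y" b] that b by (auto simp: E_def hd_def)
    \<comment> \<open>Positive because \<open>dg\<close> increases strictly and
      \<open>a \<le> 0 < b\<close>; dividing by it isolates the indicator of
      \<open>E\<close>.\<close>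
    define \<Delta> where "\<Delta> = dg b - dg a"
    have \<Delta>: "\<Delta> > 0" using inj(3)[of a b] a0 b by (simp add: \<Delta>_def)
    define I where "I w y = indicator E y * w y" for w :: "real \<times> real \<Rightarrow> real" and y
    have Ib: "\<bar>I w y\<bar> \<le> K * indicator E y" if "\<And>y. \<bar>w y\<bar> \<le> K" for w y
      using that[of y] by (cases "y \<in> E") (auto simp: I_def)
    have Im: "I w \<in> borel_measurable borel" if "w \<in> borel_measurable borel" for w
      unfolding I_def[abs_def] using that by measurable
    have curl: "mollify_dy (real (Suc n)) (I p) x = mollify_dx (real (Suc n)) (I q) x"
      if n: "n0 \<le> n" and x: "x \<in> sq z0 t" and pm: "p \<in> borel_measurable borel" "q \<in> borel_measurable borel"
        and pi: "integrable lborel p" "integrable lborel q"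
        and gi: "integrable lborel (\<lambda>y. dg (d y) * p y)" "integrable lborel (\<lambda>y. dg (d y) * q y)"
        and e1: "smear bump (deriv bump) (real (Suc n)) p x = smear (deriv bump) bump (real (Suc n)) q x"
        and e2: "smear (deriv bump) bump (real (Suc n)) (\<lambda>y. dg (d y) * q y) x = smear bump (deriv bump) (real (Suc n)) (\<lambda>y. dg (d y) * p y) x"
      for n x p q
    proof -
      let ?k = "real (Suc n)"
      have k: "0 < ?k" by simp
      have "sq x (1 / ?k) \<subseteq> sq z0 (1 / ?k + t)" by (rule sqsub[OF x])
      also have "\<dots> \<subseteq> Q" unfolding Q_def using nn[OF n] by (intro sq_mono) simp
      finally have subQ: "sq x (1 / ?k) \<subseteq> Q" .
      \<comment> \<open>\<open>(dg (d) - dg a) / \<Delta>\<close> is \<open>1\<close> on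
        \<open>E\<close> and \<open>0\<close> almost everywhere on the rest of \<open>Q\<close>. So
        \<open>I w\<close> is a combination of \<open>dg (d) * w\<close> and \<open>w\<close>, whose
        curl identities are \<open>e2\<close> and \<open>e1\<close>.\<close>
      have eq: "AE y in lborel. y \<in> sq x (1 / ?k) \<longrightarrow> I w y = (dg (d y) * w y - dg a * w y) / \<Delta>" for w
        using notE
      proof eventually_elim
        case (elim y)
        show ?case
        proof (intro impI)
          assume "y \<in> sq x (1 / ?k)"
          then have y: "y \<in> Q" using subQ by blast
          show "I w y = (dg (d y) * w y - dg a * w y) / \<Delta>"
          proof (cases "y \<in> E")
            case True
            then show ?thesis using db[OF True] \<Delta> by (simp add: I_def \<Delta>_def left_diff_distrib[symmetric])
          next
            case False
            then show ?thesis using elim y by (simp add: I_def)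
          qed
        qed
      qed
      have wm: "(\<lambda>y. (dg (d y) * w y - dg a * w y) / \<Delta>) \<in> borel_measurable borel" if "w \<in> borel_measurable borel" for w
        using that by measurable
      have "smear bump (deriv bump) ?k (I p) x = smear bump (deriv bump) ?k (\<lambda>y. (dg (d y) * p y - dg a * p y) / \<Delta>) x"
        by (rule smear_cong_AE[OF k cont_bdd_bump(1,2) bump_vanish deriv_bump_zero Im[OF pm(1)] wm[OF pm(1)] eq])
      also have "\<dots> = (smear bump (deriv bump) ?k (\<lambda>y. dg (d y) * p y) x - dg a * smear bump (deriv bump) ?k p x) / \<Delta>"
        by (rule smear_linear_combination[OF cont_bdd_bump(1,2) gi(1) pi(1)])
      also have "\<dots> = (smear (deriv bump) bump ?k (\<lambda>y. dg (d y) * q y) x - dg a * smear (deriv bump) bump ?k q x) / \<Delta>"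
        unfolding e1 e2 ..
      also have "\<dots> = smear (deriv bump) bump ?k (\<lambda>y. (dg (d y) * q y - dg a * q y) / \<Delta>) x"
        by (rule smear_linear_combination[OF cont_bdd_bump(2,1) gi(2) pi(2), symmetric])
      also have "\<dots> = smear (deriv bump) bump ?k (I q) x"
        by (rule smear_cong_AE[OF k cont_bdd_bump(2,1) deriv_bump_zero bump_vanish Im[OF pm(2)] wm[OF pm(2)] eq, symmetric])
      finally show ?thesis by (simp add: mollify_dx_def mollify_dy_def)
    qed
    have sub3: "sq x (1 / real (Suc n)) \<subseteq> sq z0 (3 * t)" if "n0 \<le> n" "x \<in> sq z0 t" for n x
      using sqsub[OF that(2), of "1 / real (Suc n)"] sq_mono[of "1 / real (Suc n) + t" "3 * t" z0] nn[OF that(1)] t by auto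
    interpret qr_gradient E "I p1" "I q1" "I p2" "I q2" K b "norm z0 + 4 * t" t z0 n0
    proof
      show "E \<in> sets borel" by (rule E_meas)
      show "I p1 \<in> borel_measurable borel" "I q1 \<in> borel_measurable borel" "I p2 \<in> borel_measurable borel" "I q2 \<in> borel_measurable borel"
        by (intro Im m)+
      show "\<bar>I p1 x\<bar> \<le> K * indicator E x" "\<bar>I q1 x\<bar> \<le> K * indicator E x" "\<bar>I p2 x\<bar> \<le> K * indicator E x"
        "\<bar>I q2 x\<bar> \<le> K * indicator E x" for x by (intro Ib bd)+
      show "I p1 x * I q2 x - I q1 x * I p2 x = b * indicator E x" for x
        using db[of x] by (cases "x \<in> E") (auto simp: I_def d_def)
      show "norm x \<le> norm z0 + 4 * t" if "x \<in> E" for x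
      proof -
        have x: "x \<in> sq z0 (2 * t)" using that by (simp add: E_def Q_def)
        have "norm (x - z0) \<le> \<bar>fst x - fst z0\<bar> + \<bar>snd x - snd z0\<bar>"
          by (cases x, cases z0) (simp add: norm_Pair sqrt_sum_squares_le_sum_abs)
        also have "\<dots> \<le> 4 * t" using x by (cases x) (auto simp: sq_def abs_if)
        finally show ?thesis using norm_triangle_sub[of x z0] by simp
      qed
      show "0 < K" "0 < b" by (rule K, rule b)
      show "0 < norm z0 + 4 * t" using t by (simp add: add_nonneg_pos)
      show "mollify_dy (real (Suc n)) (I p1) x = mollify_dx (real (Suc n)) (I q1) x" if "n0 \<le> n" "x \<in> sq z0 t" for n x
        by (rule curl[OF that m(1,2) pqi(1,2) dgi4(1,2)])
          (use W1.weak_curl_free eqs(2)[OF _ sub3[OF that]] in \<open>simp_all add: pq del: of_nat_Suc\<close>)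
      show "mollify_dy (real (Suc n)) (I p2) x = mollify_dx (real (Suc n)) (I q2) x" if "n0 \<le> n" "x \<in> sq z0 t" for n x
        by (rule curl[OF that m(3,4) pqi(3,4) dgi4(3,4)])
          (use W2.weak_curl_free eqs(1)[OF _ sub3[OF that]] in \<open>simp_all add: pq del: of_nat_Suc\<close>)
    qed
    from null_or_full[OF t] show ?thesis
    proof
      assume "E \<inter> sq z0 (t / 8) \<in> null_sets lborel"
      from AE_not_in[OF this] have "AE y in lborel. y \<in> sq z0 (t / 8) \<longrightarrow> d y = a"
        using notE by eventually_elim (use sq_mono[of "t / 8" "2 * t" z0] t in \<open>auto simp: Q_def\<close>)
      then show ?thesis by blast
    next
      assume "sq z0 (t / 8) - E \<in> null_sets lborel"
      from AE_not_in[OF this] have "AE y in lborel. y \<in> sq z0 (t / 8) \<longrightarrow> d y = b"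
        by eventually_elim (use db in auto)
      then show ?thesis by blast
    qed
  qed
  then obtain c where c: "AE y in lborel. y \<in> sq z0 (t / 8) \<longrightarrow> d y = c" by blast
  have "AE x in lebesgue. x \<in> ball x0 (t / 8) \<longrightarrow> det (D u x) = c"
  proof (rule AE_to_vecI)
    show "AE y in lborel. to_vec y \<in> ball x0 (t / 8) \<longrightarrow> det (D u (to_vec y)) = c"
      using c detd
    proof eventually_elim
      case (elim y)
      show ?case
      proof (intro impI)
        assume "to_vec y \<in> ball x0 (t / 8)"
        then have dy: "dist z0 y < t / 8" by (simp add: x0z dist_to_vec)
        then have "y \<in> ball z0 \<rho>" using t by (simp add: t_def)
        moreover have "y \<in> sq z0 (t / 8)"
          using dy dist_fst_le[of z0 y] dist_snd_le[of z0 y] by (cases y) (auto simp: sq_def dist_real_def abs_if split: if_splits)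
        ultimately show "det (D u (to_vec y)) = c" using elim by simp
      qed
    qed
  qed
  then show ?thesis using t by (intro exI[of _ "ball x0 (t / 8)"] exI[of _ c]) auto
qed

section \<open>From local to global constancy\<close>

theorem theorem2:
  fixes g :: "real \<Rightarrow> real" and f :: "real^2^2 \<Rightarrow> real"
    and \<Omega> :: "(real^2) set" and u :: "real^2 \<Rightarrow> real^2" and L :: real
  assumes g_C2: "\<And>t. g differentiable (at t)" "\<And>t. deriv g differentiable (at t)"
      "continuous_on UNIV (deriv (deriv g))"
    and g_convex: "\<And>t. deriv (deriv g) t > 0"
    and g_zero: "g 0 = 0" "deriv g 0 = 0"
    and f_def: "\<And>X. f X = g (det X)"
    and \<Omega>: "open \<Omega>" "connected \<Omega>"
    and u_lipschitz: "L-lipschitz_on \<Omega> u"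
    and u_stationary: "stationary_point f \<Omega> u"
  shows "\<exists>c. AE x in lebesgue_on \<Omega>. det (D u x) = c"
proof (cases "\<Omega> = {}")
  case True
  then have "AE x in lebesgue_on \<Omega>. det (D u x) = 0" by (simp add: AE_restrict_space_iff)
  then show ?thesis by blast
next
  case False
  then obtain x0 where x0: "x0 \<in> \<Omega>" by blast
  define P where "P c V \<longleftrightarrow> open V \<and> V \<subseteq> \<Omega> \<and> (AE x in lebesgue. x \<in> V \<longrightarrow> det (D u x) = c)" for c V
  \<comment> \<open>These sets are open, cover \<open>\<Omega>\<close> and are disjoint for
    different \<open>c\<close>; connectedness leaves a single one.\<close>
  define W where "W c = \<Union>{V. P c V}" for c
  have opn: "open (W c)" for c unfolding W_def by (rule open_Union) (simp add: P_def)
  have sub: "W c \<subseteq> \<Omega>" for c by (auto simp: W_def P_def)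
  have cover: "\<exists>c. x \<in> W c" if x: "x \<in> \<Omega>" for x
  proof -
    obtain V c where V: "open V" "x \<in> V" "AE x in lebesgue. x \<in> V \<longrightarrow> det (D u x) = c"
      using det_locally_constant[OF g_C2(1,2) g_convex g_zero f_def \<Omega>(1) u_lipschitz u_stationary x] by blast
    have "AE x in lebesgue. x \<in> V \<inter> \<Omega> \<longrightarrow> det (D u x) = c" using V(3) by eventually_elim simp
    then have "P c (V \<inter> \<Omega>)" unfolding P_def using V \<Omega> by auto
    then show ?thesis using V(2) x unfolding W_def by blast
  qed
  \<comment> \<open>On an overlap the determinant would have two values almost everywhere; an open
    null set is empty.\<close>
  have disj: "c = c'" if "x \<in> W c" "x \<in> W c'" for x c c'
  proof (rule ccontr)
    assume ne: "c \<noteq> c'"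
    obtain V V' where V: "P c V" "x \<in> V" "P c' V'" "x \<in> V'" using \<open>x \<in> W c\<close> \<open>x \<in> W c'\<close> unfolding W_def by blast
    have 1: "AE x in lebesgue. x \<in> V \<longrightarrow> det (D u x) = c" and 2: "AE x in lebesgue. x \<in> V' \<longrightarrow> det (D u x) = c'"
      using V unfolding P_def by auto
    have "AE y in lebesgue. y \<notin> V \<inter> V'" using 1 2 by eventually_elim (use ne in auto)
    moreover have o: "open (V \<inter> V')" using V unfolding P_def by auto
    ultimately have "V \<inter> V' \<in> null_sets lebesgue"
      by (subst AE_iff_null_sets) (auto intro: lmeasurable_open simp: borel_open sets_completionI_sets)
    then have "V \<inter> V' = {}" using o open_not_negligible negligible_iff_null_sets by blast
    then show False using V by blast
  qed
  obtain c where c: "x0 \<in> W c" using cover[OF x0] by blast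
  have "W c = \<Omega>"
  proof (rule ccontr)
    assume "W c \<noteq> \<Omega>"
    then obtain y where y: "y \<in> \<Omega>" "y \<notin> W c" using sub by blast
    define U where "U = (\<Union>c'\<in>-{c}. W c')"
    have "open U" unfolding U_def using opn by blast
    moreover have "\<Omega> \<subseteq> W c \<union> U" using cover unfolding U_def by blast
    moreover have "W c \<inter> U \<inter> \<Omega> = {}" using disj unfolding U_def by blast
    moreover have "W c \<inter> \<Omega> \<noteq> {}" using c x0 by blast
    moreover have "U \<inter> \<Omega> \<noteq> {}" using y cover[OF y(1)] unfolding U_def by blast
    ultimately show False using connectedD[OF \<Omega>(2) opn[of c]] by blast
  qed
  \<comment> \<open>Exceptional null sets may be united only countably often, so Lindelof's theorem
    extracts a countable subfamily with the same union.\<close>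
  moreover obtain \<V> where \<V>: "\<V> \<subseteq> {V. P c V}" "countable \<V>" "\<Union>\<V> = \<Union>{V. P c V}"
    by (rule Lindelof[of "{V. P c V}"]) (auto simp: P_def)
  ultimately have un: "\<Union>\<V> = \<Omega>" by (simp add: W_def)
  have "AE x in lebesgue. \<forall>V\<in>\<V>. x \<in> V \<longrightarrow> det (D u x) = c"
    using \<V>(1,2) by (subst AE_ball_countable) (auto simp: P_def)
  then have "AE x in lebesgue. x \<in> \<Omega> \<longrightarrow> det (D u x) = c"
    by eventually_elim (use un in blast)
  then have "AE x in lebesgue_on \<Omega>. det (D u x) = c"
    using \<Omega>(1) by (subst AE_restrict_space_iff) (auto simp: borel_open sets_completionI_sets)
  then show ?thesis by blast
qed

end
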